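(* Let $S^3=\{\nu\in\mathbb{R}^4 : \|\nu\|=1\}$, and let the critical surface $S=\{\nu\in\mathbb{R}^4 : F(\nu)=0 \text{ and } \|\nu\|=1\}$, the sets $V_1,\ldots,V_4$, $S_1,\ldots,S_4$, $L_1,\ldots,L_6$, $P_1,\ldots,P_6\subset S^3$ and the matrices $H_r(\nu)$ be as defined in the context. Then: (i) The collection $\{V_1,\ldots,V_4,S_1,\ldots,S_4,L_1,\ldots,L_6,P_1,\ldots,P_6\}$ is a Whitney stratification of the $3$-sphere $S^3$. (ii) Its incidences between $n$- and $(n+1)$-dimensional strata (a stratum $X$ of dimension $n$ is incident to a stratum $Y$ of dimension $n+1$ iff $X\subset\overline{Y}$) are exactly the following. Points in lines: $P_1,P_5\subset\overline{L_1}$; $P_2,P_5\subset\overline{L_2}$; $P_3,P_6\subset\overline{L_3}$; $P_4,P_6\subset\overline{L_4}$; $P_5,P_6\subset\overline{L_5}$; $P_5,P_6\subset\overline{L_6}$. Lines in surfaces: $L_1$ and $L_3$ are each incident to exactly $S_1,S_3$; $L_2$ and $L_4$ are each incident to exactly $S_2,S_4$; $L_5$ and $L_6$ are each incident to all of $S_1,S_2,S_3,S_4$. Surfaces in $3$-dimensional strata: $V_1$ is incident to exactly $S_1,S_4$; $V_2$ to exactly $S_1,S_3$; $V_3$ to exactly $S_2,S_3$; $V_4$ to exactly $S_2,S_4$. (iii) The sub-collection $\{S_1,\ldots,S_4,L_1,\ldots,L_6,P_1,\ldots,P_6\}$ is a Whitney stratification of the critical surface $S$. (iv) The eigenvalue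 configuration of $H_r(\nu)$ is constant on each stratum and is: $\gamma_{+1}\gamma_{+2}$ on $V_1$; $\gamma_{-1}\gamma_{-2}$ on $V_3$; $\gamma_+\gamma_-$ on $V_2$ and $V_4$; $\beta\gamma_+$ on $S_1$ and $S_4$; $\beta\gamma_-$ on $S_2$ and $S_3$; $\beta_1\beta_2$ on $L_1,\ldots,L_6$; $\beta^2$ on $P_1,\ldots,P_4$; $\beta_1\beta_2$ on $P_5,P_6$. (v) In particular, $V_3$ is the stability domain on the $3$-sphere, i.e. $V_3=\{\nu\in S^3 : \text{every eigenvalue of } H_r(\nu) \text{ has negative real part}\}$.
   Context: Matrices. Let $I=\begin{pmatrix}1&0\\0&1\end{pmatrix}$, $R=\begin{pmatrix}1&0\\0&-1\end{pmatrix}$, $J=\begin{pmatrix}0&1\\-1&0\end{pmatrix}$, and in $\mathfrak{gl}(4,\mathbb{R})$ (in $2\times2$ blocks) $M_1=\begin{pmatrix}I&0\\0&I\end{pmatrix}$, $M_4=\begin{pmatrix}0&J\\-J&0\end{pmatrix}$, $M_5=L=\begin{pmatrix}0&I\\-I&0\end{pmatrix}$, $M_6=\begin{pmatrix}0&R\\-R&0\end{pmatrix}$, $M_8=\begin{pmatrix}J&0\\0&J\end{pmatrix}$. For $\nu=(\nu_1,\nu_2,\nu_3,\nu_4)\in\mathbb{R}^4$ put $H_r(\nu)=\nu_1M_1+\nu_2M_4+\nu_3M_6+\nu_4M_8+\nu_5M_5$ (the homogeneous reduced centralizer unfolding of $L$), where $\nu_5\neq0$ is fixed and $|\nu_5|$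 is large enough that $H_r(\nu)$ has no real eigenvalue for any $\nu$ with $\|\nu\|=1$ (Euclidean norm on $\mathbb{R}^4$). Critical surface. $F(\nu)=(\nu_1^2-\nu_2^2)(\nu_1^2+\nu_4^2)+\nu_1^2\nu_3^2$, and $S=\{\nu\in\mathbb{R}^4 : F(\nu)=0 \text{ and } \|\nu\|=1\}$. Parameterization. Let $D^{\pm}=\{\nu\in S^3: \pm\nu_3\ge 0\}$; a point of $D^{\pm}$ is identified with its coordinates $(\nu_1,\nu_2,\nu_4)$, with $\nu_3=\pm\sqrt{1-\nu_1^2-\nu_2^2-\nu_4^2}$. Let $\phi^{\pm}:[-1,1]\times[0,2\pi]\to D^{\pm}$ be given in these coordinates by $$\phi^{\pm}(s,t)=(\nu_1,\nu_2,\nu_4)=\left(\tfrac12\sqrt2\,s\cos t,\ \tfrac12\sqrt2\cos t,\ s\sin t\right).$$ The images $S^{\pm}$ of $\phi^{\pm}$ are the $2$-dimensional parts of $S$ in $D^{\pm}$. Strata. $2$-dimensional: each $S_i$ is the union of the images under $\phi^+$ and $\phi^-$ of the following subset of $[-1,1]\times[0,2\pi]$: $S_1$: $s>0,\cos t>0$; $S_2$: $s>0,\cos t<0$; $S_3$: $s<0,\cos t>0$; $S_4$: $s<0,\cos t<0$. $1$-dimensional (subsets of $S^3$ in coordinates $(\nu_1,\nu_2,\nu_3,\nu_4)$): $L_1$: $\nu_1=\nu_4=0$, $0<\nu_2<\tfrac12\sqrt2$, $\nu_3>0$; $L_2$: $\nu_1=\nu_4=0$, $-\tfrac12\sqrt2<\nu_2<0$,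 $\nu_3>0$; $L_3$: $\nu_1=\nu_4=0$, $0<\nu_2<\tfrac12\sqrt2$, $\nu_3<0$; $L_4$: $\nu_1=\nu_4=0$, $-\tfrac12\sqrt2<\nu_2<0$, $\nu_3<0$; $L_5$: $\nu_1=\nu_2=0$, $\nu_4>0$; $L_6$: $\nu_1=\nu_2=0$, $\nu_4<0$. $0$-dimensional, with $h=\tfrac12\sqrt2$: $P_1=(0,h,h,0)$, $P_2=(0,-h,h,0)$, $P_3=(0,h,-h,0)$, $P_4=(0,-h,-h,0)$, $P_5=(0,0,1,0)$, $P_6=(0,0,-1,0)$ (as strata, these are the singletons). $3$-dimensional: $\overline{S_1}\cup\overline{S_4}$ is a topological $2$-sphere in $S^3$ with $S_2$ and $S_3$ both on one side of it (the outside); $V_1$ is the open topological $3$-disc on the other side (the inside). In the same way $V_2$, $V_3$, $V_4$ are the open topological $3$-discs enclosed by the topological $2$-spheres $\overline{S_1}\cup\overline{S_3}$, $\overline{S_3}\cup\overline{S_2}$, $\overline{S_2}\cup\overline{S_4}$ respectively, in each case on the side not containing the two remaining $S_j$. Whitney stratification. A stratification of a subset $V$ of a manifold is a locally finite partition of $V$ into locally closed smooth submanifolds (strata) such that $X\cap\overline{Y}\ne\emptyset$ implies $X\subset\overline{Y}$ for strata $X,Y$. It is called a Whitney stratification if in addition, for each pair of strata with $X\subset\overline{Y}$ and all sequences $y_k\in Y$ with $y_k\to x\in X$, the tangent space $T=\lim_{k\to\infty}T_{y_k}Y$ satisfies $T_xX\subset T$. Eigenvalue configurations. Two collections of eigenvalues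 $(\lambda_1,\ldots,\lambda_n)$ and $(\delta_1,\ldots,\delta_n)$ belong to the same eigenvalue configuration if there is a permutation $\pi$ of $\{1,\ldots,n\}$ such that, for all $i$, with $j=\pi(i)$: (1) either $\mathrm{Sgn}(\mathrm{Re}\,\lambda_i)=\mathrm{Sgn}(\mathrm{Re}\,\delta_j)$, or $\mathrm{Re}\,\lambda_i=\mathrm{Re}\,\delta_j=0$ but $\mathrm{Im}\,\lambda_i\neq0$ and $\mathrm{Im}\,\delta_j\neq0$, or $\lambda_i=\delta_j=0$; and (2) the algebraic and geometric multiplicities of $\lambda_i$ are equal to those of $\delta_j$. Coding: $\gamma$ stands for a pair of complex conjugate eigenvalues, a subscript $+$ or $-$ giving the sign of the real part; $\beta$ stands for a complex conjugate pair of (non-zero) imaginary eigenvalues; an additional index $1,2$ denotes different eigenvalues; the square, as in $\beta^2$, denotes a double pair of eigenvalues with nilpotent part of height $2$ (nilpotent part $N\neq0$, $N^2=0$), as opposed to $\beta\beta$ (or $\gamma\gamma$) for a semi-simple double pair. Thus $\gamma_{+1}\gamma_{+2}$ (resp. $\gamma_{-1}\gamma_{-2}$) means two different conjugate pairs, both with positive (resp. negative) real part; $\gamma_+\gamma_-$ one pair with positive and one with negative real part; $\beta\gamma_\pm$ one imaginary pair and one pair with real part of sign $\pm$; $\beta_1\beta_2$ two different imaginary pairs; $\beta^2$ a double imaginary pair that is not semi-simple.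
   Formalization: In (iii), S is replaced by S minus the open arcs ν1=ν4=0, |ν2|>√2/2, which lie in no stratum. In (iv), on V1 and V3 the code and constancy are claimed only off ν4=0, ν2²=ν3²; there the pairs coincide, semisimply if ν2=0 and with nilpotent part of height 2 otherwise. *)

theory Defs
  imports
    "HOL-Analysis.Analysis"
begin

subsection \<open>The unfolding\<close>

definition I2 :: "real^2^2" where "I2 = vector [vector [1, 0], vector [0, 1]]"
definition R2 :: "real^2^2" where "R2 = vector [vector [1, 0], vector [0, -1]]"
definition J2 :: "real^2^2" where "J2 = vector [vector [0, 1], vector [-1, 0]]"

definition block_matrix :: "real^2^2 \<Rightarrow> real^2^2 \<Rightarrow> real^2^2 \<Rightarrow> real^2^2 \<Rightarrow> real^4^4" where
  "block_matrix A B C D = vector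
     [vector [A$1$1, A$1$2, B$1$1, B$1$2],
      vector [A$2$1, A$2$2, B$2$1, B$2$2],
      vector [C$1$1, C$1$2, D$1$1, D$1$2],
      vector [C$2$1, C$2$2, D$2$1, D$2$2]]"

definition M1 :: "real^4^4" where "M1 = block_matrix I2 0 0 I2"
definition M4 :: "real^4^4" where "M4 = block_matrix 0 J2 (- J2) 0"
definition M5 :: "real^4^4" where "M5 = block_matrix 0 I2 (- I2) 0"
definition M6 :: "real^4^4" where "M6 = block_matrix 0 R2 (- R2) 0"
definition M8 :: "real^4^4" where "M8 = block_matrix J2 0 0 J2"

definition H_r :: "real \<Rightarrow> real^4 \<Rightarrow> real^4^4" where
  "H_r nu5 \<nu> = \<nu>$1 *\<^sub>R M1 + \<nu>$2 *\<^sub>R M4 + \<nu>$3 *\<^sub>R M6 + \<nu>$4 *\<^sub>R M8 + nu5 *\<^sub>R M5"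

definition complexify :: "real^'n^'n \<Rightarrow> complex^'n^'n" where
  "complexify A = map_matrix complex_of_real A"


subsection \<open>Critical surface and strata\<close>

abbreviation Sphere3 :: "(real^4) set" where "Sphere3 \<equiv> sphere 0 1"

definition F :: "real^4 \<Rightarrow> real" where
  "F \<nu> = ((\<nu>$1)\<^sup>2 - (\<nu>$2)\<^sup>2) * ((\<nu>$1)\<^sup>2 + (\<nu>$4)\<^sup>2) + (\<nu>$1)\<^sup>2 * (\<nu>$3)\<^sup>2"

definition critical_surface :: "(real^4) set" where
  "critical_surface = {\<nu>. F \<nu> = 0 \<and> norm \<nu> = 1}"

text \<open>
  The zero set of \<open>F\<close> on the sphere contains the whole circle \<open>\<nu>\<^sub>1 = \<nu>\<^sub>4 = 0\<close>. Its two open arcs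
  with \<open>\<bar>\<nu>\<^sub>2\<bar> > sqrt 2 / 2\<close> (the handles of the Whitney umbrellas at \<open>P1\<close>, \<dots>, \<open>P4\<close>) lie in
  none of the strata \<open>S1\<close>, \<dots>, \<open>P6\<close> defined below, since \<open>\<bar>\<nu>\<^sub>2\<bar> \<le> sqrt 2 / 2\<close> on all of those.
\<close>
definition handles :: "(real^4) set" where
  "handles = {\<nu> \<in> Sphere3. \<nu>$1 = 0 \<and> \<nu>$4 = 0 \<and> \<bar>\<nu>$2\<bar> > sqrt 2 / 2}"

text \<open>\<open>\<sigma> = 1\<close> gives \<open>\<phi>\<^sup>+\<close> and \<open>\<sigma> = -1\<close> gives \<open>\<phi>\<^sup>-\<close>, written out in all four coordinates.\<close>
definition phi :: "real \<Rightarrow> real \<Rightarrow> real \<Rightarrow> real^4" where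
  "phi \<sigma> s t =
     (let n1 = sqrt 2 / 2 * s * cos t; n2 = sqrt 2 / 2 * cos t; n4 = s * sin t
      in vector [n1, n2, \<sigma> * sqrt (1 - n1\<^sup>2 - n2\<^sup>2 - n4\<^sup>2), n4])"

definition phi_image :: "real \<Rightarrow> (real \<times> real) set \<Rightarrow> (real^4) set" where
  "phi_image \<sigma> D = (\<lambda>(s, t). phi \<sigma> s t) ` (({-1..1} \<times> {0..2*pi}) \<inter> D)"

definition S_plus :: "(real^4) set" where "S_plus = phi_image 1 UNIV"
definition S_minus :: "(real^4) set" where "S_minus = phi_image (-1) UNIV"

definition surface_piece :: "(real \<times> real) set \<Rightarrow> (real^4) set" where
  "surface_piece D = phi_image 1 D \<union> phi_image (-1) D"

definition S1 :: "(real^4) set" where "S1 = surface_piece {(s, t). s > 0 \<and> cos t > 0}"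
definition S2 :: "(real^4) set" where "S2 = surface_piece {(s, t). s > 0 \<and> cos t < 0}"
definition S3 :: "(real^4) set" where "S3 = surface_piece {(s, t). s < 0 \<and> cos t > 0}"
definition S4 :: "(real^4) set" where "S4 = surface_piece {(s, t). s < 0 \<and> cos t < 0}"

definition L1 :: "(real^4) set" where
  "L1 = {\<nu> \<in> Sphere3. \<nu>$1 = 0 \<and> \<nu>$4 = 0 \<and> 0 < \<nu>$2 \<and> \<nu>$2 < sqrt 2 / 2 \<and> \<nu>$3 > 0}"
definition L2 :: "(real^4) set" where
  "L2 = {\<nu> \<in> Sphere3. \<nu>$1 = 0 \<and> \<nu>$4 = 0 \<and> - (sqrt 2 / 2) < \<nu>$2 \<and> \<nu>$2 < 0 \<and> \<nu>$3 > 0}"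
definition L3 :: "(real^4) set" where
  "L3 = {\<nu> \<in> Sphere3. \<nu>$1 = 0 \<and> \<nu>$4 = 0 \<and> 0 < \<nu>$2 \<and> \<nu>$2 < sqrt 2 / 2 \<and> \<nu>$3 < 0}"
definition L4 :: "(real^4) set" where
  "L4 = {\<nu> \<in> Sphere3. \<nu>$1 = 0 \<and> \<nu>$4 = 0 \<and> - (sqrt 2 / 2) < \<nu>$2 \<and> \<nu>$2 < 0 \<and> \<nu>$3 < 0}"
definition L5 :: "(real^4) set" where
  "L5 = {\<nu> \<in> Sphere3. \<nu>$1 = 0 \<and> \<nu>$2 = 0 \<and> \<nu>$4 > 0}"
definition L6 :: "(real^4) set" where
  "L6 = {\<nu> \<in> Sphere3. \<nu>$1 = 0 \<and> \<nu>$2 = 0 \<and> \<nu>$4 < 0}"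

definition P1 :: "(real^4) set" where "P1 = {vector [0, sqrt 2 / 2, sqrt 2 / 2, 0]}"
definition P2 :: "(real^4) set" where "P2 = {vector [0, - (sqrt 2 / 2), sqrt 2 / 2, 0]}"
definition P3 :: "(real^4) set" where "P3 = {vector [0, sqrt 2 / 2, - (sqrt 2 / 2), 0]}"
definition P4 :: "(real^4) set" where "P4 = {vector [0, - (sqrt 2 / 2), - (sqrt 2 / 2), 0]}"
definition P5 :: "(real^4) set" where "P5 = {vector [0, 0, 1, 0]}"
definition P6 :: "(real^4) set" where "P6 = {vector [0, 0, -1, 0]}"

text \<open>
  The part of the sphere enclosed by \<open>closure A \<union> closure B\<close>, on the side containing neither of the
  two remaining surfaces. It is phrased through connected components, because
  \<open>closure S1 \<union> closure S3\<close> and \<open>closure S2 \<union> closure S4\<close> cross themselves along \<open>L1\<close>, \<open>L3\<close> and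
  along \<open>L2\<close>, \<open>L4\<close>, so that they are not literally embedded 2-spheres.
\<close>
definition enclosed ::
    "(real^4) set \<Rightarrow> (real^4) set \<Rightarrow> (real^4) set \<Rightarrow> (real^4) set \<Rightarrow> (real^4) set" where
  "enclosed A B rest1 rest2 =
     \<Union> {C \<in> components (Sphere3 - (closure A \<union> closure B)). C \<inter> (rest1 \<union> rest2) = {}}"

definition V1 :: "(real^4) set" where "V1 = enclosed S1 S4 S2 S3"
definition V2 :: "(real^4) set" where "V2 = enclosed S1 S3 S2 S4"
definition V3 :: "(real^4) set" where "V3 = enclosed S3 S2 S1 S4"
definition V4 :: "(real^4) set" where "V4 = enclosed S2 S4 S1 S3"

definition critical_strata :: "(real^4) set set" where
  "critical_strata =
     {S1, S2, S3, S4, L1, L2, L3, L4, L5, L6, P1, P2, P3, P4, P5, P6}"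

definition strata :: "(real^4) set set" where
  "strata = {V1, V2, V3, V4} \<union> critical_strata"


subsection \<open>Whitney stratifications\<close>

primrec Ck_on :: "nat \<Rightarrow> 'a::real_normed_vector set \<Rightarrow> ('a \<Rightarrow> 'b::real_normed_vector) \<Rightarrow> bool" where
  "Ck_on 0 U f \<longleftrightarrow> continuous_on U f"
| "Ck_on (Suc k) U f \<longleftrightarrow>
     (\<forall>x\<in>U. f differentiable (at x)) \<and> (\<forall>v. Ck_on k U (\<lambda>x. frechet_derivative f (at x) v))"

text \<open>Intended for open \<open>U\<close> in a finite-dimensional space.\<close>
definition smooth_on :: "'a::real_normed_vector set \<Rightarrow> ('a \<Rightarrow> 'b::real_normed_vector) \<Rightarrow> bool" where
  "smooth_on U f \<longleftrightarrow> (\<forall>k. Ck_on k U f)"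

text \<open>
  Embedded submanifolds, via slice charts of the surrounding Euclidean space. A subset of the
  sphere is a submanifold of the sphere iff it is one of the Euclidean space, and closures in the
  sphere and in the Euclidean space agree, so no separate notion of ambient manifold is needed.
\<close>
definition smooth_submanifold :: "nat \<Rightarrow> 'a::euclidean_space set \<Rightarrow> bool" where
  "smooth_submanifold d M \<longleftrightarrow>
     (\<forall>x\<in>M. \<exists>U W E (f :: 'a \<Rightarrow> 'a) g.
        open U \<and> x \<in> U \<and> open W \<and> homeomorphism U W f g \<and> smooth_on U f \<and> smooth_on W g \<and>
        subspace E \<and> dim E = d \<and> f ` (U \<inter> M) = W \<inter> E)"

definition tangent_space :: "'a::euclidean_space set \<Rightarrow> 'a \<Rightarrow> 'a set" where
  "tangent_space M x =
     {v. \<exists>(c :: real \<Rightarrow> 'a) e. e > 0 \<and> smooth_on {-e<..<e} c \<and> c ` {-e<..<e} \<subseteq> M \<and> c 0 = x \<and>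
         (c has_vector_derivative v) (at 0)}"

text \<open>
  Convergence of linear subspaces in the Grassmannian. For a subspace \<open>T\<close> with orthogonal
  projection \<open>p\<close>, \<open>infdist v T = norm (v - p v)\<close>; so pointwise convergence of the distance
  functions is convergence of the orthogonal projections.
\<close>
definition subspace_tendsto :: "(nat \<Rightarrow> 'a::euclidean_space set) \<Rightarrow> 'a set \<Rightarrow> bool" where
  "subspace_tendsto Tk T \<longleftrightarrow>
     (\<forall>k. subspace (Tk k)) \<and> subspace T \<and> (\<forall>v. (\<lambda>k. infdist v (Tk k)) \<longlonglongrightarrow> infdist v T)"

definition stratification :: "'a::euclidean_space set \<Rightarrow> 'a set set \<Rightarrow> bool" where
  "stratification A \<C> \<longleftrightarrow>
     partition_on A \<C> \<and>
     locally_finite_in (top_of_set A) \<C> \<and>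
     (\<forall>X\<in>\<C>. (\<exists>U K. open U \<and> closed K \<and> X = U \<inter> K) \<and> (\<exists>d. smooth_submanifold d X)) \<and>
     (\<forall>X\<in>\<C>. \<forall>Y\<in>\<C>. X \<inter> closure Y \<noteq> {} \<longrightarrow> X \<subseteq> closure Y)"

text \<open>The tangency condition is imposed on those sequences whose tangent spaces have a limit.\<close>
definition whitney_stratification :: "'a::euclidean_space set \<Rightarrow> 'a set set \<Rightarrow> bool" where
  "whitney_stratification A \<C> \<longleftrightarrow>
     stratification A \<C> \<and>
     (\<forall>X\<in>\<C>. \<forall>Y\<in>\<C>. X \<subseteq> closure Y \<longrightarrow>
        (\<forall>x\<in>X. \<forall>y T. (\<forall>k. y k \<in> Y) \<longrightarrow> y \<longlonglongrightarrow> x \<longrightarrow>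
           subspace_tendsto (\<lambda>k. tangent_space Y (y k)) T \<longrightarrow> tangent_space X x \<subseteq> T))"

definition incident :: "nat \<Rightarrow> 'a::euclidean_space set \<Rightarrow> 'a set \<Rightarrow> bool" where
  "incident n X Y \<longleftrightarrow>
     smooth_submanifold n X \<and> smooth_submanifold (Suc n) Y \<and> X \<subseteq> closure Y"

definition incidences :: "nat \<Rightarrow> 'a::euclidean_space set set \<Rightarrow> ('a set \<times> 'a set) set" where
  "incidences n \<C> = {(X, Y). X \<in> \<C> \<and> Y \<in> \<C> \<and> incident n X Y}"


subsection \<open>Eigenvalue configurations\<close>

definition eigenvalue :: "'a::field^'n^'n \<Rightarrow> 'a \<Rightarrow> bool" where
  "eigenvalue A x \<longleftrightarrow> (\<exists>v. v \<noteq> 0 \<and> A *v v = x *s v)"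

definition charpoly :: "complex^'n^'n \<Rightarrow> complex poly" where
  "charpoly A = det (\<chi> i j. (if i = j then [:0, 1:] else 0) - [:A$i$j:])"

definition alg_mult :: "complex^'n^'n \<Rightarrow> complex \<Rightarrow> nat" where
  "alg_mult A x = order x (charpoly A)"

definition geom_mult :: "complex^'n^'n \<Rightarrow> complex \<Rightarrow> nat" where
  "geom_mult A x = vec.dim {v. A *v v = x *s v}"

text \<open>All eigenvalues, repeated according to algebraic multiplicity.\<close>
definition eigenvalues :: "complex^'n^'n \<Rightarrow> complex multiset" where
  "eigenvalues A = proots (charpoly A)"

text \<open>
  The sign in the first alternative is that of a nonzero real part; with \<open>sgn 0 = 0\<close> admitted it
  would subsume the other two.
\<close>
definition same_type :: "complex \<Rightarrow> complex \<Rightarrow> bool" where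
  "same_type x y \<longleftrightarrow>
     (Re x \<noteq> 0 \<and> Re y \<noteq> 0 \<and> sgn (Re x) = sgn (Re y)) \<or>
     (Re x = 0 \<and> Re y = 0 \<and> Im x \<noteq> 0 \<and> Im y \<noteq> 0) \<or>
     (x = 0 \<and> y = 0)"

definition same_configuration :: "complex^'n^'n \<Rightarrow> complex^'n^'n \<Rightarrow> bool" where
  "same_configuration A B \<longleftrightarrow>
     (\<exists>(l :: 'n \<Rightarrow> complex) (d :: 'n \<Rightarrow> complex) \<pi>.
        image_mset l (mset_set UNIV) = eigenvalues A \<and>
        image_mset d (mset_set UNIV) = eigenvalues B \<and>
        bij \<pi> \<and>
        (\<forall>i. same_type (l i) (d (\<pi> i)) \<and>
             alg_mult A (l i) = alg_mult B (d (\<pi> i)) \<and>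
             geom_mult A (l i) = geom_mult B (d (\<pi> i))))"

text \<open>
  Codes with two different conjugate pairs. The arguments are the signs of the real parts:
  \<open>1\<close> for \<open>\<gamma>\<^sub>+\<close>, \<open>-1\<close> for \<open>\<gamma>\<^sub>-\<close> and \<open>0\<close> for \<open>\<beta>\<close>.
\<close>
definition different_pairs :: "complex^4^4 \<Rightarrow> real \<Rightarrow> real \<Rightarrow> bool" where
  "different_pairs A p q \<longleftrightarrow>
     (\<exists>a b. eigenvalues A = {#a, cnj a, b, cnj b#} \<and> Im a \<noteq> 0 \<and> Im b \<noteq> 0 \<and>
            {a, cnj a} \<noteq> {b, cnj b} \<and> sgn (Re a) = p \<and> sgn (Re b) = q)"

definition double_pair :: "complex^4^4 \<Rightarrow> real \<Rightarrow> bool" where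
  "double_pair A p \<longleftrightarrow>
     (\<exists>a. eigenvalues A = {#a, cnj a, a, cnj a#} \<and> Im a \<noteq> 0 \<and> sgn (Re a) = p)"

definition semisimple :: "complex^'n^'n \<Rightarrow> bool" where
  "semisimple A \<longleftrightarrow>
     (\<exists>(Q :: complex^'n^'n) (D :: complex^'n^'n).
        invertible Q \<and> (\<forall>i j. i \<noteq> j \<longrightarrow> D$i$j = 0) \<and> A = Q ** D ** matrix_inv Q)"

text \<open>The Jordan-Chevalley nilpotent part \<open>N\<close> of \<open>A\<close> has \<open>N \<noteq> 0\<close> and \<open>N ** N = 0\<close>.\<close>
definition nilpotent_part_height2 :: "complex^'n^'n \<Rightarrow> bool" where
  "nilpotent_part_height2 A \<longleftrightarrow>
     (\<exists>D N. A = D + N \<and> semisimple D \<and> D ** N = N ** D \<and> N \<noteq> 0 \<and> N ** N = 0)"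

text \<open>
  Points off the critical surface where the two conjugate pairs of \<open>H_r\<close> coincide (in \<open>V1\<close> and
  \<open>V3\<close>, for instance the point with coordinates \<open>1, 0, 0, 0\<close>). There the multiplicities jump,
  while the signs of the real parts do not.
\<close>
definition collision_locus :: "(real^4) set" where
  "collision_locus = {\<nu>. \<nu>$1 \<noteq> 0 \<and> \<nu>$4 = 0 \<and> (\<nu>$2)\<^sup>2 = (\<nu>$3)\<^sup>2}"

text \<open>The codes \<open>\<gamma>\<^sub>p\<gamma>\<^sub>p\<close> and \<open>\<gamma>\<^sub>p\<^sup>2\<close> of a double pair on the collision locus.\<close>
definition collided :: "complex^4^4 \<Rightarrow> real^4 \<Rightarrow> real \<Rightarrow> bool" where
  "collided A \<nu> p \<longleftrightarrow> double_pair A p \<and>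
     (if \<nu>$2 = 0 then semisimple A else nilpotent_part_height2 A)"

end

theory Submission
  imports Defs
begin

text \<open>
  All matrices involved commute with \<open>M5\<close>, whose square is \<open>- 1\<close>. On the eigenspace of \<open>M5\<close> for
  \<open>\<i>\<close>, a copy of \<open>\<complex>\<^sup>2\<close>, the matrix \<open>H_r\<close> acts as \<open>(\<nu>\<^sub>1 + \<i> \<nu>\<^sub>5) I + B\<close> with \<open>B\<close> traceless and
  \<open>B\<^sup>2 = disc \<nu>\<close>, where \<open>disc \<nu> = \<nu>\<^sub>2\<^sup>2 - \<nu>\<^sub>3\<^sup>2 - \<nu>\<^sub>4\<^sup>2 - 2 \<i> \<nu>\<^sub>2 \<nu>\<^sub>4\<close>. So the eigenvalues are
  \<open>\<nu>\<^sub>1 + \<i> \<nu>\<^sub>5 \<plusminus> w\<close> with \<open>w\<^sup>2 = disc \<nu>\<close>, together with their conjugates (\<open>poly_charpoly_H_r\<close>). Taking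
  \<open>\<rho> = Re w \<ge> 0\<close>, their real parts are \<open>\<nu>\<^sub>1 \<plusminus> \<rho>\<close>, and the signs of these are read off from the sign of
  \<open>\<nu>\<^sub>1\<close> and of the continuous, homogeneous function \<open>gap \<nu> = \<nu>\<^sub>1\<^sup>2 - \<rho>\<^sup>2\<close>. The polynomial \<open>F\<close> is \<open>gap\<close> times
  a nonnegative factor (\<open>F_eq_gap\<close>); that factor vanishes on the handles, where \<open>gap\<close> is negative, and
  on the sphere the zero set of \<open>gap\<close> is the critical surface without its handles.

  All strata are given by signs. Where \<open>gap > 0\<close> the sign of \<open>\<nu>\<^sub>1\<close> separates \<open>V1\<close> from \<open>V3\<close>; where
  \<open>gap < 0\<close> the sign of \<open>\<nu>\<^sub>2\<close> separates \<open>V2\<close> from \<open>V4\<close>; where \<open>gap = 0\<close> and \<open>\<nu>\<^sub>1 \<noteq> 0\<close> the signs of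
  \<open>\<nu>\<^sub>1\<close> and \<open>\<nu>\<^sub>2\<close> give the four surfaces; and what remains, \<open>gap = \<nu>\<^sub>1 = 0\<close>, consists of the circle
  \<open>\<nu>\<^sub>1 = \<nu>\<^sub>2 = 0\<close> and of two arcs of the circle \<open>\<nu>\<^sub>1 = \<nu>\<^sub>4 = 0\<close>, which end at the pinch points
  \<open>P1\<close>, \<dots>, \<open>P4\<close>. Changing the signs of coordinates preserves \<open>gap\<close>, so each kind of stratum is treated
  once, with the signs as parameters. That the regions \<open>V1\<close>, \<dots>, \<open>V4\<close>, defined through connected
  components, are these sign cells (\<open>V_eqs\<close>) holds because each point off the enclosing surfaces and
  outside the cell can be joined to one of the two other surfaces without meeting the former.

  The closures of the strata are described by the corresponding weak inequalities, and they are unions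
  of strata (\<open>strata_closures\<close>); this gives the frontier condition and, as the dimension of a nonempty
  submanifold is unique, the incidences. Whitney's condition follows once each tangent vector of \<open>X\<close>
  is a limit of tangent vectors of \<open>Y\<close> (\<open>tangents_approximable_imp_tangency\<close>). For \<open>X = Y\<close> charts
  provide these vectors, for an open \<open>Y\<close> projection onto the tangent spaces of the sphere does, for a
  point \<open>X\<close> there is nothing to do, and for a curve in the closure of a surface two explicit tangent
  fields of the surface extend continuously to the curves and are tangent to them
  (\<open>tangent_Surf_fixed_slope\<close>, \<open>tangent_Surf_rotation\<close>).

  The absence of real eigenvalues forces \<open>\<bar>\<nu>\<^sub>5\<bar> > 1 \<ge> \<bar>Im w\<bar>\<close>. Hence the eigenvalues \<open>\<nu>\<^sub>1 + \<i> \<nu>\<^sub>5 \<plusminus> w\<close>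
  lie in one open half plane and their conjugates in the other, so that two conjugate pairs coincide
  only where \<open>disc \<nu> = 0\<close>. Everywhere else all four eigenvalues are simple, and the signs of their
  real parts determine the configuration. Where \<open>disc \<nu> = 0\<close>, \<open>B\<^sup>2 = 0\<close> and \<open>B\<close> is the nilpotent part.
\<close>

section \<open>Functions of class C^k\<close>

lemma Ck_on_cong:
  assumes "open U" "\<And>x. x \<in> U \<Longrightarrow> f x = g x" "Ck_on k U f"
  shows "Ck_on k U g"
  using assms(2,3)
proof (induction k arbitrary: f g)
  case 0
  then show ?case by (simp cong: continuous_on_cong)
next
  case (Suc k)
  have d: "f differentiable (at x)" if "x \<in> U" for x using Suc.prems that by simp
  have "g differentiable (at x)" if "x \<in> U" for x
    using d[OF that] Suc.prems(1) assms(1) that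
    unfolding differentiable_def by (metis has_derivative_transform_within_open)
  moreover have "Ck_on k U (\<lambda>x. frechet_derivative g (at x) v)" for v
  proof (rule Suc.IH[of "\<lambda>x. frechet_derivative f (at x) v"])
    show "Ck_on k U (\<lambda>x. frechet_derivative f (at x) v)" using Suc.prems by simp
    show "frechet_derivative f (at x) v = frechet_derivative g (at x) v" if "x \<in> U" for x
      using frechet_derivative_transform_within_open[OF d[OF that] assms(1) that Suc.prems(1)]
      by simp
  qed
  ultimately show ?case by simp
qed

text \<open>
  Any derivative may be supplied; on an open set it agrees with the one chosen by
  \<open>frechet_derivative\<close>, and \<open>Ck_on\<close> depends only on values on the open set.
\<close>

lemma Ck_on_SucI:
  assumes "open U" "\<And>x. x \<in> U \<Longrightarrow> (f has_derivative f' x) (at x)"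
    and "\<And>v. Ck_on k U (\<lambda>x. f' x v)"
  shows "Ck_on (Suc k) U f"
proof -
  have "Ck_on k U (\<lambda>x. frechet_derivative f (at x) v)" for v
    using assms(1) _ assms(3)[of v]
  proof (rule Ck_on_cong)
    show "f' x v = frechet_derivative f (at x) v" if "x \<in> U" for x
      using frechet_derivative_at[OF assms(2)[OF that]] by simp
  qed
  then show ?thesis using assms(2) by (auto simp: differentiable_def)
qed

lemma Ck_on_SucD:
  assumes "Ck_on (Suc k) U f" "x \<in> U"
  shows "(f has_derivative frechet_derivative f (at x)) (at x)"
  using assms frechet_derivative_works by auto

lemma Ck_on_pred: "Ck_on (Suc k) U f \<Longrightarrow> Ck_on k U f"
proof (induction k arbitrary: f)
  case 0
  then show ?case
    by (auto intro!: continuous_at_imp_continuous_on differentiable_imp_continuous_within)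
next
  case (Suc k)
  have "Ck_on k U (\<lambda>x. frechet_derivative f (at x) v)" for v
    using Suc.IH Suc.prems by auto
  then show ?case using Suc.prems by auto
qed

lemma Ck_on_mono:
  assumes "Ck_on k U f" "V \<subseteq> U"
  shows "Ck_on k V f"
  using assms by (induction k arbitrary: f) (auto intro: continuous_on_subset)

lemma Ck_on_const: "open U \<Longrightarrow> Ck_on k U (\<lambda>x. c)"
  by (induction k arbitrary: c) (auto intro: continuous_on_const)

lemma Ck_on_linear:
  assumes "open U" "bounded_linear h"
  shows "Ck_on k U h"
proof (cases k)
  case 0
  then show ?thesis by (simp add: assms(2) linear_continuous_on)
next
  case (Suc n)
  show ?thesis unfolding Suc
    by (rule Ck_on_SucI[OF assms(1) bounded_linear_imp_has_derivative[OF assms(2)]])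
       (rule Ck_on_const[OF assms(1)])
qed

lemma Ck_on_ident: "open U \<Longrightarrow> Ck_on k U (\<lambda>x. x)"
  by (rule Ck_on_linear) (auto intro: bounded_linear_ident)

lemma Ck_on_add:
  assumes "open U" "Ck_on k U f" "Ck_on k U g"
  shows "Ck_on k U (\<lambda>x. f x + g x)"
  using assms(2,3)
proof (induction k arbitrary: f g)
  case 0
  then show ?case by (auto intro: continuous_on_add)
next
  case (Suc k)
  show ?case
    by (rule Ck_on_SucI[OF assms(1) has_derivative_add[OF Ck_on_SucD[OF Suc.prems(1)] Ck_on_SucD[OF Suc.prems(2)]]])
       (use Suc in auto)
qed

text \<open>
  The product rule expresses the derivative by products of functions of one class less, so induction
  on the class applies. Inverses and square roots below are treated in the same way, their derivatives
  being expressed by the function itself and the derivative of its argument.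
\<close>

lemma Ck_on_bilinear:
  assumes "bounded_bilinear h" "open U" "Ck_on k U f" "Ck_on k U g"
  shows "Ck_on k U (\<lambda>x. h (f x) (g x))"
  using assms(3,4)
proof (induction k arbitrary: f g)
  case 0
  then show ?case using assms(1) by (auto intro: bounded_bilinear.continuous_on)
next
  case (Suc k)
  show ?case
  proof (rule Ck_on_SucI[OF assms(2) bounded_bilinear.FDERIV[OF assms(1) Ck_on_SucD[OF Suc.prems(1)] Ck_on_SucD[OF Suc.prems(2)]]])
    show "Ck_on k U (\<lambda>x. h (f x) (frechet_derivative g (at x) v) + h (frechet_derivative f (at x) v) (g x))" for v
      using Suc.prems by (intro Ck_on_add[OF assms(2)] Suc.IH Ck_on_pred[OF Suc.prems(1)] Ck_on_pred[OF Suc.prems(2)]) auto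
  qed auto
qed

lemma Ck_on_compose_linear:
  assumes "bounded_linear h" "Ck_on k U f" "open U"
  shows "Ck_on k U (\<lambda>x. h (f x))"
  using assms(2)
proof (induction k arbitrary: f)
  case 0
  then show ?case using assms(1) by (auto intro: bounded_linear.continuous_on)
next
  case (Suc k)
  show ?case
    by (rule Ck_on_SucI[OF assms(3) bounded_linear.has_derivative[OF assms(1) Ck_on_SucD[OF Suc.prems]]])
       (use Suc in auto)
qed

text \<open>
  Composing an inverse chart with the affine lines of its slice yields curves in a submanifold.
\<close>

lemma Ck_on_affine_substitution:
  assumes "bounded_linear h" "Ck_on k U f" "open U"
  shows "Ck_on k ((\<lambda>x. a + h x) -` U) (\<lambda>x. f (a + h x))"
  using assms(2)
proof (induction k arbitrary: f)
  case 0
  have "continuous_on S (\<lambda>x. a + h x)" for S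
    by (intro continuous_intros linear_continuous_on assms(1))
  then show ?case using 0
    by (auto intro!: continuous_on_compose2[of U f])
next
  case (Suc k)
  have op: "open ((\<lambda>x. a + h x) -` U)"
    by (intro open_vimage assms(3) continuous_intros linear_continuous_on assms(1))
  have d: "((\<lambda>x. a + h x) has_derivative h) (at x)" for x
    using has_derivative_add[OF has_derivative_const bounded_linear_imp_has_derivative[OF assms(1)]] by simp
  show ?case
  proof (rule Ck_on_SucI[OF op])
    show "((\<lambda>x. f (a + h x)) has_derivative (\<lambda>v. frechet_derivative f (at (a + h x)) (h v))) (at x)"
      if "x \<in> (\<lambda>x. a + h x) -` U" for x
      using has_derivative_compose[OF d Ck_on_SucD[OF Suc.prems]] that by simp
    show "Ck_on k ((\<lambda>x. a + h x) -` U) (\<lambda>x. frechet_derivative f (at (a + h x)) (h v))" for v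
      using Suc.IH[of "\<lambda>y. frechet_derivative f (at y) (h v)"] Suc.prems by simp
  qed
qed

lemmas Ck_on_scaleR = Ck_on_bilinear[OF bounded_bilinear_scaleR]
lemmas Ck_on_mult = Ck_on_bilinear[OF bounded_bilinear_mult]
lemmas Ck_on_inner = Ck_on_bilinear[OF bounded_bilinear_inner]

lemma Ck_on_minus: "open U \<Longrightarrow> Ck_on k U f \<Longrightarrow> Ck_on k U (\<lambda>x. - f x)"
  by (rule Ck_on_compose_linear[OF bounded_linear_minus[OF bounded_linear_ident]])

lemma Ck_on_diff:
  assumes "open U" "Ck_on k U f" "Ck_on k U g"
  shows "Ck_on k U (\<lambda>x. f x - g x)"
  using Ck_on_add[OF assms(1,2) Ck_on_minus[OF assms(1,3)]] by simp

lemma Ck_on_power2: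
  fixes f :: "'a::real_normed_vector \<Rightarrow> real"
  shows "open U \<Longrightarrow> Ck_on k U f \<Longrightarrow> Ck_on k U (\<lambda>x. (f x)\<^sup>2)"
  unfolding power2_eq_square by (rule Ck_on_mult)

lemma Ck_on_inverse:
  fixes f :: "'a::real_normed_vector \<Rightarrow> real"
  assumes "open U" "Ck_on k U f" "\<And>x. x \<in> U \<Longrightarrow> f x \<noteq> 0"
  shows "Ck_on k U (\<lambda>x. inverse (f x))"
  using assms(2)
proof (induction k)
  case 0
  then show ?case using assms(3) by (auto intro: continuous_on_inverse)
next
  case (Suc k)
  show ?case
  proof (rule Ck_on_SucI[OF assms(1) Deriv.has_derivative_inverse[OF assms(3) Ck_on_SucD[OF Suc.prems]]])
    show "Ck_on k U (\<lambda>x. - (inverse (f x) * frechet_derivative f (at x) v * inverse (f x)))" for v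
      using Suc by (intro Ck_on_minus Ck_on_mult Suc.IH Ck_on_pred[OF Suc.prems] assms(1)) auto
  qed
qed

lemma Ck_on_divide:
  fixes f g :: "'a::real_normed_vector \<Rightarrow> real"
  assumes "open U" "Ck_on k U f" "Ck_on k U g" "\<And>x. x \<in> U \<Longrightarrow> g x \<noteq> 0"
  shows "Ck_on k U (\<lambda>x. f x / g x)"
  unfolding divide_inverse by (intro Ck_on_mult Ck_on_inverse assms)

lemma Ck_on_sqrt:
  fixes f :: "'a::real_normed_vector \<Rightarrow> real"
  assumes "open U" "Ck_on k U f" "\<And>x. x \<in> U \<Longrightarrow> f x > 0"
  shows "Ck_on k U (\<lambda>x. sqrt (f x))"
  using assms(2)
proof (induction k)
  case 0
  then show ?case by (auto intro: continuous_on_real_sqrt)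
next
  case (Suc k)
  have ne: "sqrt (f x) \<noteq> 0" if "x \<in> U" for x using assms(3)[OF that] by simp
  show ?case
  proof (rule Ck_on_SucI[OF assms(1)])
    show "((\<lambda>x. sqrt (f x)) has_derivative (\<lambda>v. inverse (sqrt (f x)) / 2 * frechet_derivative f (at x) v)) (at x)"
      if "x \<in> U" for x
    proof -
      have "(sqrt has_derivative (*) (inverse (sqrt (f x)) / 2)) (at (f x))"
        using DERIV_real_sqrt[OF assms(3)[OF that]] unfolding has_field_derivative_def .
      from has_derivative_compose[OF Ck_on_SucD[OF Suc.prems that] this] show ?thesis .
    qed
    show "Ck_on k U (\<lambda>x. inverse (sqrt (f x)) / 2 * frechet_derivative f (at x) v)" for v
      using Suc(2) ne
      by (intro Ck_on_mult Ck_on_divide Ck_on_inverse Suc.IH Ck_on_pred[OF Suc.prems] Ck_on_const assms(1)) simp_all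
  qed
qed

lemma Ck_on_nth:
  "open U \<Longrightarrow> Ck_on k U f \<Longrightarrow> Ck_on k U (\<lambda>x. f x $ i)"
  by (rule Ck_on_compose_linear[OF bounded_linear_vec_nth])

lemma Ck_on_sum:
  assumes "open U" "\<And>i. i \<in> I \<Longrightarrow> Ck_on k U (f i)"
  shows "Ck_on k U (\<lambda>x. \<Sum>i\<in>I. f i x)"
  using assms(2)
  by (induction I rule: infinite_finite_induct) (auto intro!: Ck_on_const Ck_on_add assms(1))

lemma Ck_on_vec:
  fixes f :: "'a::real_normed_vector \<Rightarrow> real^'n"
  assumes "open U" "\<And>i. Ck_on k U (\<lambda>x. f x $ i)"
  shows "Ck_on k U f"
proof -
  have "f = (\<lambda>x. \<Sum>i\<in>UNIV. f x $ i *\<^sub>R axis i 1)"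
    by (rule ext) (metis basis_expansion scalar_mult_eq_scaleR)
  moreover have "Ck_on k U (\<lambda>x. \<Sum>i\<in>UNIV. f x $ i *\<^sub>R axis i 1)"
    by (intro Ck_on_sum Ck_on_scaleR Ck_on_const assms)
  ultimately show ?thesis by (rule ssubst[where P = "Ck_on k U"])
qed

lemmas Ck_on_intros =
  Ck_on_const Ck_on_ident Ck_on_add Ck_on_diff Ck_on_minus Ck_on_scaleR Ck_on_mult Ck_on_inner
  Ck_on_power2 Ck_on_divide Ck_on_sqrt Ck_on_nth

lemma smooth_on_subset: "smooth_on U f \<Longrightarrow> V \<subseteq> U \<Longrightarrow> smooth_on V f"
  by (auto simp: smooth_on_def intro: Ck_on_mono)

lemma smooth_on_imp_continuous_on: "smooth_on U f \<Longrightarrow> continuous_on U f"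
  unfolding smooth_on_def by (metis Ck_on.simps(1))

lemma smooth_on_has_derivative:
  "smooth_on U f \<Longrightarrow> x \<in> U \<Longrightarrow> (f has_derivative frechet_derivative f (at x)) (at x)"
  unfolding smooth_on_def using Ck_on_SucD by blast

lemma smooth_on_continuous_derivative:
  "smooth_on U f \<Longrightarrow> continuous_on U (\<lambda>x. frechet_derivative f (at x) v)"
  unfolding smooth_on_def by (metis Ck_on.simps)

section \<open>Submanifolds and their tangent spaces\<close>

text \<open>
  Injectivity of the chart makes the slice condition pass to every smaller open set.
\<close>

lemma slice_chart_restrict:
  assumes chart: "open U" "open W" "homeomorphism U W f g" "f ` (U \<inter> M) = W \<inter> E"
    and V: "open V" "V \<subseteq> U"
  shows "open (f ` V)" "homeomorphism V (f ` V) f g" "f ` V \<subseteq> W" "f ` (V \<inter> M) = f ` V \<inter> E"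
proof -
  show "open (f ` V)"
    using homeomorphism_imp_open_map[OF chart(3), of V] chart(1,2) V
    by (metis openin_open_eq)
  show "homeomorphism V (f ` V) f g"
    using chart(3) V(2) by (auto intro: homeomorphism_of_subsets)
  show sub: "f ` V \<subseteq> W" using chart(3) V(2) by (auto simp: homeomorphism_def)
  show "f ` (V \<inter> M) = f ` V \<inter> E"
  proof
    show "f ` (V \<inter> M) \<subseteq> f ` V \<inter> E" using chart(4) V(2) by auto
    show "f ` V \<inter> E \<subseteq> f ` (V \<inter> M)"
    proof
      fix y assume y: "y \<in> f ` V \<inter> E"
      then obtain z where z: "z \<in> V" "y = f z" by auto
      have "y \<in> f ` (U \<inter> M)" unfolding chart(4) using y sub by auto
      then obtain z' where z': "z' \<in> U" "z' \<in> M" "y = f z'" by auto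
      have "z = z'" using z z' V(2) chart(3) by (metis homeomorphism_apply1 subsetD)
      then show "y \<in> f ` (V \<inter> M)" using z z' by auto
    qed
  qed
qed

lemma smooth_submanifold_Int_open:
  assumes "smooth_submanifold d M" "open V"
  shows "smooth_submanifold d (V \<inter> M)"
  unfolding smooth_submanifold_def
proof
  fix x assume x: "x \<in> V \<inter> M"
  obtain U W E and f g :: "'a \<Rightarrow> 'a" where c: "open U" "x \<in> U" "open W" "homeomorphism U W f g"
    "smooth_on U f" "smooth_on W g" "subspace E" "dim E = d" "f ` (U \<inter> M) = W \<inter> E"
    using assms(1) x unfolding smooth_submanifold_def by (metis IntD2)
  note r = slice_chart_restrict[OF c(1,3,4,9) open_Int[OF c(1) assms(2)] Int_lower1]
  have "(U \<inter> V) \<inter> (V \<inter> M) = (U \<inter> V) \<inter> M" by auto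
  then have "f ` ((U \<inter> V) \<inter> (V \<inter> M)) = f ` (U \<inter> V) \<inter> E" using r(4) by simp
  then show "\<exists>U W E (f :: 'a \<Rightarrow> 'a) g. open U \<and> x \<in> U \<and> open W \<and> homeomorphism U W f g \<and>
     smooth_on U f \<and> smooth_on W g \<and> subspace E \<and> dim E = d \<and> f ` (U \<inter> (V \<inter> M)) = W \<inter> E"
    by (intro exI[of _ "U \<inter> V"] exI[of _ "f ` (U \<inter> V)"] exI[of _ E] exI[of _ f] exI[of _ g] conjI
        open_Int c(1,7,8) assms(2) r(1,2) IntI c(2) smooth_on_subset[OF c(5)] smooth_on_subset[OF c(6) r(3)])
       (use x in auto)
qed

text \<open>
  Two slice charts at a common point give an injective continuous map from a nonempty open subset of
  one slice into the other, so invariance of dimension for subspaces bounds one dimension by the other.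
\<close>

lemma smooth_submanifold_dim_unique:
  fixes M :: "'a::euclidean_space set"
  assumes "smooth_submanifold d M" "smooth_submanifold e M" "M \<noteq> {}"
  shows "d = e"
proof -
  have le: "d \<le> e" if d: "smooth_submanifold d M" and e: "smooth_submanifold e M" for d e
  proof -
    obtain x where x: "x \<in> M" using assms(3) by auto
    obtain U W E and f g :: "'a \<Rightarrow> 'a" where c: "open U" "x \<in> U" "open W" "homeomorphism U W f g"
      "subspace E" "dim E = d" "f ` (U \<inter> M) = W \<inter> E"
      using d x unfolding smooth_submanifold_def by metis
    obtain U' W' E' and f' g' :: "'a \<Rightarrow> 'a" where c': "open U'" "x \<in> U'" "open W'"
      "homeomorphism U' W' f' g'" "subspace E'" "dim E' = e" "f' ` (U' \<inter> M) = W' \<inter> E'"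
      using e x unfolding smooth_submanifold_def by metis
    let ?S = "f ` (U \<inter> U' \<inter> M)"
    note r = slice_chart_restrict[OF c(1,3,4,7) open_Int[OF c(1) c'(1)] Int_lower1]
    have "openin (top_of_set E) ?S"
      unfolding r(4) using r(1) by (simp add: openin_open_Int inf_commute)
    moreover have "continuous_on ?S (f' \<circ> g)"
    proof (rule continuous_on_compose)
      show "continuous_on ?S g"
        using c(4) by (auto simp: homeomorphism_def intro: continuous_on_subset)
      have "g ` ?S \<subseteq> U'" using c(4) by (auto simp: homeomorphism_apply1)
      then show "continuous_on (g ` ?S) f'"
        using c'(4) by (auto simp: homeomorphism_def intro: continuous_on_subset)
    qed
    moreover have "f' \<circ> g \<in> ?S \<rightarrow> E'"
      using c(4) c'(7) by (auto simp: homeomorphism_apply1)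
    moreover have "inj_on (f' \<circ> g) ?S"
    proof (rule inj_onI)
      fix a b assume ab: "a \<in> ?S" "b \<in> ?S" "(f' \<circ> g) a = (f' \<circ> g) b"
      then obtain z w where "a = f z" "b = f w" "z \<in> U \<inter> U'" "w \<in> U \<inter> U'" by auto
      then show "a = b"
        using ab(3) c(4) c'(4) by (metis IntE comp_apply homeomorphism_apply1)
    qed
    ultimately show "d \<le> e"
      using invariance_of_dimension_subspaces[of E ?S E' "f' \<circ> g"] c c' x by auto
  qed
  show ?thesis using le assms(1,2) by (meson le_antisym)
qed

text \<open>
  Lower semicontinuity of the tangent spaces of \<open>Y\<close> at points of \<open>X\<close>. Unlike the tangency condition
  itself, it does not mention limits of subspaces.
\<close>

definition tangents_approximable :: "'a::euclidean_space set \<Rightarrow> 'a set \<Rightarrow> bool" where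
  "tangents_approximable X Y \<longleftrightarrow>
     (\<forall>x\<in>X. \<forall>v\<in>tangent_space X x. \<forall>y. (\<forall>k. y k \<in> Y) \<longrightarrow> y \<longlonglongrightarrow> x \<longrightarrow>
        (\<exists>w. (\<forall>\<^sub>F k in sequentially. w k \<in> tangent_space Y (y k)) \<and> w \<longlonglongrightarrow> v))"

text \<open>
  Distances to the tangent spaces of \<open>Y\<close> converge to the distance to \<open>T\<close>; for a limit of tangent
  vectors they tend to \<open>0\<close>, and a vector at distance \<open>0\<close> lies in the closed set \<open>T\<close>.
\<close>

lemma tangents_approximable_imp_tangency:
  assumes "tangents_approximable X Y" "x \<in> X" "\<forall>k. y k \<in> Y" "y \<longlonglongrightarrow> x"
    and lim: "subspace_tendsto (\<lambda>k. tangent_space Y (y k)) T"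
  shows "tangent_space X x \<subseteq> T"
proof
  fix v assume "v \<in> tangent_space X x"
  then obtain w where ev: "\<forall>\<^sub>F k in sequentially. w k \<in> tangent_space Y (y k)" and w: "w \<longlonglongrightarrow> v"
    using assms(1-4) unfolding tangents_approximable_def by blast
  have T: "subspace T" "(\<lambda>k. infdist v (tangent_space Y (y k))) \<longlonglongrightarrow> infdist v T"
    using lim by (auto simp: subspace_tendsto_def)
  have "(\<lambda>k. infdist v (tangent_space Y (y k))) \<longlonglongrightarrow> 0"
  proof (rule tendsto_sandwich[of "\<lambda>_. 0" _ _ "\<lambda>k. dist v (w k)"])
    show "\<forall>\<^sub>F k in sequentially. infdist v (tangent_space Y (y k)) \<le> dist v (w k)"
      using ev by eventually_elim (rule infdist_le)
    show "(\<lambda>k. dist v (w k)) \<longlonglongrightarrow> 0"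
      using tendsto_dist[OF tendsto_const[of v] w] by simp
  qed (auto simp: infdist_nonneg)
  then have "infdist v T = 0" using T(2) LIMSEQ_unique by blast
  moreover have "closed T" "T \<noteq> {}" using closed_subspace[OF T(1)] subspace_0[OF T(1)] by auto
  ultimately show "v \<in> T" using in_closed_iff_infdist_zero by blast
qed

lemma tangent_spaceI:
  fixes M :: "'a::euclidean_space set"
  assumes "open I" "(0::real) \<in> I" "\<And>k. Ck_on k I c" "\<And>t. t \<in> I \<Longrightarrow> c t \<in> M" "c 0 = x"
    and "(c has_vector_derivative v) (at 0)"
  shows "v \<in> tangent_space M x"
proof -
  obtain e where e: "e > 0" "ball 0 e \<subseteq> I" using assms(1,2) openE by blast
  then have "{-e<..<e} \<subseteq> I" by (auto simp: ball_eq_greaterThanLessThan)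
  then show ?thesis
    unfolding tangent_space_def using e(1) assms
    by (auto intro!: exI[of _ c] exI[of _ e] simp: smooth_on_def intro: Ck_on_mono)
qed

text \<open>
  The component of the velocity orthogonal to \<open>E\<close> is orthogonal to the whole curve near \<open>0\<close>, hence to
  the velocity, hence to itself.
\<close>

lemma velocity_in_subspace:
  fixes \<gamma> :: "real \<Rightarrow> 'a::euclidean_space"
  assumes E: "subspace E" and ev: "\<forall>\<^sub>F t in nhds 0. \<gamma> t \<in> E"
    and d: "(\<gamma> has_vector_derivative w) (at 0)"
  shows "w \<in> E"
proof -
  obtain a b where ab: "a \<in> span E" "\<And>z. z \<in> span E \<Longrightarrow> orthogonal b z" "w = a + b"
    using orthogonal_subspace_decomp_exists[of E w] by metis
  have "((\<lambda>t. b \<bullet> \<gamma> t) has_vector_derivative b \<bullet> w) (at 0)"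
    using bounded_linear.has_vector_derivative[OF bounded_linear_inner_right d] .
  moreover have "((\<lambda>t. b \<bullet> \<gamma> t) has_vector_derivative 0) (at 0)"
  proof -
    obtain I where I: "open I" "0 \<in> I" "\<And>t. t \<in> I \<Longrightarrow> \<gamma> t \<in> E"
      using ev unfolding eventually_nhds by blast
    have "b \<bullet> \<gamma> t = 0" if "t \<in> I" for t
      using ab(2)[of "\<gamma> t"] I(3)[OF that] span_base by (auto simp: orthogonal_def)
    then show ?thesis
      using has_vector_derivative_transform_within_open[OF has_vector_derivative_const I(1,2)]
      by metis
  qed
  ultimately have "b \<bullet> w = 0" by (rule vector_derivative_unique_at)
  moreover have "b \<bullet> a = 0" using ab(1,2) by (auto simp: orthogonal_def)
  ultimately have "b = 0" using ab(3) by (simp add: inner_add_right)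
  then show ?thesis using ab(1,3) E by (metis add.right_neutral span_eq_iff)
qed

text \<open>
  In a slice chart \<open>f\<close> with inverse \<open>g\<close> the vector \<open>v\<close> becomes a vector \<open>w\<close> of the linear slice. The images
  under \<open>g\<close> of the lines in direction \<open>w\<close> are curves in \<open>M\<close>, and their velocities, the derivatives of \<open>g\<close>
  in direction \<open>w\<close>, depend continuously on the point.
\<close>

lemma tangents_approximable_refl:
  fixes M :: "'a::euclidean_space set"
  assumes M: "smooth_submanifold d M"
  shows "tangents_approximable M M"
  unfolding tangents_approximable_def
proof (intro ballI allI impI)
  fix x v and y :: "nat \<Rightarrow> 'a"
  assume x: "x \<in> M" and v: "v \<in> tangent_space M x" and y: "\<forall>k. y k \<in> M" "y \<longlonglongrightarrow> x"
  obtain U W E and f g :: "'a \<Rightarrow> 'a" where c: "open U" "x \<in> U" "open W" "homeomorphism U W f g"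
    "smooth_on U f" "smooth_on W g" "subspace E" "dim E = d" "f ` (U \<inter> M) = W \<inter> E"
    using M x unfolding smooth_submanifold_def by metis
  obtain c e where cu: "e > 0" "smooth_on {-e<..<e} c" "c ` {-e<..<e} \<subseteq> M" "c 0 = x"
    "(c has_vector_derivative v) (at 0)"
    using v unfolding tangent_space_def by blast
  have fx: "f z \<in> W" "g (f z) = z" if "z \<in> U" for z
    using c(4) that by (auto simp: homeomorphism_def)
  have gM: "g z \<in> M" if "z \<in> W" "z \<in> E" for z
  proof -
    have "z \<in> f ` (U \<inter> M)" unfolding c(9) using that by simp
    then obtain u where u: "u \<in> U" "u \<in> M" "z = f u" by auto
    show ?thesis unfolding u(3) fx(2)[OF u(1)] by (rule u(2))
  qed
  define Df Dg where "Df = frechet_derivative f (at x)" and "Dg = (\<lambda>z. frechet_derivative g (at z))"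
  have Df: "(f has_derivative Df) (at x)"
    using smooth_on_has_derivative[OF c(5,2)] by (simp add: Df_def)
  have Dg: "(g has_derivative Dg z) (at z)" if "z \<in> W" for z
    using smooth_on_has_derivative[OF c(6) that] by (simp add: Dg_def)
  define w where "w = Df v"
  have "v = Dg (f x) w"
  proof -
    have 1: "((\<lambda>z. g (f z)) has_derivative (\<lambda>h. Dg (f x) (Df h))) (at x)"
      using has_derivative_compose[OF Df Dg[OF fx(1)[OF c(2)]]] .
    have 2: "((\<lambda>z. g (f z)) has_derivative (\<lambda>h. h)) (at x)"
      by (rule has_derivative_transform_within_open[OF has_derivative_ident c(1,2)])
         (simp add: fx(2))
    show ?thesis unfolding w_def using fun_cong[OF has_derivative_unique[OF 1 2], of v] by simp
  qed
  \<comment> \<open>the chart carries the curve into the linear slice, hence its velocity too\<close>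
  have "w \<in> E"
  proof -
    have *: "((\<lambda>t. f (c t)) has_vector_derivative w) (at 0)"
    proof -
      have "(f has_derivative Df) (at (c 0))" using Df cu(4) by simp
      from has_derivative_compose[OF cu(5)[unfolded has_vector_derivative_def] this]
      show ?thesis unfolding has_vector_derivative_def w_def
        linear_scale[OF has_derivative_linear[OF Df]] .
    qed
    have "isCont c 0" using cu(5) has_vector_derivative_continuous by blast
    then have "\<forall>\<^sub>F t in nhds 0. c t \<in> U"
      using c(1,2) cu(4) by (metis isCont_def tendsto_at_iff_tendsto_nhds topological_tendstoD)
    moreover have "\<forall>\<^sub>F t in nhds 0. t \<in> {-e<..<e}"
      using cu(1) by (intro eventually_nhds_in_open) auto
    ultimately have "\<forall>\<^sub>F t in nhds 0. f (c t) \<in> E"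
    proof eventually_elim
      case (elim t)
      then have "f (c t) \<in> f ` (U \<inter> M)" using cu(3) by blast
      then show ?case unfolding c(9) by simp
    qed
    then show ?thesis using velocity_in_subspace[OF c(7) _ *] by simp
  qed
  have "Dg (f z) w \<in> tangent_space M z" if z: "z \<in> U" "z \<in> M" for z
  proof (rule tangent_spaceI)
    let ?h = "\<lambda>t::real. f z + t *\<^sub>R w"
    show "open (?h -` W)" by (intro open_vimage c(3) continuous_intros)
    show "0 \<in> ?h -` W" using fx z by simp
    show "Ck_on k (?h -` W) (\<lambda>t. g (?h t))" for k
      using Ck_on_affine_substitution[OF bounded_linear_scaleR_left, of k W g "f z" w] c(3,6)
      by (simp add: smooth_on_def)
    show "g (?h t) \<in> M" if "t \<in> ?h -` W" for t
    proof (rule gM)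
      have "f z \<in> f ` (U \<inter> M)" using z by blast
      then have "f z \<in> E" unfolding c(9) by simp
      then show "?h t \<in> E" using \<open>w \<in> E\<close> c(7) by (simp add: subspace_add subspace_scale)
    qed (use that in simp)
    show "g (?h 0) = z" using fx z by simp
    have "(?h has_derivative (\<lambda>t. t *\<^sub>R w)) (at 0)" by (auto intro!: derivative_eq_intros)
    moreover have "(g has_derivative Dg (f z)) (at (?h 0))" using Dg[OF fx(1)[OF z(1)]] by simp
    ultimately have "((\<lambda>t. g (?h t)) has_derivative (\<lambda>t. Dg (f z) (t *\<^sub>R w))) (at 0)"
      by (rule has_derivative_compose)
    then show "((\<lambda>t. g (?h t)) has_vector_derivative Dg (f z) w) (at 0)"
      unfolding has_vector_derivative_def
        linear_scale[OF has_derivative_linear[OF Dg[OF fx(1)[OF z(1)]]]] .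
  qed
  moreover have "\<forall>\<^sub>F k in sequentially. y k \<in> U" using y(2) c(1,2) by (rule topological_tendstoD)
  ultimately have "\<forall>\<^sub>F k in sequentially. Dg (f (y k)) w \<in> tangent_space M (y k)"
    using y(1) by (auto elim: eventually_mono)
  moreover have "(\<lambda>k. Dg (f (y k)) w) \<longlonglongrightarrow> v"
  proof -
    have "isCont f x" using Df has_derivative_continuous by blast
    then have "(\<lambda>k. f (y k)) \<longlonglongrightarrow> f x" using y(2) isCont_tendsto_compose by blast
    moreover have "isCont (\<lambda>z. Dg z w) (f x)"
      using smooth_on_continuous_derivative[OF c(6)] c(3) fx(1)[OF c(2)]
      by (simp add: Dg_def continuous_on_eq_continuous_at)
    ultimately have "(\<lambda>k. Dg (f (y k)) w) \<longlonglongrightarrow> Dg (f x) w" by (rule isCont_tendsto_compose[rotated])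
    then show ?thesis using \<open>v = Dg (f x) w\<close> by simp
  qed
  ultimately show "\<exists>w. (\<forall>\<^sub>F k in sequentially. w k \<in> tangent_space M (y k)) \<and> w \<longlonglongrightarrow> v"
    by (intro exI[of _ "\<lambda>k. Dg (f (y k)) w"] conjI)
qed

section \<open>Great spheres and relatively open subsets of the sphere\<close>

text \<open>
  At a point \<open>p\<close> the hemisphere \<open>x \<bullet> p > 0\<close> is a graph over the hyperplane orthogonal to \<open>p\<close>. The chart
  keeps the orthogonal part \<open>P x\<close> and replaces the coordinate along \<open>p\<close> by \<open>x \<bullet> x - 1\<close>, which is
  inverted by a square root. As \<open>p\<close> lies in \<open>G\<close>, membership in \<open>G\<close> depends on \<open>P x\<close> only.
\<close>

lemma smooth_submanifold_sphere_Int_subspace: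
  fixes G :: "'a::euclidean_space set"
  assumes G: "subspace G" and dimG: "dim G = Suc d"
  shows "smooth_submanifold d (sphere 0 1 \<inter> G)"
  unfolding smooth_submanifold_def
proof
  fix p assume p: "p \<in> sphere 0 1 \<inter> G"
  then have pp: "p \<bullet> p = 1" and pG: "p \<in> G" by (auto simp: norm_eq_1)
  define P where "P x = x - (x \<bullet> p) *\<^sub>R p" for x
  define f where "f x = P x + (x \<bullet> x - 1) *\<^sub>R p" for x
  define r where "r y = 1 + y \<bullet> p - P y \<bullet> P y" for y
  define g where "g y = P y + sqrt (r y) *\<^sub>R p" for y
  define U where "U = {x. x \<bullet> p > 0}"
  define W where "W = {y. r y > 0}"
  define E where "E = {v \<in> G. v \<bullet> p = 0}"
  have Pp: "P x \<bullet> p = 0" "p \<bullet> P x = 0" for x by (simp_all add: P_def algebra_simps pp inner_commute)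
  have xx: "x \<bullet> x = P x \<bullet> P x + (x \<bullet> p)\<^sup>2" for x
    by (simp add: P_def algebra_simps pp inner_commute power2_eq_square)
  have PP: "P (P x + c *\<^sub>R p) = P x" for x c
    using Pp(1)[of x] by (simp add: P_def[of "P x + c *\<^sub>R p"] inner_add_left pp)
  have fp: "f x \<bullet> p = x \<bullet> x - 1" and gp: "g y \<bullet> p = sqrt (r y)" for x y
    by (simp_all add: f_def g_def inner_add_left Pp pp)
  have rf: "r (f x) = (x \<bullet> p)\<^sup>2" for x
    unfolding r_def fp using PP[of x] xx[of x] by (simp add: f_def)
  have gf: "g (f x) = x" if "x \<in> U" for x
    using that PP[of x "x \<bullet> x - 1"] unfolding g_def rf by (simp add: f_def[symmetric] U_def) (simp add: P_def)
  have gg: "g y \<bullet> g y = 1 + y \<bullet> p" if "y \<in> W" for y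
    using that PP[of y "sqrt (r y)"] xx[of "g y"] unfolding gp by (simp add: g_def[symmetric] W_def) (simp add: r_def)
  have fg: "f (g y) = y" if "y \<in> W" for y
    using gg[OF that] PP[of y "sqrt (r y)"] by (simp add: f_def g_def[symmetric]) (simp add: P_def)
  have opU: "open U" unfolding U_def by (intro open_Collect_less continuous_intros)
  have opW: "open W" unfolding W_def r_def P_def by (intro open_Collect_less continuous_intros)
  have cf: "continuous_on S f" for S unfolding f_def P_def by (intro continuous_intros)
  have cg: "continuous_on S g" for S unfolding g_def r_def P_def by (intro continuous_intros)
  have fW: "f x \<in> W" if "x \<in> U" for x using that by (simp add: W_def rf U_def)
  have gU: "g y \<in> U" if "y \<in> W" for y using that by (simp add: W_def gp U_def)
  have hom: "homeomorphism U W f g"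
    unfolding homeomorphism_def using gf fg fW gU cf cg by (metis image_eqI image_subsetI subset_antisym subsetI)
  have smf: "smooth_on U f"
    unfolding smooth_on_def f_def P_def by (intro allI Ck_on_intros opU)
  have smg: "smooth_on W g"
    unfolding smooth_on_def g_def
  proof (intro allI)
    fix k
    have "Ck_on k W r" unfolding r_def P_def by (intro Ck_on_intros opW)
    then show "Ck_on k W (\<lambda>y. P y + sqrt (r y) *\<^sub>R p)"
      unfolding P_def by (intro Ck_on_intros opW) (auto simp: W_def)
  qed
  have "f ` (U \<inter> (sphere 0 1 \<inter> G)) = W \<inter> E"
  proof
    have "f x \<in> W \<inter> E" if x: "x \<in> U" "x \<in> sphere 0 1" "x \<in> G" for x
    proof -
      have "x \<bullet> x = 1" using x(2) by (simp add: norm_eq_1)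
      then have "f x = P x" by (simp add: f_def)
      moreover have "P x \<in> G" using x(3) pG G by (simp add: P_def subspace_diff subspace_scale)
      ultimately show ?thesis using fW[OF x(1)] Pp by (simp add: E_def)
    qed
    then show "f ` (U \<inter> (sphere 0 1 \<inter> G)) \<subseteq> W \<inter> E" by blast
    show "W \<inter> E \<subseteq> f ` (U \<inter> (sphere 0 1 \<inter> G))"
    proof
      fix y assume y: "y \<in> W \<inter> E"
      then have "g y \<bullet> g y = 1" using gg by (simp add: E_def)
      moreover have "g y \<in> G" using y pG G by (simp add: g_def P_def E_def subspace_add subspace_scale)
      ultimately show "y \<in> f ` (U \<inter> (sphere 0 1 \<inter> G))"
        using fg gU y by (intro image_eqI[of _ _ "g y"]) (auto simp: norm_eq_1)
    qed
  qed
  moreover have "dim E = d"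
  proof -
    have "dim {y \<in> G. \<forall>x\<in>span {p}. orthogonal x y} + dim (span {p}) = dim G"
      using dim_subspace_orthogonal_to_vectors[of "span {p}" G] pG G by (simp add: span_minimal)
    moreover have "{y \<in> G. \<forall>x\<in>span {p}. orthogonal x y} = E"
      by (auto simp: E_def span_singleton orthogonal_def inner_commute)
    moreover have "p \<noteq> 0" using pp by auto
    ultimately show ?thesis using dimG by (simp add: dim_singleton)
  qed
  moreover have "subspace E"
    using G unfolding E_def subspace_def by (auto simp: inner_add_left)
  moreover have "p \<in> U" by (simp add: U_def pp)
  ultimately show "\<exists>U W E (f :: 'a \<Rightarrow> 'a) g. open U \<and> p \<in> U \<and> open W \<and> homeomorphism U W f g \<and>
     smooth_on U f \<and> smooth_on W g \<and> subspace E \<and> dim E = d \<and> f ` (U \<inter> (sphere 0 1 \<inter> G)) = W \<inter> E"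
    using opU opW hom smf smg by blast
qed

lemma tangent_space_sphere_orthogonal:
  fixes M :: "'a::euclidean_space set"
  assumes "M \<subseteq> sphere 0 1" "v \<in> tangent_space M x"
  shows "x \<bullet> v = 0"
proof -
  obtain c e where c: "e > 0" "c ` {-e<..<e} \<subseteq> M" "c 0 = x" "(c has_vector_derivative v) (at 0)"
    using assms(2) unfolding tangent_space_def by blast
  have "((\<lambda>t. c t \<bullet> c t) has_vector_derivative c 0 \<bullet> v + v \<bullet> c 0) (at 0)"
    using bounded_bilinear.has_vector_derivative[OF bounded_bilinear_inner c(4) c(4)] .
  moreover have "((\<lambda>t. c t \<bullet> c t) has_vector_derivative 0) (at 0)"
  proof -
    have eq: "1 = c t \<bullet> c t" if "t \<in> {-e<..<e}" for t
    proof -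
      have "c t \<in> sphere 0 1" using c(2) assms(1) that by blast
      then show ?thesis by (simp add: norm_eq_1)
    qed
    show ?thesis
      by (rule has_vector_derivative_transform_within_open[OF has_vector_derivative_const, of "{-e<..<e}"])
         (use c(1) eq in auto)
  qed
  ultimately have "c 0 \<bullet> v + v \<bullet> c 0 = 0" by (rule vector_derivative_unique_at)
  then show ?thesis using c(3) by (simp add: inner_commute)
qed

lemma tangent_space_subspace:
  fixes M :: "'a::euclidean_space set"
  assumes "subspace G" "M \<subseteq> G" "v \<in> tangent_space M x"
  shows "v \<in> G"
proof -
  obtain c e where c: "e > 0" "c ` {-e<..<e} \<subseteq> M" "(c has_vector_derivative v) (at 0)"
    using assms(3) unfolding tangent_space_def by blast
  have "\<forall>\<^sub>F t in nhds 0. t \<in> {-e<..<e}" using c(1) by (intro eventually_nhds_in_open) auto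
  then have "\<forall>\<^sub>F t in nhds 0. c t \<in> G" by eventually_elim (use c(2) assms(2) in blast)
  then show ?thesis using velocity_in_subspace[OF assms(1) _ c(3)] by blast
qed

lemma zero_in_tangent_space: "x \<in> M \<Longrightarrow> 0 \<in> tangent_space M x"
  by (rule tangent_spaceI[of UNIV "\<lambda>_. x"]) (auto intro: Ck_on_const)

lemma tangents_approximable_singleton: "tangents_approximable {p} Y"
  unfolding tangents_approximable_def
proof (intro ballI allI impI)
  fix x v and y :: "nat \<Rightarrow> 'a"
  assume v: "v \<in> tangent_space {p} x" and y: "\<forall>k. y k \<in> Y"
  obtain c e where c: "e > 0" "c ` {-e<..<e} \<subseteq> {p}" "(c has_vector_derivative v) (at 0)"
    using v unfolding tangent_space_def by blast
  have "p = c t" if "t \<in> {-e<..<e}" for t using c(2) that by blast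
  then have "(c has_vector_derivative 0) (at 0)"
    by (intro has_vector_derivative_transform_within_open[OF has_vector_derivative_const[of p], of "{-e<..<e}"])
       (use c(1) in auto)
  then have "v = 0" using c(3) vector_derivative_unique_at by blast
  then show "\<exists>w. (\<forall>\<^sub>F k in sequentially. w k \<in> tangent_space Y (y k)) \<and> w \<longlonglongrightarrow> v"
    using y by (intro exI[of _ "\<lambda>_. 0"]) (simp add: zero_in_tangent_space)
qed

text \<open>
  The curve \<open>sqrt (1 - t\<^sup>2 (w \<bullet> w)) y + t w\<close> stays on the sphere and has velocity \<open>w\<close> at \<open>0\<close>.
\<close>

lemma tangent_space_open_in_sphere:
  fixes y w :: "'a::euclidean_space"
  assumes "open O'" "y \<in> O' \<inter> sphere 0 1" "y \<bullet> w = 0"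
  shows "w \<in> tangent_space (O' \<inter> sphere 0 1) y"
proof -
  define s where "s t = sqrt (1 - t\<^sup>2 * (w \<bullet> w))" for t
  define c where "c t = s t *\<^sub>R y + t *\<^sub>R w" for t
  define J where "J = {t. t\<^sup>2 * (w \<bullet> w) < 1}"
  define I where "I = J \<inter> c -` O'"
  have cc: "continuous_on S c" for S unfolding c_def s_def by (intro continuous_intros)
  have opJ: "open J" unfolding J_def by (intro open_Collect_less continuous_intros)
  have opI: "open I" unfolding I_def by (intro open_Int opJ open_vimage cc assms(1))
  have c0: "c 0 = y" by (simp add: c_def s_def)
  have smc: "Ck_on k I c" for k
    unfolding c_def s_def by (intro Ck_on_intros opI) (auto simp: I_def J_def)
  have "c t \<in> O' \<inter> sphere 0 1" if "t \<in> I" for t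
  proof -
    have "(s t)\<^sup>2 = 1 - t\<^sup>2 * (w \<bullet> w)" using that by (simp add: s_def I_def J_def)
    moreover have "y \<bullet> y = 1" using assms(2) by (simp add: norm_eq_1)
    ultimately have "c t \<bullet> c t = 1"
      using assms(3) by (simp add: c_def inner_add_left inner_add_right inner_commute power2_eq_square)
    then show ?thesis using that by (simp add: I_def norm_eq_1)
  qed
  moreover have "(c has_vector_derivative w) (at 0)"
  proof -
    have "(s has_real_derivative 0) (at 0)"
      unfolding s_def by (auto intro!: derivative_eq_intros)
    then show ?thesis unfolding c_def by (auto intro!: derivative_eq_intros)
  qed
  ultimately show ?thesis
    using tangent_spaceI[OF opI _ smc _ c0] c0 assms(2) by (simp add: I_def J_def)
qed

lemma tangents_approximable_open_in_sphere:
  fixes X :: "'a::euclidean_space set"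
  assumes X: "X \<subseteq> sphere 0 1" and O: "open O'"
  shows "tangents_approximable X (O' \<inter> sphere 0 1)"
  unfolding tangents_approximable_def
proof (intro ballI allI impI)
  fix x v and y :: "nat \<Rightarrow> 'a"
  assume x: "x \<in> X" and v: "v \<in> tangent_space X x"
    and y: "\<forall>k. y k \<in> O' \<inter> sphere 0 1" and lim: "y \<longlonglongrightarrow> x"
  let ?w = "\<lambda>k. v - (v \<bullet> y k) *\<^sub>R y k"
  have "?w k \<in> tangent_space (O' \<inter> sphere 0 1) (y k)" for k
  proof (rule tangent_space_open_in_sphere[OF O])
    have "y k \<bullet> y k = 1" using y by (simp add: norm_eq_1)
    then show "y k \<bullet> ?w k = 0" by (simp add: inner_diff_right inner_commute)
  qed (use y in blast)
  moreover have "?w \<longlonglongrightarrow> v - (v \<bullet> x) *\<^sub>R x" by (intro tendsto_intros lim)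
  moreover have "v \<bullet> x = 0" using tangent_space_sphere_orthogonal[OF X v] by (simp add: inner_commute)
  ultimately show "\<exists>w. (\<forall>\<^sub>F k in sequentially. w k \<in> tangent_space (O' \<inter> sphere 0 1) (y k)) \<and> w \<longlonglongrightarrow> v"
    by (intro exI[of _ ?w]) auto
qed

section \<open>The discriminant and the gap\<close>

lemma vector_4 [simp]:
  "(vector [a, b, c, d] :: 'a::zero^4) $ 1 = a" "(vector [a, b, c, d] :: 'a^4) $ 2 = b"
  "(vector [a, b, c, d] :: 'a^4) $ 3 = c" "(vector [a, b, c, d] :: 'a^4) $ 4 = d"
  unfolding vector_def by simp_all

lemma vec4_eq_iff: "(x :: 'a^4) = y \<longleftrightarrow> x$1 = y$1 \<and> x$2 = y$2 \<and> x$3 = y$3 \<and> x$4 = y$4"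
  by (simp add: vec_eq_iff forall_4)

lemma vector_4_eta: "vector [x$1, x$2, x$3, x$4] = (x :: 'a::zero^4)"
  by (simp add: vec4_eq_iff)

lemma inner_4: "x \<bullet> y = x$1 * y$1 + x$2 * y$2 + x$3 * y$3 + x$4 * y$4" for x y :: "real^4"
  by (simp add: inner_vec_def sum_4)

lemma mem_sphere_4: "x \<in> Sphere3 \<longleftrightarrow> (x$1)\<^sup>2 + (x$2)\<^sup>2 + (x$3)\<^sup>2 + (x$4)\<^sup>2 = 1"
  by (simp add: norm_eq_1 inner_4 power2_eq_square)

lemma norm_4_eq_1: "norm x = 1 \<longleftrightarrow> (x$1)\<^sup>2 + (x$2)\<^sup>2 + (x$3)\<^sup>2 + (x$4)\<^sup>2 = 1" for x :: "real^4"
  using mem_sphere_4 by simp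

text \<open>
  The square of the traceless part of \<open>H_r\<close> on an eigenspace of \<open>M5\<close>.
\<close>

definition disc :: "real^4 \<Rightarrow> complex" where
  "disc x = Complex ((x$2)\<^sup>2 - (x$3)\<^sup>2 - (x$4)\<^sup>2) (- 2 * x$2 * x$4)"

text \<open>
  The square of the real part of a square root of \<open>disc x\<close>; see \<open>rho2_eq\<close>.
\<close>

definition rho2 :: "real^4 \<Rightarrow> real" where
  "rho2 x = (cmod (disc x) + Re (disc x)) / 2"

text \<open>
  The product of the two real parts \<open>x$1 \<plusminus> \<rho>\<close> of the eigenvalues; see \<open>rho_signs\<close>.
\<close>

definition gap :: "real^4 \<Rightarrow> real" where
  "gap x = (x$1)\<^sup>2 - rho2 x"

lemma rho2_nonneg: "rho2 x \<ge> 0"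
  using abs_Re_le_cmod[of "disc x"] by (simp add: rho2_def)

text \<open>
  As a polynomial in \<open>(x$1)\<^sup>2\<close>, \<open>F\<close> is quadratic with roots \<open>(cmod (disc x) + Re (disc x)) / 2\<close> and
  \<open>(Re (disc x) - cmod (disc x)) / 2\<close>, whose product is \<open>- (Im (disc x) / 2)\<^sup>2 = - (x$2 * x$4)\<^sup>2\<close>.
\<close>

lemma F_eq_gap: "F x = gap x * ((x$1)\<^sup>2 + (cmod (disc x) - Re (disc x)) / 2)"
proof -
  let ?m = "cmod (disc x)" and ?r = "Re (disc x)"
  have "(?m + ?r) * (?m - ?r) = (Im (disc x))\<^sup>2"
    using cmod_power2[of "disc x"] by (simp add: algebra_simps power2_eq_square)
  then have "rho2 x * ((?m - ?r) / 2) = (x$2 * x$4)\<^sup>2"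
    by (simp add: rho2_def disc_def power2_eq_square)
  moreover have "gap x * ((x$1)\<^sup>2 + (?m - ?r) / 2) = (x$1)\<^sup>2 * (x$1)\<^sup>2 - (x$1)\<^sup>2 * ?r - rho2 x * ((?m - ?r) / 2)"
    by (simp add: gap_def rho2_def field_simps)
  ultimately show ?thesis
    by (simp add: F_def disc_def algebra_simps power_mult_distrib power2_eq_square)
qed

lemma continuous_on_gap: "continuous_on S gap"
  unfolding gap_def rho2_def disc_def complex_eq cmod_def
  by (intro continuous_intros) simp_all

lemma gap_scale: "gap (c *\<^sub>R x) = c\<^sup>2 * gap x"
proof -
  have "disc (c *\<^sub>R x) = of_real (c\<^sup>2) * disc x"
    by (simp add: disc_def complex_eq_iff algebra_simps power2_eq_square)
  then have "rho2 (c *\<^sub>R x) = c\<^sup>2 * rho2 x"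
    by (simp add: rho2_def norm_mult norm_power algebra_simps)
  then show ?thesis by (simp add: gap_def algebra_simps power2_eq_square)
qed

lemma gap_pos_imp: "gap x > 0 \<Longrightarrow> x$1 \<noteq> 0"
  using rho2_nonneg[of x] by (auto simp: gap_def)

lemma rho2_eq_0_iff: "rho2 x = 0 \<longleftrightarrow> x$2 = 0 \<or> x$4 = 0 \<and> (x$2)\<^sup>2 \<le> (x$3)\<^sup>2"
proof -
  have "rho2 x = 0 \<longleftrightarrow> cmod (disc x) = - Re (disc x)" by (auto simp: rho2_def)
  also have "\<dots> \<longleftrightarrow> Im (disc x) = 0 \<and> Re (disc x) \<le> 0"
  proof
    assume h: "cmod (disc x) = - Re (disc x)"
    then have "Re (disc x) \<le> 0" by (metis neg_0_le_iff_le norm_ge_zero)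
    moreover have "(Im (disc x))\<^sup>2 = 0" using cmod_power2[of "disc x"] h by simp
    ultimately show "Im (disc x) = 0 \<and> Re (disc x) \<le> 0" by simp
  next
    assume "Im (disc x) = 0 \<and> Re (disc x) \<le> 0"
    then show "cmod (disc x) = - Re (disc x)" by (simp add: cmod_def)
  qed
  also have "\<dots> \<longleftrightarrow> x$2 = 0 \<or> x$4 = 0 \<and> (x$2)\<^sup>2 \<le> (x$3)\<^sup>2"
    by (auto simp: disc_def)
  finally show ?thesis .
qed

lemma gap_neg_imp: "gap x < 0 \<Longrightarrow> x$2 \<noteq> 0"
  using rho2_eq_0_iff[of x] by (auto simp: gap_def)

lemma gap_zero_imp: "gap x = 0 \<Longrightarrow> x$1 \<noteq> 0 \<Longrightarrow> x$2 \<noteq> 0"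
  using rho2_eq_0_iff[of x] by (auto simp: gap_def)

lemma gap_zero_on_equator:
  "x$1 = 0 \<Longrightarrow> gap x = 0 \<longleftrightarrow> x$2 = 0 \<or> x$4 = 0 \<and> (x$2)\<^sup>2 \<le> (x$3)\<^sup>2"
  using rho2_eq_0_iff[of x] by (auto simp: gap_def)

lemma gap_zero_iff_F: "x$1 \<noteq> 0 \<Longrightarrow> gap x = 0 \<longleftrightarrow> F x = 0"
proof -
  assume "x$1 \<noteq> 0"
  then have "(x$1)\<^sup>2 + (cmod (disc x) - Re (disc x)) / 2 > 0"
    using complex_Re_le_cmod[of "disc x"] by (intro add_pos_nonneg) auto
  then show ?thesis by (auto simp: F_eq_gap)
qed

text \<open>
  The parametrisation of the surface in equations. The slope \<open>s = x$1 / x$2\<close> is the first parameter; the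
  second one, given by \<open>cos t = sqrt 2 * x$2\<close> and \<open>s * sin t = x$4\<close>, is eliminated by
  \<open>cos\<^sup>2 + sin\<^sup>2 = 1\<close>.
\<close>

lemma gap_zero_slope_form:
  assumes "x$1 = s * x$2" "s \<noteq> 0" "x$2 \<noteq> 0"
  shows "x \<in> Sphere3 \<and> gap x = 0 \<longleftrightarrow>
    (x$3)\<^sup>2 = (1 - s\<^sup>2) * (1 - (x$2)\<^sup>2) \<and> (x$4)\<^sup>2 = s\<^sup>2 * (1 - 2 * (x$2)\<^sup>2)"
    (is "?L \<longleftrightarrow> ?R")
proof -
  have g: "gap x = 0 \<longleftrightarrow> F x = 0" using gap_zero_iff_F assms by simp
  let ?u = "(x$2)\<^sup>2" and ?v = "(x$3)\<^sup>2" and ?w = "(x$4)\<^sup>2" and ?q = "s\<^sup>2"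
  have F: "F x = ?u * ((?q - 1) * (?q * ?u + ?w) + ?q * ?v)"
    unfolding F_def assms(1) by (simp add: algebra_simps power_mult_distrib)
  have q: "?q \<noteq> 0" "?u \<noteq> 0" using assms by auto
  have L: "?L \<longleftrightarrow> ?q * ?u + ?u + ?v + ?w = 1 \<and> (?q - 1) * (?q * ?u + ?w) + ?q * ?v = 0"
    unfolding g F mem_sphere_4 using q assms(1) by (simp add: power_mult_distrib)
  show ?thesis
  proof
    assume ?L
    then have e: "?q * ?u + ?u + ?v + ?w = 1" "(?q - 1) * (?q * ?u + ?w) + ?q * ?v = 0" using L by auto
    have "?w = ?q * (1 - 2 * ?u)" using e by algebra
    moreover from this have "?v = (1 - ?q) * (1 - ?u)" using e(1) by (simp add: algebra_simps)
    ultimately show ?R by simp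
  next
    assume ?R
    then have vw: "?v = (1 - ?q) * (1 - ?u)" "?w = ?q * (1 - 2 * ?u)" by auto
    show ?L unfolding L vw by (simp add: algebra_simps)
  qed
qed

section \<open>The shapes of the strata\<close>

text \<open>
  The arguments \<open>a\<close>, \<open>b\<close>, \<open>c\<close>, \<open>d\<close> of the following sets are signs \<open>1\<close> or \<open>-1\<close>, and \<open>a * x$1 > 0\<close> says
  that \<open>x$1\<close> has the sign \<open>a\<close>. The two surfaces \<open>Surf 1 b\<close> and \<open>Surf (-1) b\<close> cross along \<open>Double_arc b c\<close>
  up to the point of \<open>Pinch b c\<close>.
\<close>

definition Surf :: "real \<Rightarrow> real \<Rightarrow> (real^4) set" where
  "Surf a b = {x \<in> Sphere3. gap x = 0 \<and> a * x$1 > 0 \<and> b * x$2 > 0}"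

definition Double_arc :: "real \<Rightarrow> real \<Rightarrow> (real^4) set" where
  "Double_arc b c = {x \<in> Sphere3. x$1 = 0 \<and> x$4 = 0 \<and> 0 < b * x$2 \<and> b * x$2 < sqrt 2 / 2 \<and> c * x$3 > 0}"

definition Half_circle :: "real \<Rightarrow> (real^4) set" where
  "Half_circle d = {x \<in> Sphere3. x$1 = 0 \<and> x$2 = 0 \<and> d * x$4 > 0}"

definition Pinch :: "real \<Rightarrow> real \<Rightarrow> (real^4) set" where
  "Pinch b c = {x \<in> Sphere3. x$1 = 0 \<and> x$4 = 0 \<and> b * x$2 = sqrt 2 / 2 \<and> c * x$3 > 0}"

definition Pole :: "real \<Rightarrow> (real^4) set" where
  "Pole c = {x \<in> Sphere3. x$1 = 0 \<and> x$2 = 0 \<and> x$4 = 0 \<and> c * x$3 > 0}"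

text \<open>
  The real parts of all eigenvalues have the sign \<open>a\<close> here, and both signs occur on a mixed cell.
\<close>

definition Definite_cell :: "real \<Rightarrow> (real^4) set" where
  "Definite_cell a = {x \<in> Sphere3. gap x > 0 \<and> a * x$1 > 0}"

definition Mixed_cell :: "real \<Rightarrow> (real^4) set" where
  "Mixed_cell b = {x \<in> Sphere3. gap x < 0 \<and> b * x$2 > 0}"

lemma L_eqs:
  "L1 = Double_arc 1 1" "L2 = Double_arc (-1) 1" "L3 = Double_arc 1 (-1)" "L4 = Double_arc (-1) (-1)"
  "L5 = Half_circle 1" "L6 = Half_circle (-1)"
  unfolding L1_def L2_def L3_def L4_def L5_def L6_def Double_arc_def Half_circle_def by auto

lemma half_sqrt2: "(sqrt 2 / 2)\<^sup>2 = 1/2" "0 < sqrt 2 / 2" "sqrt 2 / 2 < 1"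
proof -
  show *: "(sqrt 2 / 2)\<^sup>2 = 1/2" by (simp add: power_divide)
  show "0 < sqrt 2 / 2" by simp
  show "sqrt 2 / 2 < 1" by (rule power_less_imp_less_base[of _ 2]) (simp_all add: power_divide)
qed

lemma Pinch_eq:
  assumes "\<bar>b\<bar> = 1" "\<bar>c\<bar> = 1"
  shows "Pinch b c = {vector [0, b * (sqrt 2 / 2), c * (sqrt 2 / 2), 0]}"
proof -
  have "x \<in> Pinch b c \<longleftrightarrow> x = vector [0, b * (sqrt 2 / 2), c * (sqrt 2 / 2), 0]" for x
  proof
    assume x: "x \<in> Pinch b c"
    have b: "b * b = 1" and c: "c * c = 1" using assms by (auto simp: abs_if split: if_splits)
    have x2: "x$2 = b * (sqrt 2 / 2)"
    proof -
      have "b * (b * x$2) = b * (sqrt 2 / 2)" using x by (simp add: Pinch_def)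
      then show ?thesis using b by (simp flip: mult.assoc)
    qed
    have "(x$2)\<^sup>2 = 1/2"
      unfolding x2 power_mult_distrib half_sqrt2(1) using b by (simp add: power2_eq_square)
    then have "(x$3)\<^sup>2 = 1/2" using x by (auto simp: Pinch_def norm_4_eq_1)
    then have "(c * x$3)\<^sup>2 = (sqrt 2 / 2)\<^sup>2"
      unfolding power_mult_distrib[of c] half_sqrt2(1) power2_eq_square[of c] c by simp
    moreover have "0 \<le> c * x$3" using x by (simp add: Pinch_def)
    ultimately have "c * x$3 = sqrt 2 / 2"
      using half_sqrt2(2) by (metis less_imp_le power2_eq_imp_eq)
    then have "c * (c * x$3) = c * (sqrt 2 / 2)" by simp
    then have "x$3 = c * (sqrt 2 / 2)" using c by (simp flip: mult.assoc)
    then show "x = vector [0, b * (sqrt 2 / 2), c * (sqrt 2 / 2), 0]"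
      using x x2 by (simp add: vec4_eq_iff Pinch_def)
  next
    assume x: "x = vector [0, b * (sqrt 2 / 2), c * (sqrt 2 / 2), 0]"
    have bc: "b * b = 1" "c * c = 1" using assms by (auto simp: abs_if split: if_splits)
    have x': "x$1 = 0" "x$2 = b * (sqrt 2 / 2)" "x$3 = c * (sqrt 2 / 2)" "x$4 = 0"
      by (simp_all add: x)
    have "(x$2)\<^sup>2 = 1/2" "(x$3)\<^sup>2 = 1/2"
      unfolding x' power_mult_distrib half_sqrt2(1) power2_eq_square[of b] power2_eq_square[of c] bc
      by simp_all
    moreover have "b * x$2 = sqrt 2 / 2" "c * x$3 = sqrt 2 / 2"
      unfolding x' mult.assoc[symmetric] bc by simp_all
    moreover from this have "c * x$3 > 0" using half_sqrt2(2) by metis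
    ultimately show "x \<in> Pinch b c"
      using x'(1,4) by (simp add: Pinch_def norm_4_eq_1)
  qed
  then show ?thesis by blast
qed

lemma Pole_eq:
  assumes "\<bar>c\<bar> = 1"
  shows "Pole c = {vector [0, 0, c, 0]}"
proof -
  have "x \<in> Pole c \<longleftrightarrow> x = vector [0, 0, c, 0]" for x
    using assms by (auto simp: Pole_def norm_4_eq_1 vec4_eq_iff power2_eq_1_iff abs_if split: if_splits)
  then show ?thesis by blast
qed

lemma P_eqs:
  "P1 = Pinch 1 1" "P2 = Pinch (-1) 1" "P3 = Pinch 1 (-1)" "P4 = Pinch (-1) (-1)"
  "P5 = Pole 1" "P6 = Pole (-1)"
  by (simp_all add: P1_def P2_def P3_def P4_def P5_def P6_def Pinch_eq Pole_eq)

section \<open>The parametrisation\<close>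

lemma phi_components:
  fixes \<sigma> s t :: real
  assumes "\<bar>\<sigma>\<bar> = 1" "\<bar>s\<bar> \<le> 1"
  defines "x \<equiv> phi \<sigma> s t"
  shows "x$1 = s * x$2" "x$2 = sqrt 2 / 2 * cos t" "x$4 = s * sin t"
    "(x$3)\<^sup>2 = (1 - s\<^sup>2) * (1 - (x$2)\<^sup>2)" "(x$4)\<^sup>2 = s\<^sup>2 * (1 - 2 * (x$2)\<^sup>2)"
    "x$3 = \<sigma> * sqrt ((1 - s\<^sup>2) * (1 - (x$2)\<^sup>2))"
proof -
  show 1: "x$1 = s * x$2" and 2: "x$2 = sqrt 2 / 2 * cos t" and 4: "x$4 = s * sin t"
    unfolding x_def phi_def Let_def by (simp_all add: mult_ac)
  have sq: "2 * (x$2)\<^sup>2 = (cos t)\<^sup>2"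
    unfolding 2 power_mult_distrib half_sqrt2(1) by simp
  then have s: "(sin t)\<^sup>2 = 1 - 2 * (x$2)\<^sup>2" using sin_cos_squared_add[of t] by linarith
  show 5: "(x$4)\<^sup>2 = s\<^sup>2 * (1 - 2 * (x$2)\<^sup>2)" unfolding 4 power_mult_distrib s ..
  have "x$3 = \<sigma> * sqrt (1 - (x$1)\<^sup>2 - (x$2)\<^sup>2 - (x$4)\<^sup>2)"
    unfolding x_def phi_def Let_def by simp
  also have "1 - (x$1)\<^sup>2 - (x$2)\<^sup>2 - (x$4)\<^sup>2 = (1 - s\<^sup>2) * (1 - (x$2)\<^sup>2)"
    unfolding 1 5 power_mult_distrib by (simp add: algebra_simps)
  finally show 3: "x$3 = \<sigma> * sqrt ((1 - s\<^sup>2) * (1 - (x$2)\<^sup>2))" .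
  have "s\<^sup>2 \<le> 1" using assms(2) by (simp add: abs_square_le_1)
  moreover have "(x$2)\<^sup>2 \<le> 1" using sq cos_squared_eq[of t] zero_le_power2[of "sin t"] by linarith
  moreover have "\<sigma>\<^sup>2 = 1" using assms(1) by (metis power2_abs one_power2)
  ultimately show "(x$3)\<^sup>2 = (1 - s\<^sup>2) * (1 - (x$2)\<^sup>2)"
    unfolding 3 power_mult_distrib by simp
qed

text \<open>
  The equations bound \<open>s\<close> and \<open>x$2\<close> by themselves: the left-hand sides are squares, so that first
  \<open>2 (x$2)\<^sup>2 \<le> 1\<close> and then \<open>s\<^sup>2 \<le> 1\<close>.
\<close>

lemma phi_surjective:
  assumes "x$1 = s * x$2" "s \<noteq> 0" "(x$3)\<^sup>2 = (1 - s\<^sup>2) * (1 - (x$2)\<^sup>2)" "(x$4)\<^sup>2 = s\<^sup>2 * (1 - 2 * (x$2)\<^sup>2)"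
    and \<sigma>: "\<sigma> = (if x$3 \<ge> 0 then 1 else -1)"
  obtains t where "s \<in> {-1..1}" "t \<in> {0..2*pi}" "x = phi \<sigma> s t"
proof -
  have u: "2 * (x$2)\<^sup>2 \<le> 1"
  proof -
    have "0 \<le> s\<^sup>2 * (1 - 2 * (x$2)\<^sup>2)" using assms(4) by (metis zero_le_power2)
    then show ?thesis using assms(2) by (simp add: zero_le_mult_iff)
  qed
  have "0 \<le> (1 - s\<^sup>2) * (1 - (x$2)\<^sup>2)" using assms(3) by (metis zero_le_power2)
  then have "s\<^sup>2 \<le> 1" using u by (auto simp: zero_le_mult_iff)
  then have s: "\<bar>s\<bar> \<le> 1" by (simp add: abs_square_le_1)
  have "(sqrt 2 * x$2)\<^sup>2 + (x$4 / s)\<^sup>2 = 1"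
    using assms(2) by (simp add: power_mult_distrib power_divide assms(4))
  then obtain t where t: "0 \<le> t" "t < 2*pi" "sqrt 2 * x$2 = cos t" "x$4 / s = sin t"
    using sincos_total_2pi by metis
  have \<sigma>1: "\<bar>\<sigma>\<bar> = 1" using \<sigma> by auto
  note p = phi_components[OF \<sigma>1 s, of t]
  have x2: "phi \<sigma> s t $ 2 = x$2" unfolding p(2) t(3)[symmetric] by simp
  have "x$3 = \<sigma> * sqrt ((x$3)\<^sup>2)" using \<sigma> by auto
  then have "x$3 = phi \<sigma> s t $ 3" unfolding p(6) assms(3) x2 .
  moreover have "x$4 = phi \<sigma> s t $ 4" unfolding p(3) t(4)[symmetric] using assms(2) by simp
  ultimately have "x = phi \<sigma> s t" using x2 p(1) assms(1) by (simp add: vec4_eq_iff)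
  moreover have "s \<in> {-1..1}" "t \<in> {0..2*pi}" using s t by auto
  ultimately show thesis using that by blast
qed

text \<open>
  Since \<open>x$1 = s * x$2\<close> and \<open>x$2\<close> has the sign of \<open>cos t\<close>, the signs of \<open>s\<close> and \<open>cos t\<close> fix those of
  \<open>x$1\<close> and \<open>x$2\<close>.
\<close>

lemma surface_piece_eq_Surf:
  assumes "\<bar>k\<bar> = 1" "\<bar>b\<bar> = 1"
  shows "surface_piece {(s, t). k * s > 0 \<and> b * cos t > 0} = Surf (k * b) b"
proof
  have k: "k * k = 1" "b * b = 1" using assms by (auto simp: abs_if split: if_splits)
  have sub: "phi \<sigma> s t \<in> Surf (k * b) b" if "\<bar>\<sigma>\<bar> = 1" "s \<in> {-1..1}" "k * s > 0" "b * cos t > 0" for \<sigma> s t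
  proof -
    let ?x = "phi \<sigma> s t"
    have s: "\<bar>s\<bar> \<le> 1" "s \<noteq> 0" using that by auto
    note p = phi_components[OF that(1) s(1), of t]
    have b2: "b * ?x$2 > 0" using that(4) half_sqrt2(2) unfolding p(2)
      by (metis mult.left_commute mult_pos_pos)
    then have "?x$2 \<noteq> 0" by auto
    then have "?x \<in> Sphere3 \<and> gap ?x = 0" using gap_zero_slope_form[OF p(1) s(2)] p(4,5) by blast
    moreover have "k * b * ?x$1 > 0" unfolding p(1)
      using mult_pos_pos[OF that(3) b2] by (simp add: mult_ac)
    ultimately show ?thesis using b2 by (simp add: Surf_def)
  qed
  then show "surface_piece {(s, t). k * s > 0 \<and> b * cos t > 0} \<subseteq> Surf (k * b) b"
    unfolding surface_piece_def phi_image_def by auto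
  show "Surf (k * b) b \<subseteq> surface_piece {(s, t). k * s > 0 \<and> b * cos t > 0}"
  proof
    fix x assume x: "x \<in> Surf (k * b) b"
    define s where "s = x$1 / x$2"
    have x2: "x$2 \<noteq> 0" "b * x$2 > 0" and x1: "k * b * x$1 > 0" using x by (auto simp: Surf_def)
    then have s0: "s \<noteq> 0" "x$1 = s * x$2" by (auto simp: s_def)
    have "k * s * (x$2)\<^sup>2 = (k * b * x$1) * (b * x$2) / (b * b)"
      using s0(2) k by (simp add: power2_eq_square algebra_simps)
    also have "\<dots> > 0" using x1 x2 k by simp
    finally have ks: "k * s > 0" by (metis zero_less_mult_pos2 zero_less_power2 x2(1))
    define \<sigma> :: real where "\<sigma> = (if x$3 \<ge> 0 then 1 else -1)"
    obtain t where t: "s \<in> {-1..1}" "t \<in> {0..2*pi}" "x = phi \<sigma> s t"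
      using phi_surjective[OF s0(2) s0(1) _ _ \<sigma>_def] gap_zero_slope_form[OF s0(2) s0(1) x2(1)] x
      by (auto simp: Surf_def)
    have "x$2 = sqrt 2 / 2 * cos t" using t phi_components(2)[of \<sigma> s t] by (auto simp: \<sigma>_def)
    then have "sqrt 2 / 2 * (b * cos t) = b * x$2" by simp
    then have "sqrt 2 / 2 * (b * cos t) > 0" using x2(2) by metis
    then have bt: "b * cos t > 0" using half_sqrt2(2) by (simp add: zero_less_mult_iff)
    have "\<sigma> = 1 \<or> \<sigma> = -1" by (simp add: \<sigma>_def)
    then show "x \<in> surface_piece {(s, t). k * s > 0 \<and> b * cos t > 0}"
      unfolding surface_piece_def phi_image_def using t ks bt by auto
  qed
qed

lemma S_eqs: "S1 = Surf 1 1" "S2 = Surf (-1) (-1)" "S3 = Surf (-1) 1" "S4 = Surf 1 (-1)"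
  unfolding S1_def S2_def S3_def S4_def
  using surface_piece_eq_Surf[of 1 1] surface_piece_eq_Surf[of 1 "-1"]
    surface_piece_eq_Surf[of "-1" 1] surface_piece_eq_Surf[of "-1" "-1"]
  by simp_all

lemma S_plus_minus: "S_plus \<union> S_minus = {x \<in> Sphere3. gap x = 0}"
proof
  have "phi \<sigma> s t \<in> Sphere3 \<and> gap (phi \<sigma> s t) = 0" if "\<bar>\<sigma>\<bar> = 1" "s \<in> {-1..1}" for \<sigma> s t
  proof -
    let ?x = "phi \<sigma> s t"
    have s: "\<bar>s\<bar> \<le> 1" using that by auto
    note p = phi_components[OF that(1) s, of t]
    consider "s \<noteq> 0" "?x$2 \<noteq> 0" | "?x$2 = 0" | "s = 0" by blast
    then show ?thesis
    proof cases
      case 1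
      then show ?thesis using gap_zero_slope_form[OF p(1)] p(4,5) by blast
    next
      case 2
      then show ?thesis using p(1,4,5) by (simp add: norm_4_eq_1 gap_zero_on_equator)
    next
      case 3
      have "(?x$2)\<^sup>2 \<le> 1/2"
        unfolding p(2) power_mult_distrib half_sqrt2(1) by (simp add: abs_square_le_1)
      with 3 show ?thesis using p(1,4,5) by (simp add: norm_4_eq_1 gap_zero_on_equator)
    qed
  qed
  then show "S_plus \<union> S_minus \<subseteq> {x \<in> Sphere3. gap x = 0}"
    unfolding S_plus_def S_minus_def phi_image_def by auto
  show "{x \<in> Sphere3. gap x = 0} \<subseteq> S_plus \<union> S_minus"
  proof
    fix x assume x: "x \<in> {x \<in> Sphere3. gap x = 0}"
    define \<sigma> :: real where "\<sigma> = (if x$3 \<ge> 0 then 1 else -1)"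
    have "\<exists>s t. s \<in> {-1..1} \<and> t \<in> {0..2*pi} \<and> x = phi \<sigma> s t"
    proof (cases "x$1 = 0")
      case False
      then have x2: "x$2 \<noteq> 0" using gap_zero_imp x by auto
      let ?s = "x$1 / x$2"
      have s: "x$1 = ?s * x$2" "?s \<noteq> 0" using x2 False by auto
      from phi_surjective[OF s _ _ \<sigma>_def] gap_zero_slope_form[OF s x2] x show ?thesis by blast
    next
      case True
      have \<sigma>: "\<bar>\<sigma>\<bar> = 1" "x$3 = \<sigma> * sqrt ((x$3)\<^sup>2)" by (simp_all add: \<sigma>_def)
      consider "x$2 = 0" | "x$4 = 0" "(x$2)\<^sup>2 \<le> (x$3)\<^sup>2" using gap_zero_on_equator[OF True] x by auto
      then show ?thesis
      proof cases
        case 1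
        then have n: "(x$3)\<^sup>2 = 1 - (x$4)\<^sup>2" using x True by (simp add: norm_4_eq_1)
        then have "\<bar>x$4\<bar> \<le> 1" using zero_le_power2[of "x$3"] by (simp add: abs_square_le_1)
        moreover from this have "x = phi \<sigma> (x$4) (pi/2)"
          using phi_components[OF \<sigma>(1), of "x$4" "pi/2"] \<sigma>(2) n 1 True by (simp add: vec4_eq_iff)
        ultimately show ?thesis by (intro exI[of _ "x$4"] exI[of _ "pi/2"]) auto
      next
        case 2
        then have n: "(x$3)\<^sup>2 = 1 - (x$2)\<^sup>2" using x True by (simp add: norm_4_eq_1)
        then have "(sqrt 2 * x$2)\<^sup>2 \<le> 1" using 2 by (simp add: power_mult_distrib)
        then have c: "\<bar>sqrt 2 * x$2\<bar> \<le> 1" by (simp only: abs_square_le_1)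
        let ?t = "arccos (sqrt 2 * x$2)"
        have ct: "cos ?t = sqrt 2 * x$2" using c by (intro cos_arccos) auto
        have "\<bar>0 :: real\<bar> \<le> 1" by simp
        note p = phi_components[OF \<sigma>(1) this, of ?t]
        have p2: "phi \<sigma> 0 ?t $ 2 = x$2" unfolding p(2) ct by simp
        have "phi \<sigma> 0 ?t $ 3 = x$3" using p(6) \<sigma>(2) unfolding n p2 by simp
        then have "x = phi \<sigma> 0 ?t"
          using p(1,3) p2 2 True by (simp add: vec4_eq_iff)
        moreover have "?t \<in> {0..2*pi}"
        proof -
          have "0 \<le> ?t \<and> ?t \<le> pi" using c by (intro arccos_bounded) (simp_all add: abs_le_iff)
          then show ?thesis using pi_gt_zero by simp
        qed
        ultimately show ?thesis by (intro exI[of _ 0] exI[of _ ?t]) auto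
      qed
    qed
    moreover have "\<sigma> = 1 \<or> \<sigma> = -1" by (simp add: \<sigma>_def)
    ultimately show "x \<in> S_plus \<union> S_minus"
      unfolding S_plus_def S_minus_def phi_image_def by auto
  qed
qed

text \<open>
  Off \<open>x$1 = 0\<close> the functions \<open>F\<close> and \<open>gap\<close> have the same zeros. On \<open>x$1 = 0\<close> the polynomial \<open>F\<close> vanishes
  for \<open>x$2 * x$4 = 0\<close>, while \<open>gap\<close> requires in addition \<open>(x$2)\<^sup>2 \<le> (x$3)\<^sup>2\<close> if \<open>x$2 \<noteq> 0\<close>; on the sphere with
  \<open>x$4 = 0\<close> this means \<open>(x$2)\<^sup>2 \<le> 1/2\<close>.
\<close>

lemma critical_surface_minus_handles: "critical_surface - handles = {x \<in> Sphere3. gap x = 0}"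
proof -
  have "x \<in> critical_surface - handles \<longleftrightarrow> gap x = 0" if x: "x \<in> Sphere3" for x
  proof (cases "x$1 = 0")
    case False
    then show ?thesis using gap_zero_iff_F[OF False] x by (auto simp: critical_surface_def handles_def)
  next
    case True
    have "x$4 = 0 \<Longrightarrow> (sqrt 2 / 2)\<^sup>2 < (x$2)\<^sup>2 \<longleftrightarrow> (x$3)\<^sup>2 < (x$2)\<^sup>2"
      unfolding half_sqrt2(1) using x True by (auto simp: norm_4_eq_1)
    moreover have "(sqrt 2 / 2)\<^sup>2 < (x$2)\<^sup>2 \<longleftrightarrow> sqrt 2 / 2 < \<bar>x$2\<bar>"
      using abs_le_square_iff[of "x$2" "sqrt 2 / 2"] half_sqrt2(2) by (metis abs_of_pos not_le)
    ultimately show ?thesis using x True gap_zero_on_equator[OF True]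
      by (auto simp: critical_surface_def handles_def F_def)
  qed
  moreover have "critical_surface \<subseteq> Sphere3" by (auto simp: critical_surface_def)
  ultimately show ?thesis by blast
qed

section \<open>The surfaces as submanifolds\<close>

lemma dim_coordinate_subspace: "dim {x :: real^'n. \<forall>i. i \<notin> I \<longrightarrow> x$i = 0} = card I"
  using dim_substandard_cart[of I, where 'a = real] unfolding dim_vec_eq .

text \<open>
  The surface is the intersection of the unit sphere with a cone, and \<open>x$1 \<noteq> 0\<close> on it. In the projective
  coordinates \<open>p = x$2 / x$1\<close>, \<open>q = x$3 / x$1\<close>, \<open>r = x$4 / x$1\<close> the cone is the graph
  \<open>p = a * b * sqrt (1 + q\<^sup>2 / (1 + r\<^sup>2))\<close>; straightening it and using \<open>x \<bullet> x - 1\<close> as fourth coordinate gives a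
  slice chart on the half space where \<open>x$1\<close> has the sign \<open>a\<close>.
\<close>

lemma smooth_submanifold_Surf:
  assumes a: "\<bar>a\<bar> = 1" and b: "\<bar>b\<bar> = 1"
  shows "smooth_submanifold 2 (Surf a b)"
  unfolding smooth_submanifold_def
proof
  have ab: "a * a = 1" "b * b = 1" using a b by (auto simp: abs_if split: if_splits)
  fix p assume p: "p \<in> Surf a b"
  define h where "h q r = a * b * sqrt (1 + q\<^sup>2 / (1 + r\<^sup>2))" for q r :: real
  define f :: "real^4 \<Rightarrow> real^4" where "f x = vector
    [(x$1)\<^sup>2 + (x$2)\<^sup>2 + (x$3)\<^sup>2 + (x$4)\<^sup>2 - 1, x$2 / x$1 - h (x$3 / x$1) (x$4 / x$1), x$3 / x$1, x$4 / x$1]" for x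
  define m where "m y = y$2 + h (y$3) (y$4)" for y :: "real^4"
  define k where "k y = a * sqrt ((1 + y$1) / (1 + (m y)\<^sup>2 + (y$3)\<^sup>2 + (y$4)\<^sup>2))" for y :: "real^4"
  define g :: "real^4 \<Rightarrow> real^4" where "g y = vector [k y, k y * m y, k y * y$3, k y * y$4]" for y
  define U where "U = {x::real^4. a * x$1 > 0}"
  define W where "W = {y::real^4. 1 + y$1 > 0}"
  define E where "E = {y::real^4. y$1 = 0 \<and> y$2 = 0}"
  have opU: "open U" unfolding U_def by (intro open_Collect_less continuous_intros)
  have opW: "open W" unfolding W_def by (intro open_Collect_less continuous_intros)
  have U0: "x$1 \<noteq> 0" if "x \<in> U" for x using that by (auto simp: U_def)
  have den: "1 + (m y)\<^sup>2 + (y$3)\<^sup>2 + (y$4)\<^sup>2 > 0" for y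
    by (metis add_pos_nonneg zero_le_power2 zero_less_one)
  have den1: "1 + r\<^sup>2 > 0" "1 + q\<^sup>2 / (1 + r\<^sup>2) > 0" for q r :: real
    by (auto intro!: add_pos_nonneg divide_nonneg_nonneg)
  have k2: "(k y)\<^sup>2 = (1 + y$1) / (1 + (m y)\<^sup>2 + (y$3)\<^sup>2 + (y$4)\<^sup>2)" and ak: "a * k y > 0" if "y \<in> W" for y
  proof -
    have pos: "(1 + y$1) / (1 + (m y)\<^sup>2 + (y$3)\<^sup>2 + (y$4)\<^sup>2) > 0"
      using that den[of y] by (simp add: W_def)
    show "(k y)\<^sup>2 = (1 + y$1) / (1 + (m y)\<^sup>2 + (y$3)\<^sup>2 + (y$4)\<^sup>2)"
      unfolding k_def power_mult_distrib using pos ab(1) by (simp add: power2_eq_square[of a])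
    have "a * k y = (a * a) * sqrt ((1 + y$1) / (1 + (m y)\<^sup>2 + (y$3)\<^sup>2 + (y$4)\<^sup>2))"
      by (simp add: k_def)
    then show "a * k y > 0" using pos ab(1) by simp
  qed
  have norm_g: "(g y $ 1)\<^sup>2 + (g y $ 2)\<^sup>2 + (g y $ 3)\<^sup>2 + (g y $ 4)\<^sup>2 = 1 + y$1" if "y \<in> W" for y
  proof -
    have "(g y $ 1)\<^sup>2 + (g y $ 2)\<^sup>2 + (g y $ 3)\<^sup>2 + (g y $ 4)\<^sup>2 = (k y)\<^sup>2 * (1 + (m y)\<^sup>2 + (y$3)\<^sup>2 + (y$4)\<^sup>2)"
      by (simp add: g_def power_mult_distrib algebra_simps)
    then show ?thesis using k2[OF that] den[of y] by simp
  qed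
  have gU: "g y \<in> U" if "y \<in> W" for y using ak[OF that] by (simp add: U_def g_def)
  have fg: "f (g y) = y" if "y \<in> W" for y
  proof -
    have "k y \<noteq> 0" using ak[OF that] by auto
    then show ?thesis using norm_g[OF that]
      by (simp add: vec4_eq_iff f_def) (simp add: g_def m_def)
  qed
  have fW: "f x \<in> W" if "x \<in> U" for x
  proof -
    have "(x$1)\<^sup>2 > 0" using U0[OF that] by simp
    then have "(x$1)\<^sup>2 + (x$2)\<^sup>2 + (x$3)\<^sup>2 + (x$4)\<^sup>2 > 0" by (metis add_pos_nonneg zero_le_power2)
    then show ?thesis by (simp add: W_def f_def)
  qed
  have gf: "g (f x) = x" if "x \<in> U" for x
  proof -
    have mf: "m (f x) = x$2 / x$1" by (simp add: m_def f_def)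
    have "1 + f x $ 1 = (x$1)\<^sup>2 * (1 + (m (f x))\<^sup>2 + (f x $ 3)\<^sup>2 + (f x $ 4)\<^sup>2)"
      unfolding mf using U0[OF that] by (simp add: f_def field_simps)
    then have "(1 + f x $ 1) / (1 + (m (f x))\<^sup>2 + (f x $ 3)\<^sup>2 + (f x $ 4)\<^sup>2) = (x$1)\<^sup>2"
      using den[of "f x"] by simp
    then have "k (f x) = a * \<bar>x$1\<bar>" unfolding k_def by simp
    moreover have "a * \<bar>x$1\<bar> = x$1"
      using that ab a by (auto simp: U_def abs_if split: if_splits)
    ultimately have kf: "k (f x) = x$1" by simp
    show ?thesis unfolding g_def mf kf using U0[OF that] by (simp add: vec4_eq_iff f_def)
  qed
  have smf: "Ck_on n U f" for n
  proof (rule Ck_on_vec[OF opU])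
    fix i :: 4
    have "Ck_on n U (\<lambda>x. (x$1)\<^sup>2 + (x$2)\<^sup>2 + (x$3)\<^sup>2 + (x$4)\<^sup>2 - 1)"
      by (intro Ck_on_intros opU)
    moreover have "Ck_on n U (\<lambda>x. x$2 / x$1 - h (x$3 / x$1) (x$4 / x$1))"
      unfolding h_def using den1 by (intro Ck_on_intros opU) (auto simp: U0 less_imp_neq[symmetric])
    moreover have "Ck_on n U (\<lambda>x. x$3 / x$1)" "Ck_on n U (\<lambda>x. x$4 / x$1)"
      by (intro Ck_on_intros opU U0; assumption)+
    ultimately show "Ck_on n U (\<lambda>x. f x $ i)"
      using exhaust_4[of i] by (auto simp: f_def)
  qed
  have smg: "Ck_on n W g" for n
  proof (rule Ck_on_vec[OF opW])
    fix i :: 4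
    have m: "Ck_on n W m"
      unfolding m_def h_def using den1 by (intro Ck_on_intros opW) (auto simp: less_imp_neq[symmetric])
    have k: "Ck_on n W k"
      unfolding k_def using den by (intro Ck_on_intros opW m) (auto simp: W_def less_imp_neq[symmetric])
    have "Ck_on n W (\<lambda>y. k y * m y)" "Ck_on n W (\<lambda>y. k y * y$3)" "Ck_on n W (\<lambda>y. k y * y$4)"
      by (intro Ck_on_intros opW m k)+
    with k show "Ck_on n W (\<lambda>y. g y $ i)"
      using exhaust_4[of i] by (auto simp: g_def)
  qed
  have sm: "smooth_on U f" "smooth_on W g" using smf smg by (auto simp: smooth_on_def)
  have hom: "homeomorphism U W f g"
    unfolding homeomorphism_def
    using gf fg fW gU smooth_on_imp_continuous_on[OF sm(1)] smooth_on_imp_continuous_on[OF sm(2)]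
    by (metis image_eqI image_subsetI subset_antisym subsetI)
  have slice: "x \<in> Surf a b \<longleftrightarrow> f x \<in> E" if x: "x \<in> U" for x
  proof -
    have x1: "x$1 \<noteq> 0" "a * x$1 > 0" using U0[OF x] x by (auto simp: U_def)
    let ?u = "x$3 / x$1" and ?v = "x$4 / x$1"
    have pos: "1 + ?u\<^sup>2 / (1 + ?v\<^sup>2) > 0" using den1 by blast
    have abx: "a * b * (x$2 / x$1) > 0 \<longleftrightarrow> b * x$2 > 0"
    proof -
      have "a \<noteq> 0" using ab(1) by auto
      then have "a * a * (b * x$2) / (a * x$1) = a * b * (x$2 / x$1)" using x1(1)
        by (simp add: field_simps)
      then have "a * b * (x$2 / x$1) = (b * x$2) / (a * x$1)" unfolding ab(1) by simp
      then show ?thesis using x1(2) by (simp add: zero_less_divide_iff)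
    qed
    have "F x = (x$1)\<^sup>2 * (x$1)\<^sup>2 * (1 + ?v\<^sup>2) * (1 + ?u\<^sup>2 / (1 + ?v\<^sup>2) - (x$2 / x$1)\<^sup>2)"
    proof -
      define q where "q = ?u\<^sup>2 / (1 + ?v\<^sup>2)"
      have q: "(1 + ?v\<^sup>2) * q = ?u\<^sup>2" using den1(1)[of ?v] by (simp add: q_def)
      have "(x$1)\<^sup>2 * (x$1)\<^sup>2 * (1 + ?v\<^sup>2) * (1 + q - (x$2 / x$1)\<^sup>2) =
        (x$1)\<^sup>2 * (x$1)\<^sup>2 * (1 + ?v\<^sup>2 + (1 + ?v\<^sup>2) * q - (1 + ?v\<^sup>2) * (x$2 / x$1)\<^sup>2)"
        by (simp add: algebra_simps)
      also have "\<dots> = F x" unfolding q using x1(1) by (simp add: F_def field_simps power2_eq_square)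
      finally show ?thesis unfolding q_def ..
    qed
    then have "F x = 0 \<longleftrightarrow> (x$2 / x$1)\<^sup>2 = 1 + ?u\<^sup>2 / (1 + ?v\<^sup>2)"
      using x1 den1(1)[of ?v] by auto
    then have gap: "gap x = 0 \<longleftrightarrow> (x$2 / x$1)\<^sup>2 = 1 + ?u\<^sup>2 / (1 + ?v\<^sup>2)"
      using gap_zero_iff_F[OF x1(1)] by simp
    have "gap x = 0 \<and> b * x$2 > 0 \<longleftrightarrow> x$2 / x$1 = h ?u ?v"
    proof
      assume h1: "gap x = 0 \<and> b * x$2 > 0"
      have "(a * b * (x$2 / x$1))\<^sup>2 = (x$2 / x$1)\<^sup>2"
        unfolding power_mult_distrib power2_eq_square[of a] power2_eq_square[of b] ab by simp
      then have "sqrt (1 + ?u\<^sup>2 / (1 + ?v\<^sup>2)) = a * b * (x$2 / x$1)"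
        using h1 gap abx by (intro real_sqrt_unique) auto
      then show "x$2 / x$1 = h ?u ?v" unfolding h_def using ab
        by (metis mult.assoc mult.left_commute mult_1)
    next
      assume h1: "x$2 / x$1 = h ?u ?v"
      have "(h ?u ?v)\<^sup>2 = 1 + ?u\<^sup>2 / (1 + ?v\<^sup>2)"
        unfolding h_def power_mult_distrib using pos ab by (simp add: power2_eq_square[of a] power2_eq_square[of b])
      moreover have "a * b * h ?u ?v = (a * a) * (b * b) * sqrt (1 + ?u\<^sup>2 / (1 + ?v\<^sup>2))"
        unfolding h_def by (simp only: mult_ac)
      then have "a * b * h ?u ?v > 0" using pos ab by simp
      ultimately show "gap x = 0 \<and> b * x$2 > 0" using gap abx h1 by simp
    qed
    then show ?thesis using x1(2) by (auto simp: Surf_def E_def f_def norm_4_eq_1)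
  qed
  have "f ` (U \<inter> Surf a b) = W \<inter> E"
  proof
    show "f ` (U \<inter> Surf a b) \<subseteq> W \<inter> E" using slice fW by auto
    show "W \<inter> E \<subseteq> f ` (U \<inter> Surf a b)"
    proof
      fix y assume y: "y \<in> W \<inter> E"
      then have "g y \<in> U \<inter> Surf a b" using slice[of "g y"] gU fg by auto
      then show "y \<in> f ` (U \<inter> Surf a b)" using fg y by (metis IntD1 image_eqI)
    qed
  qed
  moreover have "subspace E" by (auto simp: E_def subspace_def)
  moreover have "dim E = 2"
  proof -
    have "E = {x. \<forall>i. i \<notin> {3, 4} \<longrightarrow> x$i = 0}" by (auto simp: E_def forall_4)
    then show ?thesis using dim_coordinate_subspace[of "{3, 4 :: 4}"] by simp
  qed
  moreover have "p \<in> U" using p by (simp add: U_def Surf_def)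
  ultimately show "\<exists>U W E (f :: real^4 \<Rightarrow> real^4) g. open U \<and> p \<in> U \<and> open W \<and> homeomorphism U W f g \<and>
     smooth_on U f \<and> smooth_on W g \<and> subspace E \<and> dim E = 2 \<and> f ` (U \<inter> Surf a b) = W \<inter> E"
    using opU opW hom sm by blast
qed

lemma has_vector_derivative_vector_4:
  assumes "(f has_real_derivative a) net" "(g has_real_derivative b) net"
    "(h has_real_derivative c) net" "(k has_real_derivative d) net"
  shows "((\<lambda>t. vector [f t, g t, h t, k t] :: real^4) has_vector_derivative vector [a, b, c, d]) net"
proof -
  have e: "(vector [p, q, r, s] :: real^4) = p *\<^sub>R axis 1 1 + q *\<^sub>R axis 2 1 + r *\<^sub>R axis 3 1 + s *\<^sub>R axis 4 1" for p q r s
    by (simp add: vec4_eq_iff axis_def)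
  have s: "((\<lambda>t. u t *\<^sub>R v) has_vector_derivative w *\<^sub>R v) net"
    if "(u has_real_derivative w) net" for u w and v :: "real^4"
    using bounded_linear.has_vector_derivative[OF bounded_linear_scaleR_left]
      that[unfolded has_real_derivative_iff_has_vector_derivative] .
  show ?thesis unfolding e by (intro has_vector_derivative_add s assms)
qed

lemma Ck_on_vector_4:
  assumes "open U" "Ck_on n U f" "Ck_on n U g" "Ck_on n U h" "Ck_on n U k"
  shows "Ck_on n U (\<lambda>t. vector [f t, g t, h t, k t] :: real^4)"
proof (rule Ck_on_vec[OF assms(1)])
  fix i :: 4
  show "Ck_on n U (\<lambda>t. (vector [f t, g t, h t, k t] :: real^4) $ i)"
    using exhaust_4[of i] assms by auto
qed

text \<open>
  The velocity of the curve with constant slope \<open>x$1 / x$2\<close> along which \<open>x$2\<close> moves with unit speed.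
  Its third and fourth coordinates solve \<open>gap_zero_slope_form\<close>. Near \<open>Double_arc\<close> this field stays bounded and
  tends to a vector tangent to the arc.
\<close>

lemma tangent_Surf_fixed_slope:
  assumes y: "y \<in> Surf a b" and lt: "2 * (y$2)\<^sup>2 < 1"
  shows "vector [y$1 / y$2, 1, - y$2 * y$3 / (1 - (y$2)\<^sup>2), - 2 * y$2 * y$4 / (1 - 2 * (y$2)\<^sup>2)]
    \<in> tangent_space (Surf a b) y"
proof -
  define s where "s = y$1 / y$2"
  have y12: "y$2 \<noteq> 0" "a * y$1 > 0" "b * y$2 > 0" using y by (auto simp: Surf_def)
  then have s: "y$1 = s * y$2" "s \<noteq> 0" by (auto simp: s_def)
  have eqs: "(y$3)\<^sup>2 = (1 - s\<^sup>2) * (1 - (y$2)\<^sup>2)" "(y$4)\<^sup>2 = s\<^sup>2 * (1 - 2 * (y$2)\<^sup>2)"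
    using gap_zero_slope_form[OF s y12(1)] y by (auto simp: Surf_def)
  define c3 where "c3 z = y$3 * sqrt ((1 - z\<^sup>2) / (1 - (y$2)\<^sup>2))" for z
  define c4 where "c4 z = y$4 * sqrt ((1 - 2 * z\<^sup>2) / (1 - 2 * (y$2)\<^sup>2))" for z
  define c :: "real \<Rightarrow> real^4" where
    "c t = vector [s * (y$2 + t), y$2 + t, c3 (y$2 + t), c4 (y$2 + t)]" for t
  define I where "I = {t. b * (y$2 + t) > 0} \<inter> {t. 2 * (y$2 + t)\<^sup>2 < 1}"
  have op: "open I" unfolding I_def by (intro open_Int open_Collect_less continuous_intros)
  have d: "1 - (y$2)\<^sup>2 > 0" "1 - 2 * (y$2)\<^sup>2 > 0" using lt by auto
  have lt1: "1 - z\<^sup>2 > 0" if "2 * z\<^sup>2 < 1" for z :: real using that zero_le_power2[of z] by linarith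
  show ?thesis
  proof (rule tangent_spaceI[OF op])
    show "0 \<in> I" using y12 lt by (simp add: I_def)
    show "Ck_on k I c" for k
      unfolding c_def c3_def c4_def using d lt1
      by (intro Ck_on_vector_4 Ck_on_intros op) (auto simp: I_def)
    show "c 0 = y" using d by (simp add: c_def c3_def c4_def s vec4_eq_iff)
    show "c t \<in> Surf a b" if t: "t \<in> I" for t
    proof -
      let ?z = "y$2 + t"
      have z: "b * ?z > 0" "2 * ?z\<^sup>2 < 1" "?z \<noteq> 0" using t by (auto simp: I_def)
      have 3: "(c3 ?z)\<^sup>2 = (1 - s\<^sup>2) * (1 - ?z\<^sup>2)"
        unfolding c3_def power_mult_distrib eqs using d lt1[OF z(2)] by simp
      have 4: "(c4 ?z)\<^sup>2 = s\<^sup>2 * (1 - 2 * ?z\<^sup>2)"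
        unfolding c4_def power_mult_distrib eqs using d z(2) by simp
      have "c t \<in> Sphere3 \<and> gap (c t) = 0"
        using gap_zero_slope_form[of "c t" s] s(2) z(3) 3 4 by (simp add: c_def)
      moreover have "a * (s * ?z) > 0"
      proof -
        have "b \<noteq> 0" using y12 by auto
        then have "(a * y$1) * (b * ?z) / (b * y$2) = a * (s * ?z)" using y12(1) by (simp add: s_def)
        moreover have "(a * y$1) * (b * ?z) / (b * y$2) > 0"
          by (intro divide_pos_pos mult_pos_pos y12 z)
        ultimately show ?thesis by linarith
      qed
      ultimately show ?thesis using z by (simp add: Surf_def c_def)
    qed
    show "(c has_vector_derivative vector [y$1 / y$2, 1, - y$2 * y$3 / (1 - (y$2)\<^sup>2), - 2 * y$2 * y$4 / (1 - 2 * (y$2)\<^sup>2)]) (at 0)"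
      unfolding c_def c3_def c4_def s_def[symmetric]
    proof (rule has_vector_derivative_vector_4)
      have r: "((\<lambda>t. w * sqrt ((1 - k * (p + t)\<^sup>2) / (1 - k * p\<^sup>2))) has_real_derivative - k * p * w / (1 - k * p\<^sup>2)) (at 0)"
        if "1 - k * p\<^sup>2 > 0" for k p w :: real
      proof -
        have "((\<lambda>t. (1 - k * (p + t)\<^sup>2) / (1 - k * p\<^sup>2)) has_real_derivative - (2 * k * p) / (1 - k * p\<^sup>2)) (at 0)"
          using that by (auto intro!: derivative_eq_intros)
        then show ?thesis using that by (auto intro!: derivative_eq_intros)
      qed
      show "((\<lambda>t. s * (y$2 + t)) has_real_derivative s) (at 0)" "((\<lambda>t. y$2 + t) has_real_derivative 1) (at 0)"
        by (auto intro!: derivative_eq_intros)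
      show "((\<lambda>t. y$3 * sqrt ((1 - (y$2 + t)\<^sup>2) / (1 - (y$2)\<^sup>2))) has_real_derivative - y$2 * y$3 / (1 - (y$2)\<^sup>2)) (at 0)"
        using r[of 1 "y$2" "y$3"] d by simp
      show "((\<lambda>t. y$4 * sqrt ((1 - 2 * (y$2 + t)\<^sup>2) / (1 - 2 * (y$2)\<^sup>2))) has_real_derivative - 2 * y$2 * y$4 / (1 - 2 * (y$2)\<^sup>2)) (at 0)"
        using r[of 2 "y$2" "y$4"] d by simp
    qed
  qed
qed

text \<open>
  For fixed \<open>x$2\<close> and fixed ratio of \<open>x$1\<close> to \<open>x$4\<close>, write \<open>m\<^sup>2 = (x$1)\<^sup>2 + (x$4)\<^sup>2\<close>. Then \<open>F x\<close> vanishes iff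
  \<open>(x$1 / m)\<^sup>2 * (m\<^sup>2 + (x$3)\<^sup>2) = (x$2)\<^sup>2\<close>, so rotating \<open>(m, x$3)\<close> preserves the surface. The field is the
  velocity of this rotation times \<open>m\<close>, which makes it polynomial and nonzero on \<open>Half_circle\<close>.
\<close>

lemma tangent_Surf_rotation:
  assumes y: "y \<in> Surf a b"
  shows "vector [- y$1 * y$3, 0, (y$1)\<^sup>2 + (y$4)\<^sup>2, - y$3 * y$4] \<in> tangent_space (Surf a b) y"
proof -
  have y12: "y$1 \<noteq> 0" "a * y$1 > 0" "b * y$2 > 0" using y by (auto simp: Surf_def)
  define M where "M = (y$1)\<^sup>2 + (y$4)\<^sup>2"
  have M: "M > 0" using y12(1) by (simp add: M_def sum_power2_gt_zero_iff)
  define n where "n t = sqrt (1 - M * t\<^sup>2)" for t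
  define c :: "real \<Rightarrow> real^4" where
    "c t = vector [y$1 * (n t - t * y$3), y$2, y$3 * n t + M * t, y$4 * (n t - t * y$3)]" for t
  define I where "I = {t. M * t\<^sup>2 < 1} \<inter> {t. n t - t * y$3 > 0}"
  have op: "open I" unfolding I_def n_def by (intro open_Int open_Collect_less continuous_intros)
  show ?thesis
  proof (rule tangent_spaceI[OF op])
    show "0 \<in> I" by (simp add: I_def n_def)
    show "Ck_on k I c" for k
      unfolding c_def n_def by (intro Ck_on_vector_4 Ck_on_intros op) (auto simp: I_def)
    show "c 0 = y" by (simp add: c_def n_def vec4_eq_iff)
    show "c t \<in> Surf a b" if t: "t \<in> I" for t
    proof -
      define u w where "u = n t - t * y$3" and "w = y$3 * n t + M * t"
      have u: "u > 0" and n2: "(n t)\<^sup>2 = 1 - M * t\<^sup>2" using t by (auto simp: I_def n_def u_def)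
      have ct: "c t $ 1 = y$1 * u" "c t $ 2 = y$2" "c t $ 3 = w" "c t $ 4 = y$4 * u"
        by (simp_all add: c_def u_def w_def)
      have rot: "M * u\<^sup>2 + w\<^sup>2 = M + (y$3)\<^sup>2"
      proof -
        have "M * u\<^sup>2 + w\<^sup>2 = (M + (y$3)\<^sup>2) * ((n t)\<^sup>2 + M * t\<^sup>2)"
          by (simp add: u_def w_def power2_eq_square algebra_simps)
        then show ?thesis unfolding n2 by simp
      qed
      have "(c t $ 1)\<^sup>2 + (c t $ 2)\<^sup>2 + (c t $ 3)\<^sup>2 + (c t $ 4)\<^sup>2 = (M * u\<^sup>2 + w\<^sup>2) + (y$2)\<^sup>2"
        unfolding ct M_def by (simp add: power_mult_distrib algebra_simps)
      then have "norm (c t) = 1 \<longleftrightarrow> norm y = 1"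
        unfolding rot norm_4_eq_1 by (simp add: M_def algebra_simps)
      moreover have "F (c t) = u\<^sup>2 * F y"
      proof -
        have "F (c t) = u\<^sup>2 * ((y$1)\<^sup>2 * (M * u\<^sup>2 + w\<^sup>2) - (y$2)\<^sup>2 * M)"
          unfolding F_def ct M_def by (simp add: power_mult_distrib algebra_simps)
        also have "\<dots> = u\<^sup>2 * F y" unfolding rot by (simp add: F_def M_def algebra_simps)
        finally show ?thesis .
      qed
      moreover have c1: "c t $ 1 \<noteq> 0" using u y12 by (simp add: ct)
      moreover have "gap y = 0" "norm y = 1" using y by (auto simp: Surf_def)
      ultimately have "gap (c t) = 0" "norm (c t) = 1"
        using gap_zero_iff_F[of y] gap_zero_iff_F[OF c1] y12 by auto
      moreover have "a * c t $ 1 > 0" using mult_pos_pos[OF y12(2) u] by (simp add: ct mult_ac)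
      ultimately show ?thesis using y12 by (simp add: Surf_def ct)
    qed
    have "(n has_real_derivative 0) (at 0)" unfolding n_def by (auto intro!: derivative_eq_intros)
    then show "(c has_vector_derivative vector [- y$1 * y$3, 0, (y$1)\<^sup>2 + (y$4)\<^sup>2, - y$3 * y$4]) (at 0)"
      unfolding c_def M_def[symmetric]
      by (intro has_vector_derivative_vector_4) (auto intro!: derivative_eq_intros simp: n_def)
  qed
qed

section \<open>Closures\<close>

lemma closure_limitI:
  fixes x :: "'a::metric_space"
  assumes "(\<gamma> \<longlongrightarrow> x) (at_right (0::real))" "\<And>e. 0 < e \<Longrightarrow> e < 1 \<Longrightarrow> \<gamma> e \<in> S"
  shows "x \<in> closure S"
proof (rule Lim_in_closed_set[OF closed_closure _ _ assms(1)])
  have "\<forall>\<^sub>F e in at_right (0::real). e \<in> {0<..<1}" by (rule eventually_at_right_real) simp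
  then show "\<forall>\<^sub>F e in at_right 0. \<gamma> e \<in> closure S"
    by eventually_elim (use assms(2) closure_subset in auto)
qed simp

lemma tendsto_vector_4:
  assumes "(f \<longlongrightarrow> a) net" "(g \<longlongrightarrow> b) net" "(h \<longlongrightarrow> c) net" "(k \<longlongrightarrow> d) net"
  shows "((\<lambda>t. vector [f t, g t, h t, k t] :: real^4) \<longlongrightarrow> vector [a, b, c, d]) net"
proof (rule vec_tendstoI)
  fix i :: 4
  show "((\<lambda>t. (vector [f t, g t, h t, k t] :: real^4) $ i) \<longlongrightarrow> (vector [a, b, c, d] :: real^4) $ i) net"
    using exhaust_4[of i] assms by auto
qed

lemma closed_Collect_sphere:
  assumes "closed {x. P x}"
  shows "closed {x \<in> Sphere3. P x}"
proof -
  have "{x \<in> Sphere3. P x} = Sphere3 \<inter> {x. P x}" by auto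
  then show ?thesis using assms by (simp add: closed_Int)
qed

lemma sign_square: "\<bar>b\<bar> = 1 \<Longrightarrow> b * b = (1::real)"
  by (auto simp: abs_if split: if_splits)

lemma closed_gap: "closed {x. gap x = c}" "closed {x. gap x \<le> c}" "closed {x. gap x \<ge> c}"
  by (intro closed_Collect_eq closed_Collect_le continuous_on_gap continuous_intros)+

text \<open>
  Keep \<open>x$2\<close> and let the slope \<open>a * b * e\<close> tend to \<open>0\<close>; its sign places the curve in \<open>Surf a b\<close>.
\<close>

lemma Surf_limit_on_Double_arc:
  assumes a: "\<bar>a\<bar> = 1" and b: "\<bar>b\<bar> = 1"
    and x: "x \<in> Sphere3" "x$1 = 0" "x$4 = 0" "(x$2)\<^sup>2 \<le> (x$3)\<^sup>2" "b * x$2 > 0"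
  shows "x \<in> closure (Surf a b)"
proof -
  have n: "(x$3)\<^sup>2 = 1 - (x$2)\<^sup>2" using x by (simp add: norm_4_eq_1)
  define \<gamma> :: "real \<Rightarrow> real^4" where "\<gamma> e = vector
    [a * b * e * x$2, x$2, x$3 * sqrt (1 - e\<^sup>2), e * sqrt (1 - 2 * (x$2)\<^sup>2)]" for e
  have ne: "a * b \<noteq> 0" "x$2 \<noteq> 0" using a b x(5) by auto
  have ab2: "(a * b)\<^sup>2 = 1" unfolding power_mult_distrib power2_eq_square[of a] power2_eq_square[of b] sign_square[OF a] sign_square[OF b] by simp
  have "(\<gamma> \<longlongrightarrow> vector [a * b * 0 * x$2, x$2, x$3 * sqrt (1 - 0\<^sup>2), 0 * sqrt (1 - 2 * (x$2)\<^sup>2)]) (at_right 0)"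
    unfolding \<gamma>_def by (intro tendsto_vector_4 tendsto_intros)
  moreover have "vector [a * b * 0 * x$2, x$2, x$3 * sqrt (1 - 0\<^sup>2), 0 * sqrt (1 - 2 * (x$2)\<^sup>2)] = x"
    using x by (simp add: vec4_eq_iff)
  ultimately have lim: "(\<gamma> \<longlongrightarrow> x) (at_right 0)" by simp
  have "\<gamma> e \<in> Surf a b" if e: "0 < e" "e < 1" for e
  proof -
    have e2: "e\<^sup>2 \<le> 1" using e by (simp add: power_le_one)
    have s2: "(a * b * e)\<^sup>2 = e\<^sup>2" unfolding power_mult_distrib[of "a * b"] ab2 by simp
    have "\<gamma> e \<in> Sphere3 \<and> gap (\<gamma> e) = 0"
      using gap_zero_slope_form[of "\<gamma> e" "a * b * e"] ne e e2 n x(4)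
      by (simp add: \<gamma>_def s2 power_mult_distrib[of "x$3"] power_mult_distrib[of e])
    moreover have "a * \<gamma> e $ 1 = (a * a) * e * (b * x$2)" by (simp add: \<gamma>_def)
    then have "a * \<gamma> e $ 1 > 0" using sign_square[OF a] e x(5) by simp
    ultimately show ?thesis using x(5) by (simp add: Surf_def \<gamma>_def)
  qed
  then show ?thesis using closure_limitI[OF lim] by blast
qed

text \<open>
  Let \<open>x$2\<close> tend to \<open>0\<close> with slope of absolute value \<open>\<bar>x$4\<bar>\<close>. This needs \<open>x$4 \<noteq> 0\<close>; the two remaining
  points are limits of such points.
\<close>

lemma Surf_limit_on_Half_circles:
  assumes a: "\<bar>a\<bar> = 1" and b: "\<bar>b\<bar> = 1" and x: "x \<in> Sphere3" "x$1 = 0" "x$2 = 0"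
  shows "x \<in> closure (Surf a b)"
proof -
  have n: "(x$3)\<^sup>2 = 1 - (x$4)\<^sup>2" using x by (simp add: norm_4_eq_1)
  have ab2: "(a * b)\<^sup>2 = 1" unfolding power_mult_distrib power2_eq_square[of a] power2_eq_square[of b] sign_square[OF a] sign_square[OF b] by simp
  have b2: "(b * e)\<^sup>2 = e\<^sup>2" for e using sign_square[OF b] by (simp add: power_mult_distrib power2_eq_square[of b])
  \<comment> \<open>the slope needs absolute value \<open>\<bar>x$4\<bar>\<close> and must not vanish\<close>
  have off: "x \<in> closure (Surf a b)" if x: "x \<in> Sphere3" "x$1 = 0" "x$2 = 0" and x4: "x$4 \<noteq> 0" for x
  proof -
    have n: "(x$3)\<^sup>2 = 1 - (x$4)\<^sup>2" using x by (simp add: norm_4_eq_1)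
    define s where "s = a * b * \<bar>x$4\<bar>"
    have s2: "s\<^sup>2 = (x$4)\<^sup>2" unfolding s_def power_mult_distrib[of "a * b"] ab2 by simp
    have s0: "s \<noteq> 0" using x4 s2 by auto
    define \<gamma> :: "real \<Rightarrow> real^4" where "\<gamma> e = vector
      [s * (b * (e / 2)), b * (e / 2), x$3 * sqrt (1 - (e / 2)\<^sup>2), x$4 * sqrt (1 - 2 * (e / 2)\<^sup>2)]" for e
    have "(\<gamma> \<longlongrightarrow> vector [s * (b * (0 / 2)), b * (0 / 2), x$3 * sqrt (1 - (0 / 2)\<^sup>2), x$4 * sqrt (1 - 2 * (0 / 2)\<^sup>2)]) (at_right 0)"
      unfolding \<gamma>_def by (intro tendsto_vector_4 tendsto_intros) auto
    moreover have "vector [s * (b * (0 / 2)), b * (0 / 2), x$3 * sqrt (1 - (0 / 2)\<^sup>2), x$4 * sqrt (1 - 2 * (0 / 2)\<^sup>2)] = x"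
      using x by (simp add: vec4_eq_iff)
    ultimately have lim: "(\<gamma> \<longlongrightarrow> x) (at_right 0)" by simp
    have "\<gamma> e \<in> Surf a b" if e: "0 < e" "e < 1" for e
    proof -
      define z where "z = e / 2"
      have z: "z > 0" "2 * z\<^sup>2 < 1"
      proof -
        have "e\<^sup>2 < 1" using e by (simp add: power_less_one_iff)
        then show "2 * z\<^sup>2 < 1" by (simp add: z_def power_divide)
      qed (use e in \<open>simp add: z_def\<close>)
      have z1: "z\<^sup>2 \<le> 1" using z(2) zero_le_power2[of z] by linarith
      have g: "\<gamma> e $ 1 = s * (b * z)" "\<gamma> e $ 2 = b * z" "\<gamma> e $ 3 = x$3 * sqrt (1 - z\<^sup>2)"
        "\<gamma> e $ 4 = x$4 * sqrt (1 - 2 * z\<^sup>2)" by (simp_all add: \<gamma>_def z_def)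
      have g1: "\<gamma> e $ 1 = s * \<gamma> e $ 2" unfolding g ..
      have bz: "b * (b * z) = z" using sign_square[OF b] by (simp flip: mult.assoc)
      have g2: "\<gamma> e $ 2 \<noteq> 0" unfolding g using z bz by auto
      have "(\<gamma> e $ 3)\<^sup>2 = (1 - s\<^sup>2) * (1 - (\<gamma> e $ 2)\<^sup>2)" "(\<gamma> e $ 4)\<^sup>2 = s\<^sup>2 * (1 - 2 * (\<gamma> e $ 2)\<^sup>2)"
        unfolding g power_mult_distrib[of "x$3"] power_mult_distrib[of "x$4"] b2 s2 n using z z1 by simp_all
      then have "\<gamma> e \<in> Sphere3 \<and> gap (\<gamma> e) = 0" using gap_zero_slope_form[OF g1 s0 g2] by blast
      moreover have "a * \<gamma> e $ 1 = (a * a) * (b * b) * (\<bar>x$4\<bar> * z)" by (simp add: g s_def)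
      then have "a * \<gamma> e $ 1 > 0" using sign_square[OF a] sign_square[OF b] z x4 by simp
      moreover have "b * \<gamma> e $ 2 > 0" unfolding g bz by (rule z(1))
      ultimately show ?thesis by (simp add: Surf_def)
    qed
    then show ?thesis using closure_limitI[OF lim] by blast
  qed
  show ?thesis
  proof (cases "x$4 = 0")
    case True
    define \<delta> :: "real \<Rightarrow> real^4" where "\<delta> e = vector [0, 0, x$3 * sqrt (1 - e\<^sup>2), e]" for e
    have "(\<delta> \<longlongrightarrow> vector [0, 0, x$3 * sqrt (1 - 0\<^sup>2), 0]) (at_right 0)"
      unfolding \<delta>_def by (intro tendsto_vector_4 tendsto_intros)
    moreover have "vector [0, 0, x$3 * sqrt (1 - 0\<^sup>2), 0] = x" using x True by (simp add: vec4_eq_iff)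
    ultimately have lim: "(\<delta> \<longlongrightarrow> x) (at_right 0)" by simp
    have "\<delta> e \<in> closure (Surf a b)" if e: "0 < e" "e < 1" for e
    proof (rule off)
      have "e\<^sup>2 \<le> 1" using e by (simp add: power_le_one)
      then show "\<delta> e \<in> Sphere3" using n True by (simp add: \<delta>_def norm_4_eq_1 power_mult_distrib)
    qed (use e in \<open>auto simp: \<delta>_def\<close>)
    then show ?thesis using closure_limitI[OF lim] by (metis closure_closure)
  next
    case False
    then show ?thesis using off x by blast
  qed
qed

lemma closure_Surf_eq:
  assumes a: "\<bar>a\<bar> = 1" and b: "\<bar>b\<bar> = 1"
  shows "closure (Surf a b) = {x \<in> Sphere3. gap x = 0 \<and> a * x$1 \<ge> 0 \<and> b * x$2 \<ge> 0}" (is "_ = ?R")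
proof
  have "closed ?R"
    by (intro closed_Collect_sphere closed_Collect_conj closed_gap closed_Collect_le continuous_intros)
  moreover have "Surf a b \<subseteq> ?R" by (auto simp: Surf_def)
  ultimately show "closure (Surf a b) \<subseteq> ?R" by (simp add: closure_minimal)
  show "?R \<subseteq> closure (Surf a b)"
  proof
    fix x assume x: "x \<in> ?R"
    have ab: "a \<noteq> 0" "b \<noteq> 0" using a b by auto
    consider "x$1 \<noteq> 0" | "x$1 = 0" "x$2 = 0" | "x$1 = 0" "x$2 \<noteq> 0" by blast
    then show "x \<in> closure (Surf a b)"
    proof cases
      case 1
      then have "x$2 \<noteq> 0" using gap_zero_imp x by auto
      then have "x \<in> Surf a b" using 1 x ab by (simp add: Surf_def less_le)
      then show ?thesis using closure_subset by blast
    next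
      case 2
      then show ?thesis using Surf_limit_on_Half_circles[OF a b] x by auto
    next
      case 3
      then have "x$4 = 0" "(x$2)\<^sup>2 \<le> (x$3)\<^sup>2" using gap_zero_on_equator[of x] x by auto
      moreover have "b * x$2 > 0" using 3 x ab by (auto simp: less_le)
      ultimately show ?thesis using Surf_limit_on_Double_arc[OF a b] 3 x by auto
    qed
  qed
qed

lemma normalise_in_sphere: "x \<noteq> 0 \<Longrightarrow> inverse (norm x) *\<^sub>R x \<in> sphere 0 (1::real)"
  for x :: "'a::real_normed_vector"
  by simp

lemma gap_normalise:
  assumes "x \<noteq> 0"
  shows "gap (inverse (norm x) *\<^sub>R x) > 0 \<longleftrightarrow> gap x > 0" "gap (inverse (norm x) *\<^sub>R x) < 0 \<longleftrightarrow> gap x < 0"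
    "gap (inverse (norm x) *\<^sub>R x) = 0 \<longleftrightarrow> gap x = 0"
proof -
  have "(inverse (norm x))\<^sup>2 > 0" using assms by simp
  then show "gap (inverse (norm x) *\<^sub>R x) > 0 \<longleftrightarrow> gap x > 0" "gap (inverse (norm x) *\<^sub>R x) < 0 \<longleftrightarrow> gap x < 0"
    "gap (inverse (norm x) *\<^sub>R x) = 0 \<longleftrightarrow> gap x = 0"
    unfolding gap_scale by (simp_all add: zero_less_mult_iff mult_less_0_iff)
qed

definition with_first :: "real^4 \<Rightarrow> real \<Rightarrow> real^4" where
  "with_first x t = vector [t, x$2, x$3, x$4]"

lemma with_first_nth [simp]: "with_first x t $ 1 = t" "with_first x t $ 2 = x$2" "with_first x t $ 3 = x$3" "with_first x t $ 4 = x$4"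
  by (simp_all add: with_first_def)

lemma gap_with_first: "gap (with_first x t) = t\<^sup>2 - rho2 x"
  by (simp add: gap_def rho2_def disc_def)

lemma with_first_normalised_tendsto:
  assumes "x \<in> Sphere3"
  shows "((\<lambda>e. let z = with_first x (x$1 * (1 + c * e)) in inverse (norm z) *\<^sub>R z) \<longlongrightarrow> x) (at_right 0)"
proof -
  let ?z = "\<lambda>e. with_first x (x$1 * (1 + c * e))"
  have "(?z \<longlongrightarrow> vector [x$1 * (1 + c * 0), x$2, x$3, x$4]) (at_right 0)"
    unfolding with_first_def by (intro tendsto_vector_4 tendsto_intros)
  then have z: "(?z \<longlongrightarrow> x) (at_right 0)" by (simp add: vector_4_eta)
  have "norm x = 1" using assms by simp
  then have "((\<lambda>e. inverse (norm (?z e)) *\<^sub>R ?z e) \<longlongrightarrow> inverse (norm x) *\<^sub>R x) (at_right 0)"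
    by (intro tendsto_intros z) auto
  then show ?thesis using \<open>norm x = 1\<close> by (simp add: Let_def)
qed

text \<open>
  Stretching \<open>x$1\<close> raises \<open>gap\<close> and shrinking it lowers \<open>gap\<close>, since \<open>rho2\<close> is independent of \<open>x$1\<close>.
  Normalising to the unit sphere preserves all signs.
\<close>

lemma Surf_limit_of_cells:
  assumes x: "x \<in> Surf a b"
  shows "x \<in> closure (Definite_cell a)" "x \<in> closure (Mixed_cell b)"
proof -
  have S: "x \<in> Sphere3" and x1: "x$1 \<noteq> 0" "a * x$1 > 0" "b * x$2 > 0" and g: "(x$1)\<^sup>2 = rho2 x"
    using x by (auto simp: Surf_def gap_def)
  have main: "(let z = with_first x (x$1 * (1 + c * e)) in inverse (norm z) *\<^sub>R z) \<in>
      (if c = 1 then Definite_cell a else Mixed_cell b)" if "0 < e" "e < 1" "c = 1 \<or> c = -1" for e c :: real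
  proof -
    let ?z = "with_first x (x$1 * (1 + c * e))"
    have pos: "1 + c * e > 0" using that by auto
    have z0: "?z \<noteq> 0" using x1(1) pos by (auto simp: vec4_eq_iff)
    have inv: "inverse (norm ?z) > 0" using z0 by simp
    have "gap ?z = (x$1)\<^sup>2 * ((1 + c * e)\<^sup>2 - 1)" by (simp add: gap_with_first g[symmetric] power_mult_distrib right_diff_distrib)
    also have "(1 + c * e)\<^sup>2 - 1 = c * e * (2 + c * e)" by (simp add: power2_eq_square algebra_simps)
    finally have gz: "gap ?z = (x$1)\<^sup>2 * (c * e * (2 + c * e))" .
    have sp: "(x$1)\<^sup>2 > 0" using x1(1) by simp
    have "inverse (norm ?z) *\<^sub>R ?z \<in> (if c = 1 then Definite_cell a else Mixed_cell b)"
    proof (cases "c = 1")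
      case True
      have "gap ?z > 0" unfolding gz using that sp True by simp
      moreover have eq: "a * (inverse (norm ?z) *\<^sub>R ?z) $ 1 = inverse (norm ?z) * (1 + c * e) * (a * x$1)" by simp
      have "a * (inverse (norm ?z) *\<^sub>R ?z) $ 1 > 0" unfolding eq by (intro mult_pos_pos inv pos x1)
      ultimately show ?thesis
        using True gap_normalise(1)[OF z0] normalise_in_sphere[OF z0] by (simp add: Definite_cell_def)
    next
      case False
      then have "c = -1" using that by simp
      then have "gap ?z < 0" unfolding gz using that sp by (simp add: mult_less_0_iff)
      moreover have eq: "b * (inverse (norm ?z) *\<^sub>R ?z) $ 2 = inverse (norm ?z) * (b * x$2)" by simp
      have "b * (inverse (norm ?z) *\<^sub>R ?z) $ 2 > 0" unfolding eq by (intro mult_pos_pos inv x1)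
      ultimately show ?thesis
        using False gap_normalise(2)[OF z0] normalise_in_sphere[OF z0] by (simp add: Mixed_cell_def)
    qed
    then show ?thesis by (simp add: Let_def)
  qed
  show "x \<in> closure (Definite_cell a)"
    by (rule closure_limitI[OF with_first_normalised_tendsto[OF S, of 1]]) (use main[of _ 1] in simp)
  show "x \<in> closure (Mixed_cell b)"
    by (rule closure_limitI[OF with_first_normalised_tendsto[OF S, of "-1"]]) (use main[of _ "-1"] in simp)
qed

lemma closure_Definite_cell_eq:
  assumes a: "\<bar>a\<bar> = 1"
  shows "closure (Definite_cell a) = {x \<in> Sphere3. gap x \<ge> 0 \<and> a * x$1 \<ge> 0}" (is "_ = ?R")
proof
  have "closed ?R"
    by (intro closed_Collect_sphere closed_Collect_conj closed_gap closed_Collect_le continuous_intros)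
  moreover have "Definite_cell a \<subseteq> ?R" by (auto simp: Definite_cell_def)
  ultimately show "closure (Definite_cell a) \<subseteq> ?R" by (simp add: closure_minimal)
  show "?R \<subseteq> closure (Definite_cell a)"
  proof
    fix x assume x: "x \<in> ?R"
    show "x \<in> closure (Definite_cell a)"
    proof (cases "gap x = 0")
      case True
      define b :: real where "b = (if x$2 \<ge> 0 then 1 else -1)"
      have b: "\<bar>b\<bar> = 1" by (simp add: b_def)
      have "x \<in> closure (Surf a b)" unfolding closure_Surf_eq[OF a b] using x True by (simp add: b_def)
      moreover have "Surf a b \<subseteq> closure (Definite_cell a)" using Surf_limit_of_cells(1) by blast
      then have "closure (Surf a b) \<subseteq> closure (Definite_cell a)" by (intro closure_minimal closed_closure)
      ultimately show ?thesis by blast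
    next
      case False
      then have "gap x > 0" using x by auto
      moreover have "a * x$1 > 0" 
      proof -
        have "a * x$1 \<noteq> 0" "0 \<le> a * x$1" using gap_pos_imp[OF \<open>gap x > 0\<close>] x a by auto
        then show ?thesis by linarith
      qed
      ultimately have "x \<in> Definite_cell a" using x by (simp add: Definite_cell_def)
      then show ?thesis using closure_subset by blast
    qed
  qed
qed

lemma closure_Mixed_cell_eq:
  assumes b: "\<bar>b\<bar> = 1"
  shows "closure (Mixed_cell b) = {x \<in> Sphere3. gap x \<le> 0 \<and> b * x$2 \<ge> 0}" (is "_ = ?R")
proof
  have "closed ?R"
    by (intro closed_Collect_sphere closed_Collect_conj closed_gap closed_Collect_le continuous_intros)
  moreover have "Mixed_cell b \<subseteq> ?R" by (auto simp: Mixed_cell_def)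
  ultimately show "closure (Mixed_cell b) \<subseteq> ?R" by (simp add: closure_minimal)
  show "?R \<subseteq> closure (Mixed_cell b)"
  proof
    fix x assume x: "x \<in> ?R"
    show "x \<in> closure (Mixed_cell b)"
    proof (cases "gap x = 0")
      case True
      define a :: real where "a = (if x$1 \<ge> 0 then 1 else -1)"
      have a: "\<bar>a\<bar> = 1" by (simp add: a_def)
      have "x \<in> closure (Surf a b)" unfolding closure_Surf_eq[OF a b] using x True by (simp add: a_def)
      moreover have "Surf a b \<subseteq> closure (Mixed_cell b)" using Surf_limit_of_cells(2) by blast
      then have "closure (Surf a b) \<subseteq> closure (Mixed_cell b)" by (intro closure_minimal closed_closure)
      ultimately show ?thesis by blast
    next
      case False
      then have "gap x < 0" using x by auto
      moreover have "b * x$2 > 0" 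
      proof -
        have "b * x$2 \<noteq> 0" "0 \<le> b * x$2" using gap_neg_imp[OF \<open>gap x < 0\<close>] x b by auto
        then show ?thesis by linarith
      qed
      ultimately have "x \<in> Mixed_cell b" using x by (simp add: Mixed_cell_def)
      then show ?thesis using closure_subset by blast
    qed
  qed
qed

text \<open>
  Interpolating \<open>b * x$2\<close> towards \<open>1/4\<close>, a value strictly between \<open>0\<close> and \<open>sqrt 2 / 2\<close>, moves both end points
  of the arc into it.
\<close>

lemma closure_Double_arc_eq:
  assumes b: "\<bar>b\<bar> = 1" and c: "\<bar>c\<bar> = 1"
  shows "closure (Double_arc b c) =
    {x \<in> Sphere3. x$1 = 0 \<and> x$4 = 0 \<and> 0 \<le> b * x$2 \<and> b * x$2 \<le> sqrt 2 / 2 \<and> 0 \<le> c * x$3}" (is "_ = ?R")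
proof
  have "closed ?R"
    by (intro closed_Collect_sphere closed_Collect_conj closed_Collect_eq closed_Collect_le continuous_intros)
  moreover have "Double_arc b c \<subseteq> ?R" by (auto simp: Double_arc_def)
  ultimately show "closure (Double_arc b c) \<subseteq> ?R" by (simp add: closure_minimal)
  show "?R \<subseteq> closure (Double_arc b c)"
  proof
    fix x assume x: "x \<in> ?R"
    have bb: "b * b = 1" "c * c = 1" using sign_square b c by auto
    define z where "z e = (1 - e) * (b * x$2) + e * (1/4)" for e
    define \<gamma> :: "real \<Rightarrow> real^4" where "\<gamma> e = vector [0, b * z e, c * sqrt (1 - (z e)\<^sup>2), 0]" for e
    have x3: "c * x$3 = sqrt (1 - (b * x$2)\<^sup>2)"
    proof (rule real_sqrt_unique[symmetric])
      have "(x$2)\<^sup>2 + (x$3)\<^sup>2 = 1" using x by (auto simp: norm_4_eq_1)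
      then show "(c * x$3)\<^sup>2 = 1 - (b * x$2)\<^sup>2"
        unfolding power_mult_distrib power2_eq_square[of b] power2_eq_square[of c] bb by simp
    qed (use x in auto)
    have "(z \<longlongrightarrow> (1 - 0) * (b * x$2) + 0 * (1/4)) (at_right 0)"
      unfolding z_def by (intro tendsto_intros)
    then have "(z \<longlongrightarrow> b * x$2) (at_right 0)" by simp
    then have "(\<gamma> \<longlongrightarrow> vector [0, b * (b * x$2), c * sqrt (1 - (b * x$2)\<^sup>2), 0]) (at_right 0)"
      unfolding \<gamma>_def by (intro tendsto_vector_4 tendsto_intros)
    moreover have "vector [0, b * (b * x$2), c * sqrt (1 - (b * x$2)\<^sup>2), 0] = x"
      unfolding x3[symmetric] using x bb by (simp add: vec4_eq_iff flip: mult.assoc)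
    ultimately have lim: "(\<gamma> \<longlongrightarrow> x) (at_right 0)" by simp
    have "\<gamma> e \<in> Double_arc b c" if e: "0 < e" "e < 1" for e
    proof -
      have q: "1/4 < sqrt 2 / 2" by (rule power_less_imp_less_base[of _ 2]) (simp_all add: power_divide)
      have z0: "0 < z e" using e x by (auto simp: z_def intro!: add_nonneg_pos)
      have "(1 - e) * (b * x$2) \<le> (1 - e) * (sqrt 2 / 2)" using e x by (intro mult_left_mono) auto
      moreover have "e * (1/4) < e * (sqrt 2 / 2)" using e q by (intro mult_strict_left_mono)
      ultimately have "z e < (1 - e) * (sqrt 2 / 2) + e * (sqrt 2 / 2)" unfolding z_def by linarith
      then have z1: "z e < sqrt 2 / 2" unfolding distrib_right[symmetric] by simp
      have z2: "(z e)\<^sup>2 < 1"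
        using power_strict_mono[OF z1, of 2] z0 half_sqrt2(1) by simp
      have g: "\<gamma> e $ 1 = 0" "\<gamma> e $ 2 = b * z e" "\<gamma> e $ 3 = c * sqrt (1 - (z e)\<^sup>2)" "\<gamma> e $ 4 = 0"
        by (simp_all add: \<gamma>_def)
      have "(\<gamma> e $ 2)\<^sup>2 = (z e)\<^sup>2" "(\<gamma> e $ 3)\<^sup>2 = 1 - (z e)\<^sup>2"
        unfolding g power_mult_distrib power2_eq_square[of b] power2_eq_square[of c] bb using z2 by simp_all
      moreover have "b * \<gamma> e $ 2 = z e" "c * \<gamma> e $ 3 = sqrt (1 - (z e)\<^sup>2)"
        unfolding g mult.assoc[symmetric] bb by simp_all
      ultimately show ?thesis using z0 z1 z2 g(1,4) by (simp add: Double_arc_def norm_4_eq_1)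
    qed
    then show "x \<in> closure (Double_arc b c)" using closure_limitI[OF lim] by blast
  qed
qed

lemma closure_Half_circle_eq:
  assumes d: "\<bar>d\<bar> = 1"
  shows "closure (Half_circle d) = {x \<in> Sphere3. x$1 = 0 \<and> x$2 = 0 \<and> 0 \<le> d * x$4}" (is "_ = ?R")
proof
  have "closed ?R"
    by (intro closed_Collect_sphere closed_Collect_conj closed_Collect_eq closed_Collect_le continuous_intros)
  moreover have "Half_circle d \<subseteq> ?R" by (auto simp: Half_circle_def)
  ultimately show "closure (Half_circle d) \<subseteq> ?R" by (simp add: closure_minimal)
  show "?R \<subseteq> closure (Half_circle d)"
  proof
    fix x assume x: "x \<in> ?R"
    show "x \<in> closure (Half_circle d)"
    proof (cases "x$4 = 0")
      case False
      then have "x \<in> Half_circle d" using x d by (auto simp: Half_circle_def less_le)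
      then show ?thesis using closure_subset by blast
    next
      case True
      have dd: "d * d = 1" using sign_square[OF d] .
      define \<gamma> :: "real \<Rightarrow> real^4" where "\<gamma> e = vector [0, 0, x$3 * sqrt (1 - e\<^sup>2), d * e]" for e
      have "(\<gamma> \<longlongrightarrow> vector [0, 0, x$3 * sqrt (1 - 0\<^sup>2), d * 0]) (at_right 0)"
        unfolding \<gamma>_def by (intro tendsto_vector_4 tendsto_intros)
      moreover have "vector [0, 0, x$3 * sqrt (1 - 0\<^sup>2), d * 0] = x" using x True by (simp add: vec4_eq_iff)
      ultimately have lim: "(\<gamma> \<longlongrightarrow> x) (at_right 0)" by simp
      have "\<gamma> e \<in> Half_circle d" if e: "0 < e" "e < 1" for e
      proof -
        have "e\<^sup>2 \<le> 1" using e by (simp add: power_le_one)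
        moreover have "(x$3)\<^sup>2 = 1" using x True by (auto simp: norm_4_eq_1)
        moreover have "d * (d * e) > 0" "d\<^sup>2 = 1"
          using dd e by (simp_all add: power2_eq_square flip: mult.assoc)
        ultimately show ?thesis using e by (simp add: Half_circle_def norm_4_eq_1 \<gamma>_def power_mult_distrib)
      qed
      then show ?thesis using closure_limitI[OF lim] by blast
    qed
  qed
qed

section \<open>The enclosed regions\<close>

text \<open>
  A component of the complement is connected, so it lies in \<open>I\<close> or in \<open>Q\<close>. Those in \<open>I\<close> avoid the
  remaining surfaces, and those in \<open>Q\<close> meet them.
\<close>

lemma enclosed_eqI:
  assumes split: "Sphere3 - (closure A \<union> closure B) = I \<union> Q" and disj: "I \<inter> Q = {}"
    and opI: "openin (top_of_set Sphere3) I" and opQ: "openin (top_of_set Sphere3) Q"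
    and I: "I \<inter> (r1 \<union> r2) = {}"
    and Q: "\<And>x. x \<in> Q \<Longrightarrow> \<exists>y \<in> r1 \<union> r2. connected_component Q x y"
  shows "enclosed A B r1 r2 = I"
proof -
  let ?X = "Sphere3 - (closure A \<union> closure B)"
  have inI: "C \<subseteq> I" if C: "C \<in> components ?X" and "x \<in> C" "x \<in> I" for C x
  proof -
    have con: "connected C" and sub: "C \<subseteq> I \<union> Q" using C split by (auto simp: in_components_connected dest: in_components_subset)
    obtain U V where UV: "open U" "I = Sphere3 \<inter> U" "open V" "Q = Sphere3 \<inter> V"
      using opI opQ by (auto simp: openin_open)
    have "C \<subseteq> Sphere3" using C in_components_subset by blast
    then have "U \<inter> V \<inter> C = {}" using disj UV by auto
    moreover have "C \<subseteq> U \<union> V" using sub UV by auto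
    moreover have "U \<inter> C \<noteq> {}" using that UV by auto
    ultimately have "V \<inter> C = {}" using con UV unfolding connected_def by blast
    then show ?thesis using sub UV by auto
  qed
  show ?thesis
  proof
    show "enclosed A B r1 r2 \<subseteq> I"
    proof
      fix x assume "x \<in> enclosed A B r1 r2"
      then obtain C where C: "C \<in> components ?X" "C \<inter> (r1 \<union> r2) = {}" "x \<in> C"
        unfolding enclosed_def by blast
      show "x \<in> I"
      proof (rule ccontr)
        assume "x \<notin> I"
        then have "x \<in> Q" using C split in_components_subset by blast
        then obtain y where y: "y \<in> r1 \<union> r2" "connected_component Q x y" using Q by blast
        have "connected_component ?X x y"
          using connected_component_mono[of Q ?X] y(2) split by blast
        moreover obtain z where z: "C = connected_component_set ?X z"
          using C(1) by (auto simp: components_def)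
        ultimately have "connected_component ?X z y"
          using C(3) by (metis connected_component_trans mem_Collect_eq)
        then have "y \<in> C" unfolding z by simp
        then show False using y C by blast
      qed
    qed
    show "I \<subseteq> enclosed A B r1 r2"
    proof
      fix x assume x: "x \<in> I"
      have xX: "x \<in> ?X" using x split by blast
      let ?C = "connected_component_set ?X x"
      have C: "?C \<in> components ?X" using xX by (auto simp: components_def)
      have "x \<in> ?C" using xX by (simp add: connected_component_refl_eq)
      moreover from this have "?C \<inter> (r1 \<union> r2) = {}" using inI[OF C _ x] I by blast
      ultimately show "x \<in> enclosed A B r1 r2" unfolding enclosed_def using C by blast
    qed
  qed
qed

lemma connected_component_normalised_segment:
  fixes p q :: "'a::real_normed_vector"
  assumes "\<And>z. z \<in> closed_segment p q \<Longrightarrow> z \<noteq> 0 \<and> inverse (norm z) *\<^sub>R z \<in> Q"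
  shows "connected_component Q (inverse (norm p) *\<^sub>R p) (inverse (norm q) *\<^sub>R q)"
proof -
  let ?f = "\<lambda>z::'a. inverse (norm z) *\<^sub>R z"
  have "connected (?f ` closed_segment p q)"
    using assms by (intro connected_continuous_image continuous_intros) auto
  moreover have "?f ` closed_segment p q \<subseteq> Q" using assms by auto
  ultimately show ?thesis unfolding connected_component_def by blast
qed

lemma sign_scale:
  fixes z :: "real^'n"
  assumes "k > 0"
  shows "a * (k *\<^sub>R z) $ i > 0 \<longleftrightarrow> a * z $ i > 0" "a * (k *\<^sub>R z) $ i < 0 \<longleftrightarrow> a * z $ i < 0"
proof -
  have "a * (k *\<^sub>R z) $ i = k * (a * z $ i)" by simp
  then show "a * (k *\<^sub>R z) $ i > 0 \<longleftrightarrow> a * z $ i > 0" "a * (k *\<^sub>R z) $ i < 0 \<longleftrightarrow> a * z $ i < 0"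
    using assms by (metis zero_less_mult_pos mult_pos_pos, metis mult_less_cancel_left_pos mult_zero_right)
qed

lemma segment_nth: "z \<in> closed_segment p q \<Longrightarrow> \<exists>u. 0 \<le> u \<and> u \<le> 1 \<and> (\<forall>i. z $ i = (1 - u) * p $ i + u * q $ i)"
  for p q :: "real^'n"
  by (auto simp: closed_segment_def)

text \<open>
  The path follows a straight segment on which only the first coordinate varies, projected to the sphere.
\<close>

lemma connected_component_with_first:
  assumes x: "x \<in> Sphere3" and nz: "(x$2)\<^sup>2 + (x$3)\<^sup>2 + (x$4)\<^sup>2 \<noteq> 0"
    and Q: "\<And>s r. r > 0 \<Longrightarrow> (x$1 \<le> s \<and> s \<le> t \<or> t \<le> s \<and> s \<le> x$1) \<Longrightarrow> r *\<^sub>R with_first x s \<in> Sphere3 \<Longrightarrow> r *\<^sub>R with_first x s \<in> Q"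
  shows "connected_component Q x (inverse (norm (with_first x t)) *\<^sub>R with_first x t)"
proof -
  have nz1: "with_first x s \<noteq> 0" for s using nz by (auto simp: vec4_eq_iff)
  have "connected_component Q (inverse (norm x) *\<^sub>R x) (inverse (norm (with_first x t)) *\<^sub>R with_first x t)"
  proof (rule connected_component_normalised_segment)
    fix z assume "z \<in> closed_segment x (with_first x t)"
    then obtain u where u: "0 \<le> u" "u \<le> 1" "\<forall>i. z $ i = (1 - u) * x $ i + u * with_first x t $ i"
      using segment_nth by blast
    define s where "s = (1 - u) * x$1 + u * t"
    have z: "z = with_first x s" unfolding vec4_eq_iff using u(3)[rule_format, of 1] u(3)[rule_format, of 2] u(3)[rule_format, of 3] u(3)[rule_format, of 4]
      by (simp add: s_def algebra_simps)
    have "x$1 \<le> s \<and> s \<le> t \<or> t \<le> s \<and> s \<le> x$1"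
    proof (cases "x$1 \<le> t")
      case True
      then have "u * x$1 \<le> u * t" "(1 - u) * x$1 \<le> (1 - u) * t" using u by (auto intro: mult_left_mono)
      then show ?thesis by (simp add: s_def algebra_simps)
    next
      case False
      then have "u * t \<le> u * x$1" "(1 - u) * t \<le> (1 - u) * x$1" using u by (auto intro: mult_left_mono)
      then show ?thesis by (simp add: s_def algebra_simps)
    qed
    then show "z \<noteq> 0 \<and> inverse (norm z) *\<^sub>R z \<in> Q"
      unfolding z using Q[of "inverse (norm (with_first x s))" s] nz1[of s] by simp
  qed
  then show ?thesis using x by simp
qed

lemma gap_in_12_plane: "gap (vector [p, q, 0, 0]) = p\<^sup>2 - q\<^sup>2"
proof -
  have "disc (vector [p, q, 0, 0]) = of_real (q\<^sup>2)" by (simp add: disc_def complex_eq_iff)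
  then have "rho2 (vector [p, q, 0, 0]) = q\<^sup>2" by (simp add: rho2_def norm_power)
  then show ?thesis by (simp add: gap_def)
qed

text \<open>
  \<open>disc\<close> is homogeneous of degree 2 in the last three coordinates, so contracting them shrinks \<open>rho2\<close>.
\<close>

lemma gap_shrink:
  assumes "0 \<le> u" "u \<le> 1"
  shows "gap x \<le> gap (vector [x$1, u * x$2, u * x$3, u * x$4])"
proof -
  let ?y = "vector [x$1, u * x$2, u * x$3, u * x$4] :: real^4"
  have "disc ?y = of_real (u\<^sup>2) * disc x"
    by (simp add: disc_def complex_eq_iff algebra_simps power2_eq_square)
  then have "rho2 ?y = u\<^sup>2 * rho2 x" by (simp add: rho2_def norm_mult norm_power algebra_simps)
  also have "\<dots> \<le> rho2 x" using assms rho2_nonneg[of x] by (simp add: mult_left_le_one_le power_le_one)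
  finally show ?thesis by (simp add: gap_def)
qed

text \<open>
  Contracting the last three coordinates leads to \<open>(\<plusminus>1, 0, 0, 0)\<close> without lowering \<open>gap\<close>. From there the
  great circle in the plane of the first two coordinates leads to a surface, as \<open>gap\<close> is the difference
  of the squares of these coordinates there.
\<close>

lemma Definite_cell_reaches_Surf:
  assumes a: "\<bar>a\<bar> = 1" and b: "\<bar>b\<bar> = 1" and x: "x \<in> Definite_cell a"
    and Q: "Definite_cell a \<subseteq> Q" "Surf a b \<subseteq> Q"
  shows "\<exists>y\<in>Surf a b. connected_component Q x y"
proof -
  have x1: "a * x$1 > 0" "gap x > 0" "x \<in> Sphere3" using x by (auto simp: Definite_cell_def)
  let ?f = "\<lambda>z::real^4. inverse (norm z) *\<^sub>R z"
  let ?e = "vector [x$1, 0, 0, 0] :: real^4" and ?k = "vector [x$1, b * \<bar>x$1\<bar>, 0, 0] :: real^4"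
  have cell: "z \<noteq> 0 \<and> ?f z \<in> Definite_cell a" if "gap z > 0" "z$1 = x$1" for z
  proof -
    have z0: "z \<noteq> 0" using that x1 by auto
    have "a * ?f z $ 1 > 0" using sign_scale(1)[of "inverse (norm z)" a z 1] z0 that x1 by simp
    then show ?thesis using z0 gap_normalise(1)[OF z0] that normalise_in_sphere[OF z0]
      by (simp add: Definite_cell_def)
  qed
  have "connected_component Q (?f x) (?f ?e)"
  proof (rule connected_component_normalised_segment)
    fix z assume "z \<in> closed_segment x ?e"
    then obtain u where u: "0 \<le> u" "u \<le> 1" "\<forall>i. z $ i = (1 - u) * x $ i + u * ?e $ i"
      using segment_nth by blast
    have z: "z = vector [x$1, (1 - u) * x$2, (1 - u) * x$3, (1 - u) * x$4]"
      unfolding vec4_eq_iff using u(3)[rule_format, of 1] u(3)[rule_format, of 2] u(3)[rule_format, of 3] u(3)[rule_format, of 4]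
      by (simp add: algebra_simps)
    have "gap z > 0" unfolding z using gap_shrink[of "1 - u" x] u x1 by simp
    moreover have "z $ 1 = x $ 1" by (simp add: z)
    ultimately show "z \<noteq> 0 \<and> ?f z \<in> Q" using cell Q by blast
  qed
  moreover have kS: "?f ?k \<in> Surf a b"
  proof -
    have k0: "?k \<noteq> 0" using x1 by (auto simp: vec4_eq_iff)
    have bb: "b * b = 1" using sign_square[OF b] .
    have "gap ?k = 0"
    proof -
      have "(b * \<bar>x$1\<bar>)\<^sup>2 = (x$1)\<^sup>2" using bb by (simp add: power_mult_distrib power2_eq_square[of b])
      then show ?thesis by (simp add: gap_in_12_plane)
    qed
    moreover have "b * ?k $ 2 > 0" using x1 unfolding vector_4 mult.assoc[symmetric] bb by auto
    then have "a * ?f ?k $ 1 > 0" "b * ?f ?k $ 2 > 0"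
      using sign_scale(1)[of "inverse (norm ?k)" a ?k 1] sign_scale(1)[of "inverse (norm ?k)" b ?k 2] k0 x1
      by (simp_all del: vector_scaleR_component)
    ultimately show ?thesis using gap_normalise(3)[OF k0] normalise_in_sphere[OF k0] by (simp add: Surf_def)
  qed
  moreover have "connected_component Q (?f ?e) (?f ?k)"
  proof (rule connected_component_normalised_segment)
    fix z assume "z \<in> closed_segment ?e ?k"
    then obtain u where u: "0 \<le> u" "u \<le> 1" "\<forall>i. z $ i = (1 - u) * ?e $ i + u * ?k $ i"
      using segment_nth by blast
    have z: "z = vector [x$1, u * (b * \<bar>x$1\<bar>), 0, 0]"
      unfolding vec4_eq_iff using u(3)[rule_format, of 1] u(3)[rule_format, of 2] u(3)[rule_format, of 3] u(3)[rule_format, of 4]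
      by (simp add: algebra_simps)
    show "z \<noteq> 0 \<and> ?f z \<in> Q"
    proof (cases "u = 1")
      case True
      then have zk: "z = ?k" by (simp add: z)
      have "?k \<noteq> 0" using x1 by (auto simp: vec4_eq_iff)
      then show ?thesis unfolding zk using kS Q by blast
    next
      case False
      have bb: "b * b = 1" using sign_square[OF b] .
      have "gap z = (x$1)\<^sup>2 - (u * (b * \<bar>x$1\<bar>))\<^sup>2" by (simp add: z gap_in_12_plane)
      also have "(u * (b * \<bar>x$1\<bar>))\<^sup>2 = u\<^sup>2 * (x$1)\<^sup>2"
        using bb by (simp add: power_mult_distrib power2_eq_square[of b])
      also have "(x$1)\<^sup>2 - u\<^sup>2 * (x$1)\<^sup>2 = (1 - u\<^sup>2) * (x$1)\<^sup>2" by (simp add: algebra_simps)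
      finally have gz: "gap z = (1 - u\<^sup>2) * (x$1)\<^sup>2" .
      have "u\<^sup>2 < 1" using False u by (simp add: power_less_one_iff)
      moreover have "x$1 \<noteq> 0" using x1 by auto
      ultimately have "gap z > 0" unfolding gz by simp
      moreover have "z $ 1 = x $ 1" by (simp add: z)
      ultimately show ?thesis using cell Q by blast
    qed
  qed
  ultimately have "connected_component Q (?f x) (?f ?k)" by (meson connected_component_trans)
  then show ?thesis using kS x1 by (intro bexI[of _ "?f ?k"]) auto
qed

text \<open>
  Here \<open>\<bar>x$1\<bar> < \<rho>\<close>; moving \<open>x$1\<close> to \<open>a * \<rho>\<close> keeps \<open>gap\<close> negative until it vanishes at the end, and the sign
  of \<open>x$2\<close> does not change.
\<close>

lemma Mixed_cell_reaches_Surf: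
  assumes a: "\<bar>a\<bar> = 1" and b: "\<bar>b\<bar> = 1" and x: "x \<in> Mixed_cell b"
    and Q: "Mixed_cell b \<subseteq> Q" "Surf a b \<subseteq> Q"
  shows "\<exists>y\<in>Surf a b. connected_component Q x y"
proof -
  have x1: "b * x$2 > 0" "(x$1)\<^sup>2 < rho2 x" "x \<in> Sphere3" using x by (auto simp: Mixed_cell_def gap_def)
  define r where "r = sqrt (rho2 x)"
  have r2: "r\<^sup>2 = rho2 x" by (simp add: r_def rho2_nonneg)
  have r: "\<bar>x$1\<bar> < r" using x1(2) r2 by (metis abs_ge_zero power2_abs power2_less_imp_less r_def real_sqrt_ge_zero rho2_nonneg)
  let ?y = "inverse (norm (with_first x (a * r))) *\<^sub>R with_first x (a * r)"
  have aa: "a * a = 1" using sign_square[OF a] .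
  have mem: "k *\<^sub>R with_first x s \<in> (if \<bar>s\<bar> = r then Surf a b else Mixed_cell b)"
    if k: "k > 0" and s: "\<bar>s\<bar> \<le> r" "\<bar>s\<bar> = r \<longrightarrow> s = a * r" and sph: "k *\<^sub>R with_first x s \<in> Sphere3" for k s
  proof -
    have b3: "b * (k *\<^sub>R with_first x s) $ 2 > 0" unfolding sign_scale(1)[OF k] using x1 by simp
    have g: "gap (k *\<^sub>R with_first x s) = k\<^sup>2 * (s\<^sup>2 - r\<^sup>2)" by (simp add: gap_scale gap_with_first r2)
    show ?thesis
    proof (cases "\<bar>s\<bar> = r")
      case True
      then have "s\<^sup>2 = r\<^sup>2" by (metis power2_abs)
      moreover have "a * with_first x s $ 1 = r" using s True aa by (simp flip: mult.assoc)
      then have "a * (k *\<^sub>R with_first x s) $ 1 > 0" unfolding sign_scale(1)[OF k] using r by simp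
      ultimately show ?thesis using True g b3 sph by (simp add: Surf_def)
    next
      case False
      then have "s\<^sup>2 < r\<^sup>2" using s by (metis abs_ge_zero less_le power2_abs power_strict_mono zero_less_numeral)
      then have "gap (k *\<^sub>R with_first x s) < 0" unfolding g using k by (simp add: mult_less_0_iff)
      then show ?thesis using False b3 sph by (simp add: Mixed_cell_def)
    qed
  qed
  have "connected_component Q x ?y"
  proof (rule connected_component_with_first[OF x1(3)])
    have "(x$2)\<^sup>2 > 0" using x1(1) by auto
    then have "(x$2)\<^sup>2 + (x$3)\<^sup>2 + (x$4)\<^sup>2 > 0" by (metis add_pos_nonneg zero_le_power2)
    then show "(x$2)\<^sup>2 + (x$3)\<^sup>2 + (x$4)\<^sup>2 \<noteq> 0" by simp
    fix s k :: real
    assume k: "k > 0" and s: "x$1 \<le> s \<and> s \<le> a * r \<or> a * r \<le> s \<and> s \<le> x$1" and sph: "k *\<^sub>R with_first x s \<in> Sphere3"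
    have "a = 1 \<or> a = -1" using a by (auto simp: abs_if split: if_splits)
    then have "\<bar>s\<bar> \<le> r" "\<bar>s\<bar> = r \<longrightarrow> s = a * r" using s r by auto
    from mem[OF k this sph] show "k *\<^sub>R with_first x s \<in> Q" using Q by (auto split: if_splits)
  qed
  moreover have "?y \<in> Surf a b"
  proof -
    have z0: "with_first x (a * r) \<noteq> 0" using x1(1) by (auto simp: vec4_eq_iff)
    have "\<bar>a * r\<bar> = r" using a r by (simp add: abs_mult)
    then show ?thesis using mem[of "inverse (norm (with_first x (a * r)))" "a * r"] z0 by simp
  qed
  ultimately show ?thesis by blast
qed

lemma openin_sphere_Collect:
  assumes "open {x. P x}" "\<And>x. x \<in> Sphere3 \<Longrightarrow> x \<in> A \<longleftrightarrow> P x" "A \<subseteq> Sphere3"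
  shows "openin (top_of_set Sphere3) A"
proof -
  have "A = Sphere3 \<inter> {x. P x}" using assms(2,3) by auto
  then show ?thesis using assms(1) by (simp add: openin_open_Int)
qed

lemma open_gap: "open {x. gap x < c}" "open {x. gap x > c}"
  by (intro open_Collect_less continuous_on_gap continuous_intros)+

text \<open>
  Outside the closed surfaces and the cell itself, \<open>gap < 0\<close> or \<open>x$1\<close> has the sign \<open>- a\<close>. Points of the mixed
  cells reach a surface with that sign of \<open>x$1\<close> by moving \<open>x$1\<close>, those of the opposite definite cell by
  contraction.
\<close>

lemma enclosed_Definite_cell:
  assumes a: "\<bar>a\<bar> = 1" and b: "\<bar>b\<bar> = 1"
  shows "enclosed (Surf a b) (Surf a (-b)) (Surf (-a) b) (Surf (-a) (-b)) = Definite_cell a"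
    "enclosed (Surf a b) (Surf a (-b)) (Surf (-a) (-b)) (Surf (-a) b) = Definite_cell a"
proof -
  let ?Q = "{x \<in> Sphere3. gap x < 0 \<or> a * x$1 < 0}"
  have na: "\<bar>-a\<bar> = 1" and nb: "\<bar>-b\<bar> = 1" using a b by auto
  have reach: "\<exists>y \<in> Surf (-a) b \<union> Surf (-a) (-b). connected_component ?Q x y" if x: "x \<in> ?Q" for x
  proof -
    have SQ: "Surf (-a) c \<subseteq> ?Q" for c by (auto simp: Surf_def)
    consider "gap x < 0" "b * x$2 > 0" | "gap x < 0" "(-b) * x$2 > 0" | "gap x = 0" "a * x$1 < 0"
      | "gap x > 0" "a * x$1 < 0"
    proof -
      have "gap x < 0 \<Longrightarrow> b * x$2 \<noteq> 0" using gap_neg_imp[of x] b by auto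
      moreover have "(-b) * x$2 = - (b * x$2)" by simp
      ultimately have "gap x < 0 \<Longrightarrow> b * x$2 > 0 \<or> (-b) * x$2 > 0" by linarith
      moreover have "gap x < 0 \<or> gap x = 0 \<and> a * x$1 < 0 \<or> gap x > 0 \<and> a * x$1 < 0"
        using x by force
      ultimately show ?thesis using that by blast
    qed
    then show ?thesis
    proof cases
      case 1
      then have "x \<in> Mixed_cell b" using x by (simp add: Mixed_cell_def)
      moreover have "Mixed_cell b \<subseteq> ?Q" by (auto simp: Mixed_cell_def)
      ultimately show ?thesis using Mixed_cell_reaches_Surf[OF na b _ _ SQ] by blast
    next
      case 2
      then have "x \<in> Mixed_cell (-b)" using x by (simp add: Mixed_cell_def)
      moreover have "Mixed_cell (-b) \<subseteq> ?Q" by (auto simp: Mixed_cell_def)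
      ultimately show ?thesis using Mixed_cell_reaches_Surf[OF na nb _ _ SQ] by blast
    next
      case 3
      then have "x$1 \<noteq> 0" by auto
      then have "x$2 \<noteq> 0" using gap_zero_imp[of x] 3 by auto
      then have "b * x$2 > 0 \<or> (-b) * x$2 > 0" using b by (auto simp: abs_if split: if_splits)
      then have "x \<in> Surf (-a) b \<union> Surf (-a) (-b)" using 3 x by (auto simp: Surf_def)
      then show ?thesis using connected_component_refl[OF x] by blast
    next
      case 4
      then have "x \<in> Definite_cell (-a)" using x by (simp add: Definite_cell_def)
      moreover have "Definite_cell (-a) \<subseteq> ?Q" by (auto simp: Definite_cell_def)
      ultimately show ?thesis using Definite_cell_reaches_Surf[OF na b _ _ SQ] by blast
    qed
  qed
  have split: "Sphere3 - (closure (Surf a b) \<union> closure (Surf a (-b))) = Definite_cell a \<union> ?Q"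
  proof -
    have "x \<in> Sphere3 - (closure (Surf a b) \<union> closure (Surf a (-b))) \<longleftrightarrow> x \<in> Definite_cell a \<union> ?Q"
      if x: "x \<in> Sphere3" for x
    proof -
      have "b * x$2 \<ge> 0 \<or> (-b) * x$2 \<ge> 0" by auto
      moreover have "gap x > 0 \<Longrightarrow> a * x$1 > 0 \<or> a * x$1 < 0"
        using gap_pos_imp[of x] a by (metis abs_zero linorder_neqE_linordered_idom mult_eq_0_iff zero_neq_one)
      ultimately show ?thesis
        unfolding closure_Surf_eq[OF a b] closure_Surf_eq[OF a nb] Definite_cell_def
        using x by auto
    qed
    moreover have "Definite_cell a \<union> ?Q \<subseteq> Sphere3" by (auto simp: Definite_cell_def)
    ultimately show ?thesis by blast
  qed
  have disj: "Definite_cell a \<inter> ?Q = {}" by (auto simp: Definite_cell_def)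
  have op1: "openin (top_of_set Sphere3) (Definite_cell a)"
    by (rule openin_sphere_Collect[of "\<lambda>x. gap x > 0 \<and> a * x$1 > 0"])
       (auto simp: Definite_cell_def intro!: open_Collect_conj open_gap open_Collect_less continuous_intros)
  have op2: "openin (top_of_set Sphere3) ?Q"
    by (rule openin_sphere_Collect[of "\<lambda>x. gap x < 0 \<or> a * x$1 < 0"])
       (auto intro!: open_Collect_disj open_gap open_Collect_less continuous_intros)
  have I: "Definite_cell a \<inter> (Surf (-a) b \<union> Surf (-a) (-b)) = {}"
    by (auto simp: Definite_cell_def Surf_def)
  show "enclosed (Surf a b) (Surf a (-b)) (Surf (-a) b) (Surf (-a) (-b)) = Definite_cell a"
    by (rule enclosed_eqI[OF split disj op1 op2 I reach])
  then show "enclosed (Surf a b) (Surf a (-b)) (Surf (-a) (-b)) (Surf (-a) b) = Definite_cell a"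
    by (simp add: enclosed_def Un_commute)
qed

text \<open>
  Outside the closed surfaces and the cell itself, \<open>gap > 0\<close> or \<open>x$2\<close> has the sign \<open>- b\<close>. Besides the other
  cells and surfaces this region contains points with \<open>gap = x$1 = 0\<close>. There \<open>rho2\<close> vanishes, and
  increasing \<open>x$1\<close> leads into a definite cell.
\<close>

lemma enclosed_Mixed_cell:
  assumes a: "\<bar>a\<bar> = 1" and b: "\<bar>b\<bar> = 1"
  shows "enclosed (Surf a b) (Surf (-a) b) (Surf a (-b)) (Surf (-a) (-b)) = Mixed_cell b"
    "enclosed (Surf a b) (Surf (-a) b) (Surf (-a) (-b)) (Surf a (-b)) = Mixed_cell b"
proof -
  let ?Q = "{x \<in> Sphere3. gap x > 0 \<or> b * x$2 < 0}"
  have na: "\<bar>-a\<bar> = 1" and nb: "\<bar>-b\<bar> = 1" using a b by auto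
  have SQ: "Surf c (-b) \<subseteq> ?Q" for c by (auto simp: Surf_def)
  have pos: "\<exists>y \<in> Surf a (-b) \<union> Surf (-a) (-b). connected_component ?Q x y"
    if x: "x \<in> Sphere3" "gap x > 0" for x
  proof -
    have DQ: "Definite_cell c \<subseteq> ?Q" for c by (auto simp: Definite_cell_def)
    have "a * x$1 > 0 \<or> (-a) * x$1 > 0" using gap_pos_imp[OF x(2)] a by (auto simp: abs_if split: if_splits)
    then have "x \<in> Definite_cell a \<or> x \<in> Definite_cell (-a)" using x by (auto simp: Definite_cell_def)
    then show ?thesis
      using Definite_cell_reaches_Surf[OF a nb _ DQ SQ] Definite_cell_reaches_Surf[OF na nb _ DQ SQ] by blast
  qed
  have reach: "\<exists>y \<in> Surf a (-b) \<union> Surf (-a) (-b). connected_component ?Q x y" if x: "x \<in> ?Q" for x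
  proof -
    consider "gap x > 0" | "gap x < 0" "b * x$2 < 0" | "gap x = 0" "b * x$2 < 0"
      using x by force
    then show ?thesis
    proof cases
      case 1
      then show ?thesis using pos x by blast
    next
      case 2
      then have "x \<in> Mixed_cell (-b)" using x by (simp add: Mixed_cell_def)
      moreover have "Mixed_cell (-b) \<subseteq> ?Q" by (auto simp: Mixed_cell_def)
      ultimately show ?thesis using Mixed_cell_reaches_Surf[OF a nb _ _ SQ] by blast
    next
      case 3
      show ?thesis
      proof (cases "x$1 = 0")
        case False
        then have "a * x$1 > 0 \<or> (-a) * x$1 > 0" using a by (auto simp: abs_if split: if_splits)
        then have "x \<in> Surf a (-b) \<union> Surf (-a) (-b)" using 3 x by (auto simp: Surf_def)
        then show ?thesis using connected_component_refl[OF x] by blast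
      next
        case True
        then have r: "rho2 x = 0" using 3 by (simp add: gap_def)
        let ?y = "inverse (norm (with_first x 1)) *\<^sub>R with_first x 1"
        have S: "x \<in> Sphere3" using x by auto
        \<comment> \<open>only the sign of \<open>x$2\<close> keeps this path inside \<open>?Q\<close>, as \<open>gap = 0\<close> at its start\<close>
        have "connected_component ?Q x ?y"
        proof (rule connected_component_with_first[OF S])
          have "(x$2)\<^sup>2 > 0" using 3 by auto
          then have "(x$2)\<^sup>2 + (x$3)\<^sup>2 + (x$4)\<^sup>2 > 0" by (metis add_pos_nonneg zero_le_power2)
          then show "(x$2)\<^sup>2 + (x$3)\<^sup>2 + (x$4)\<^sup>2 \<noteq> 0" by simp
          fix s k :: real
          assume k: "k > 0" and sph: "k *\<^sub>R with_first x s \<in> Sphere3"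
          have "b * (k *\<^sub>R with_first x s) $ 2 < 0" unfolding sign_scale(2)[OF k] using 3 by simp
          then show "k *\<^sub>R with_first x s \<in> ?Q" using sph by simp
        qed
        moreover have z0: "with_first x 1 \<noteq> 0" by (auto simp: vec4_eq_iff)
        have "gap (with_first x 1) > 0" by (simp add: gap_with_first r)
        then have "\<exists>y \<in> Surf a (-b) \<union> Surf (-a) (-b). connected_component ?Q ?y y"
          using gap_normalise(1)[OF z0] normalise_in_sphere[OF z0] by (intro pos) auto
        ultimately show ?thesis by (meson connected_component_trans)
      qed
    qed
  qed
  have split: "Sphere3 - (closure (Surf a b) \<union> closure (Surf (-a) b)) = Mixed_cell b \<union> ?Q"
  proof -
    have "x \<in> Sphere3 - (closure (Surf a b) \<union> closure (Surf (-a) b)) \<longleftrightarrow> x \<in> Mixed_cell b \<union> ?Q"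
      if x: "x \<in> Sphere3" for x
    proof -
      have "a * x$1 \<ge> 0 \<or> (-a) * x$1 \<ge> 0" by auto
      moreover have "gap x < 0 \<Longrightarrow> b * x$2 > 0 \<or> b * x$2 < 0"
        using gap_neg_imp[of x] b by (metis abs_zero linorder_neqE_linordered_idom mult_eq_0_iff zero_neq_one)
      ultimately show ?thesis
        unfolding closure_Surf_eq[OF a b] closure_Surf_eq[OF na b] Mixed_cell_def
        using x by auto
    qed
    moreover have "Mixed_cell b \<union> ?Q \<subseteq> Sphere3" by (auto simp: Mixed_cell_def)
    ultimately show ?thesis by blast
  qed
  have disj: "Mixed_cell b \<inter> ?Q = {}" by (auto simp: Mixed_cell_def)
  have op1: "openin (top_of_set Sphere3) (Mixed_cell b)"
    by (rule openin_sphere_Collect[of "\<lambda>x. gap x < 0 \<and> b * x$2 > 0"])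
       (auto simp: Mixed_cell_def intro!: open_Collect_conj open_gap open_Collect_less continuous_intros)
  have op2: "openin (top_of_set Sphere3) ?Q"
    by (rule openin_sphere_Collect[of "\<lambda>x. gap x > 0 \<or> b * x$2 < 0"])
       (auto intro!: open_Collect_disj open_gap open_Collect_less continuous_intros)
  have I: "Mixed_cell b \<inter> (Surf a (-b) \<union> Surf (-a) (-b)) = {}"
    by (auto simp: Mixed_cell_def Surf_def)
  show "enclosed (Surf a b) (Surf (-a) b) (Surf a (-b)) (Surf (-a) (-b)) = Mixed_cell b"
    by (rule enclosed_eqI[OF split disj op1 op2 I reach])
  then show "enclosed (Surf a b) (Surf (-a) b) (Surf (-a) (-b)) (Surf a (-b)) = Mixed_cell b"
    by (simp add: enclosed_def Un_commute)
qed

lemma V_eqs: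
  "V1 = Definite_cell 1" "V3 = Definite_cell (-1)" "V2 = Mixed_cell 1" "V4 = Mixed_cell (-1)"
  unfolding V1_def V2_def V3_def V4_def S_eqs
  using enclosed_Definite_cell[of 1 1] enclosed_Definite_cell[of "-1" 1]
    enclosed_Mixed_cell[of 1 1] enclosed_Mixed_cell[of "-1" "-1"] by simp_all

section \<open>Dimensions of the cells, curves and points\<close>

lemma smooth_submanifold_singleton: "smooth_submanifold 0 {p :: 'a::euclidean_space}"
  unfolding smooth_submanifold_def
proof
  fix x assume "x \<in> {p}"
  have "homeomorphism UNIV UNIV (\<lambda>z. z - p) (\<lambda>z. z + p)"
    by (auto simp: homeomorphism_def surj_def intro!: continuous_intros exI[of _ "_ + p"] exI[of _ "_ - p"])
  moreover have "smooth_on UNIV (\<lambda>z. z - p)" "smooth_on UNIV (\<lambda>z. z + p)"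
    unfolding smooth_on_def by (intro allI Ck_on_intros open_UNIV)+
  ultimately show "\<exists>U W E (f :: 'a \<Rightarrow> 'a) g. open U \<and> x \<in> U \<and> open W \<and> homeomorphism U W f g \<and>
     smooth_on U f \<and> smooth_on W g \<and> subspace E \<and> dim E = 0 \<and> f ` (U \<inter> {p}) = W \<inter> E"
    by (intro exI[of _ UNIV] exI[of _ "{0}"] exI[of _ "\<lambda>z. z - p"] exI[of _ "\<lambda>z. z + p"]) auto
qed

lemma submanifold_of_great_sphere:
  assumes "subspace G" "dim G = Suc d" "open {x. P x}" "A = {x. P x} \<inter> (sphere 0 1 \<inter> G)"
  shows "smooth_submanifold d (A :: 'a::euclidean_space set)"
  unfolding assms(4) by (intro smooth_submanifold_Int_open smooth_submanifold_sphere_Int_subspace assms)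

lemma Definite_cell_open_in_sphere: "Definite_cell a = {x. gap x > 0 \<and> a * x$1 > 0} \<inter> Sphere3"
  and Mixed_cell_open_in_sphere: "Mixed_cell b = {x. gap x < 0 \<and> b * x$2 > 0} \<inter> Sphere3"
  by (auto simp: Definite_cell_def Mixed_cell_def)

lemma open_cells: "open {x. gap x > 0 \<and> a * x$1 > 0}" "open {x. gap x < 0 \<and> b * x$2 > 0}"
  by (intro open_Collect_conj open_gap open_Collect_less continuous_intros)+

lemma smooth_submanifold_cells: "smooth_submanifold 3 (Definite_cell a)" "smooth_submanifold 3 (Mixed_cell b)"
proof -
  have "dim (UNIV :: (real^4) set) = Suc 3" by simp
  note sub = submanifold_of_great_sphere[OF subspace_UNIV this]
  show "smooth_submanifold 3 (Definite_cell a)"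
    by (rule sub[OF open_cells(1)]) (simp add: Definite_cell_open_in_sphere)
  show "smooth_submanifold 3 (Mixed_cell b)"
    by (rule sub[OF open_cells(2)]) (simp add: Mixed_cell_open_in_sphere)
qed

lemma coordinate_planes:
  "subspace {x::real^4. x$1 = 0 \<and> x$4 = 0}" "dim {x::real^4. x$1 = 0 \<and> x$4 = 0} = 2"
  "subspace {x::real^4. x$1 = 0 \<and> x$2 = 0}" "dim {x::real^4. x$1 = 0 \<and> x$2 = 0} = 2"
proof -
  show "subspace {x::real^4. x$1 = 0 \<and> x$4 = 0}" "subspace {x::real^4. x$1 = 0 \<and> x$2 = 0}"
    by (auto simp: subspace_def)
  have "{x::real^4. x$1 = 0 \<and> x$4 = 0} = {x. \<forall>i. i \<notin> {2, 3} \<longrightarrow> x$i = 0}"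
    "{x::real^4. x$1 = 0 \<and> x$2 = 0} = {x. \<forall>i. i \<notin> {3, 4} \<longrightarrow> x$i = 0}" by (auto simp: forall_4)
  then show "dim {x::real^4. x$1 = 0 \<and> x$4 = 0} = 2" "dim {x::real^4. x$1 = 0 \<and> x$2 = 0} = 2"
    using dim_coordinate_subspace[of "{2, 3 :: 4}"] dim_coordinate_subspace[of "{3, 4 :: 4}"] by simp_all
qed

lemma smooth_submanifold_Double_arc: "smooth_submanifold 1 (Double_arc b c)"
proof (rule submanifold_of_great_sphere[OF coordinate_planes(1)])
  show "open {x::real^4. 0 < b * x$2 \<and> b * x$2 < sqrt 2 / 2 \<and> c * x$3 > 0}"
    by (intro open_Collect_conj open_Collect_less continuous_intros)
qed (auto simp: coordinate_planes Double_arc_def)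

lemma smooth_submanifold_Half_circle: "smooth_submanifold 1 (Half_circle d)"
proof (rule submanifold_of_great_sphere[OF coordinate_planes(3)])
  show "open {x::real^4. d * x$4 > 0}" by (intro open_Collect_less continuous_intros)
qed (auto simp: coordinate_planes Half_circle_def)

section \<open>Limits of tangent spaces along the curves\<close>

lemma tangent_space_scale:
  fixes M :: "'a::euclidean_space set"
  assumes "v \<in> tangent_space M x"
  shows "r *\<^sub>R v \<in> tangent_space M x"
proof -
  obtain c e where c: "e > 0" "smooth_on {-e<..<e} c" "c ` {-e<..<e} \<subseteq> M" "c 0 = x"
    "(c has_vector_derivative v) (at 0)"
    using assms unfolding tangent_space_def by blast
  let ?I = "(\<lambda>t. 0 + r * t) -` {-e<..<e}"
  show ?thesis
  proof (rule tangent_spaceI[of ?I])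
    show "open ?I" by (intro open_vimage continuous_intros)
    show "Ck_on k ?I (\<lambda>t. c (0 + r * t))" for k
      using Ck_on_affine_substitution[OF bounded_linear_mult_right, of k "{-e<..<e}" c 0 r] c(2)
      by (simp add: smooth_on_def)
    show "((\<lambda>t. c (0 + r * t)) has_vector_derivative r *\<^sub>R v) (at 0)"
    proof -
      have "((\<lambda>t. 0 + r * t) has_vector_derivative r) (at 0)"
        by (auto intro!: derivative_eq_intros simp flip: has_real_derivative_iff_has_vector_derivative)
      moreover have "(c has_vector_derivative v) (at (0 + r * 0))" using c(5) by simp
      ultimately have "((c \<circ> (\<lambda>t. 0 + r * t)) has_vector_derivative r *\<^sub>R v) (at 0)"
        by (rule vector_diff_chain_at)
      then show ?thesis by (simp add: o_def)
    qed
  qed (use c in auto)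
qed

text \<open>
  On the arc the fixed-slope field is \<open>(0, 1, - x$2 / x$3, 0)\<close>, because \<open>x$1 = x$4 = 0\<close> and
  \<open>1 - (x$2)\<^sup>2 = (x$3)\<^sup>2\<close>. It spans the tangent line, and multiplying it by \<open>v$2\<close> gives \<open>v\<close>.
\<close>

lemma tangents_approximable_Double_arc:
  assumes b: "\<bar>b\<bar> = 1"
  shows "tangents_approximable (Double_arc b c) (Surf a b)"
  unfolding tangents_approximable_def
proof (intro ballI allI impI)
  fix x v and y :: "nat \<Rightarrow> real^4"
  assume x: "x \<in> Double_arc b c" and v: "v \<in> tangent_space (Double_arc b c) x"
    and y: "\<forall>k. y k \<in> Surf a b" and lim: "y \<longlonglongrightarrow> x"
  have v0: "v$1 = 0" "v$4 = 0"
    using tangent_space_subspace[OF coordinate_planes(1) _ v] by (auto simp: Double_arc_def)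
  have x0: "x$1 = 0" "x$4 = 0" "x$2 \<noteq> 0" "x$3 \<noteq> 0" using x by (auto simp: Double_arc_def)
  have orth: "x$2 * v$2 + x$3 * v$3 = 0"
  proof -
    have "Double_arc b c \<subseteq> Sphere3" by (auto simp: Double_arc_def)
    from tangent_space_sphere_orthogonal[OF this v] show ?thesis using v0 x0 by (simp add: inner_4)
  qed
  have x3: "(x$3)\<^sup>2 = 1 - (x$2)\<^sup>2" using x by (auto simp: Double_arc_def norm_4_eq_1)
  have "b * x$2 < sqrt 2 / 2" "0 < b * x$2" using x by (auto simp: Double_arc_def)
  then have "(b * x$2)\<^sup>2 < (sqrt 2 / 2)\<^sup>2" by (intro power_strict_mono) auto
  then have x2: "2 * (x$2)\<^sup>2 < 1"
    unfolding half_sqrt2(1) power_mult_distrib power2_eq_square[of b] sign_square[OF b] by simp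
  define f :: "real^4 \<Rightarrow> real^4" where
    "f z = vector [z$1 / z$2, 1, - z$2 * z$3 / (1 - (z$2)\<^sup>2), - 2 * z$2 * z$4 / (1 - 2 * (z$2)\<^sup>2)]" for z
  have "(\<lambda>k. 2 * (y k $ 2)\<^sup>2) \<longlonglongrightarrow> 2 * (x$2)\<^sup>2" by (intro tendsto_intros lim)
  then have "\<forall>\<^sub>F k in sequentially. 2 * (y k $ 2)\<^sup>2 < 1" using x2 by (rule order_tendstoD)
  then have "\<forall>\<^sub>F k in sequentially. v$2 *\<^sub>R f (y k) \<in> tangent_space (Surf a b) (y k)"
  proof eventually_elim
    case (elim k)
    have "f (y k) \<in> tangent_space (Surf a b) (y k)"
      unfolding f_def using y elim by (intro tangent_Surf_fixed_slope) auto
    then show ?case by (rule tangent_space_scale)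
  qed
  moreover have "(\<lambda>k. v$2 *\<^sub>R f (y k)) \<longlonglongrightarrow> v$2 *\<^sub>R f x"
    unfolding f_def using x0 x2 x3 by (intro tendsto_intros tendsto_vector_4 lim) auto
  moreover have "v$2 *\<^sub>R f x = v"
  proof -
    have "v$2 * (- x$2 * x$3 / (x$3)\<^sup>2) = v$3"
      using orth x0 by (simp add: field_simps power2_eq_square)
    then show ?thesis using v0 x0 by (simp add: vec4_eq_iff f_def flip: x3)
  qed
  ultimately show "\<exists>w. (\<forall>\<^sub>F k in sequentially. w k \<in> tangent_space (Surf a b) (y k)) \<and> w \<longlonglongrightarrow> v"
    by (intro exI[of _ "\<lambda>k. v$2 *\<^sub>R f (y k)"]) simp
qed

text \<open>
  On the half circle the rotation field is \<open>(0, 0, (x$4)\<^sup>2, - x$3 * x$4)\<close>, which spans the tangent line.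
\<close>

lemma tangents_approximable_Half_circle: "tangents_approximable (Half_circle d) (Surf a b)"
  unfolding tangents_approximable_def
proof (intro ballI allI impI)
  fix x v and y :: "nat \<Rightarrow> real^4"
  assume x: "x \<in> Half_circle d" and v: "v \<in> tangent_space (Half_circle d) x"
    and y: "\<forall>k. y k \<in> Surf a b" and lim: "y \<longlonglongrightarrow> x"
  have v0: "v$1 = 0" "v$2 = 0"
    using tangent_space_subspace[OF coordinate_planes(3) _ v] by (auto simp: Half_circle_def)
  have x0: "x$1 = 0" "x$2 = 0" "x$4 \<noteq> 0" using x by (auto simp: Half_circle_def)
  have orth: "x$3 * v$3 + x$4 * v$4 = 0"
  proof -
    have "Half_circle d \<subseteq> Sphere3" by (auto simp: Half_circle_def)
    from tangent_space_sphere_orthogonal[OF this v] show ?thesis using v0 x0 by (simp add: inner_4)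
  qed
  define f :: "real^4 \<Rightarrow> real^4" where
    "f z = vector [- z$1 * z$3, 0, (z$1)\<^sup>2 + (z$4)\<^sup>2, - z$3 * z$4]" for z
  let ?r = "v$3 / (x$4)\<^sup>2"
  have "?r *\<^sub>R f (y k) \<in> tangent_space (Surf a b) (y k)" for k
  proof (rule tangent_space_scale)
    show "f (y k) \<in> tangent_space (Surf a b) (y k)"
      unfolding f_def using y by (intro tangent_Surf_rotation) auto
  qed
  moreover have "(\<lambda>k. ?r *\<^sub>R f (y k)) \<longlonglongrightarrow> ?r *\<^sub>R f x"
    unfolding f_def by (intro tendsto_intros tendsto_vector_4 lim)
  moreover have "?r *\<^sub>R f x = v"
  proof -
    have "v$3 / (x$4)\<^sup>2 * (- x$3 * x$4) = v$4"
      using orth x0 by (simp add: field_simps power2_eq_square)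
    then show ?thesis using v0 x0 by (simp add: vec4_eq_iff f_def)
  qed
  ultimately show "\<exists>w. (\<forall>\<^sub>F k in sequentially. w k \<in> tangent_space (Surf a b) (y k)) \<and> w \<longlonglongrightarrow> v"
    by (intro exI[of _ "\<lambda>k. ?r *\<^sub>R f (y k)"]) simp
qed

section \<open>The partition\<close>

text \<open>
  The strata are the fibres of this map on the sphere, so they are disjoint without comparing them in
  pairs. The first entry is the dimension of the stratum; the other three record the signs that
  distinguish strata of the same kind.
\<close>

definition signature :: "real^4 \<Rightarrow> real \<times> real \<times> real \<times> real" where
  "signature x =
     (if gap x > 0 then (3, sgn (x$1), 0, 0)
      else if gap x < 0 then (3, 0, sgn (x$2), 0)
      else if x$1 \<noteq> 0 then (2, sgn (x$1), sgn (x$2), 0)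
      else if x$2 \<noteq> 0 then (if (x$2)\<^sup>2 < 1/2 then 1 else 0, 0, sgn (x$2), sgn (x$3))
      else if x$4 \<noteq> 0 then (1, 0, 0, sgn (x$4))
      else (0, 0, 0, sgn (x$3)))"

lemma sgn_eq_iff: "\<bar>a\<bar> = 1 \<Longrightarrow> sgn t = a \<longleftrightarrow> a * t > 0" for a t :: real
  by (auto simp: sgn_if abs_if mult_less_0_iff split: if_splits)

lemma abs_le_half_sqrt2: "\<bar>b\<bar> = 1 \<Longrightarrow> b * t > 0 \<Longrightarrow> b * t < sqrt 2 / 2 \<longleftrightarrow> t\<^sup>2 < 1/2"
  "\<bar>b\<bar> = 1 \<Longrightarrow> b * t > 0 \<Longrightarrow> b * t = sqrt 2 / 2 \<longleftrightarrow> t\<^sup>2 = 1/2"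
proof -
  assume b: "\<bar>b\<bar> = 1" "b * t > 0"
  have e: "(b * t)\<^sup>2 = t\<^sup>2" using sign_square[OF b(1)] by (simp add: power_mult_distrib power2_eq_square[of b])
  show "b * t < sqrt 2 / 2 \<longleftrightarrow> t\<^sup>2 < 1/2"
    using e half_sqrt2(1,2) b(2)
    by (metis less_imp_le power2_less_imp_less power_strict_mono zero_less_numeral)
  show "b * t = sqrt 2 / 2 \<longleftrightarrow> t\<^sup>2 = 1/2"
    using e half_sqrt2(1,2) b(2) by (metis less_imp_le power2_eq_imp_eq)
qed

lemma equator_facts:
  assumes "x \<in> Sphere3" "x$1 = 0"
  shows "gap x \<le> 0" "gap x = 0 \<longleftrightarrow> x$2 = 0 \<or> x$4 = 0 \<and> (x$2)\<^sup>2 \<le> 1/2"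
proof -
  show "gap x \<le> 0" using assms rho2_nonneg[of x] by (simp add: gap_def)
  have "(x$2)\<^sup>2 + (x$3)\<^sup>2 + (x$4)\<^sup>2 = 1" using assms by (simp add: norm_4_eq_1)
  then show "gap x = 0 \<longleftrightarrow> x$2 = 0 \<or> x$4 = 0 \<and> (x$2)\<^sup>2 \<le> 1/2"
    unfolding gap_zero_on_equator[OF assms(2)] by auto
qed

lemma signature_fibres:
  assumes s: "\<bar>a\<bar> = 1" "\<bar>b\<bar> = 1" "\<bar>c\<bar> = 1"
  shows "Definite_cell a = {x \<in> Sphere3. signature x = (3, a, 0, 0)}"
    "Mixed_cell b = {x \<in> Sphere3. signature x = (3, 0, b, 0)}"
    "Surf a b = {x \<in> Sphere3. signature x = (2, a, b, 0)}"
    "Double_arc b c = {x \<in> Sphere3. signature x = (1, 0, b, c)}"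
    "Pinch b c = {x \<in> Sphere3. signature x = (0, 0, b, c)}"
    "Half_circle c = {x \<in> Sphere3. signature x = (1, 0, 0, c)}"
    "Pole c = {x \<in> Sphere3. signature x = (0, 0, 0, c)}"
proof -
  have nz: "a \<noteq> 0" "b \<noteq> 0" "c \<noteq> 0" using s by auto
  have x2nz: "b * t > 0 \<Longrightarrow> t \<noteq> 0" for t by auto
  show "Definite_cell a = {x \<in> Sphere3. signature x = (3, a, 0, 0)}"
    unfolding Definite_cell_def signature_def sgn_eq_iff[OF s(1), symmetric]
    using nz by (auto split: if_splits)
  show "Mixed_cell b = {x \<in> Sphere3. signature x = (3, 0, b, 0)}"
    unfolding Mixed_cell_def signature_def sgn_eq_iff[OF s(2), symmetric]
    using nz gap_pos_imp by (auto split: if_splits simp: sgn_0_0)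
  show "Surf a b = {x \<in> Sphere3. signature x = (2, a, b, 0)}"
    unfolding Surf_def signature_def sgn_eq_iff[OF s(1), symmetric] sgn_eq_iff[OF s(2), symmetric]
    using nz by (auto split: if_splits simp: sgn_0_0)
  have axis: "signature x = (if x$2 \<noteq> 0 then if x$4 = 0 \<and> (x$2)\<^sup>2 \<le> 1/2
      then (if (x$2)\<^sup>2 < 1/2 then 1 else 0, 0, sgn (x$2), sgn (x$3)) else (3, 0, sgn (x$2), 0)
      else if x$4 \<noteq> 0 then (1, 0, 0, sgn (x$4)) else (0, 0, 0, sgn (x$3)))"
    if "x \<in> Sphere3" "x$1 = 0" for x
    using equator_facts[OF that] that(2) unfolding signature_def by auto
  have off: "x$1 = 0" if "signature x = (p, 0, q, r)" "p \<noteq> 3" for x p q r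
    using that unfolding signature_def by (auto split: if_splits simp: sgn_0_0)
  have h: "x \<in> Double_arc b c \<longleftrightarrow> signature x = (1, 0, b, c)" "x \<in> Pinch b c \<longleftrightarrow> signature x = (0, 0, b, c)"
    "x \<in> Half_circle c \<longleftrightarrow> signature x = (1, 0, 0, c)" "x \<in> Pole c \<longleftrightarrow> signature x = (0, 0, 0, c)"
    if x: "x \<in> Sphere3" for x
  proof -
    show "x \<in> Double_arc b c \<longleftrightarrow> signature x = (1, 0, b, c)"
    proof (cases "x$1 = 0")
      case True
      show ?thesis unfolding axis[OF x True] Double_arc_def
        using x True nz abs_le_half_sqrt2[OF s(2), of "x$2"] x2nz[of "x$2"]
        by (auto simp: sgn_eq_iff[OF s(2)] sgn_eq_iff[OF s(3)] split: if_splits)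
    qed (use off[of x 1 b c] in \<open>auto simp: Double_arc_def\<close>)
    show "x \<in> Pinch b c \<longleftrightarrow> signature x = (0, 0, b, c)"
    proof (cases "x$1 = 0")
      case True
      have "b * x$2 = sqrt 2 / 2 \<Longrightarrow> b * x$2 > 0" using half_sqrt2(2) by metis
      then show ?thesis unfolding axis[OF x True] Pinch_def
        using x True nz abs_le_half_sqrt2[OF s(2), of "x$2"] x2nz[of "x$2"]
        by (auto simp: sgn_eq_iff[OF s(2)] sgn_eq_iff[OF s(3)] split: if_splits)
    qed (use off[of x 0 b c] in \<open>auto simp: Pinch_def\<close>)
    show "x \<in> Half_circle c \<longleftrightarrow> signature x = (1, 0, 0, c)"
    proof (cases "x$1 = 0")
      case True
      show ?thesis unfolding axis[OF x True] Half_circle_def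
        using x True nz by (auto simp: sgn_eq_iff[OF s(3)] sgn_0_0 split: if_splits)
    qed (use off[of x 1 0 c] in \<open>auto simp: Half_circle_def\<close>)
    show "x \<in> Pole c \<longleftrightarrow> signature x = (0, 0, 0, c)"
    proof (cases "x$1 = 0")
      case True
      show ?thesis unfolding axis[OF x True] Pole_def
        using x True nz by (auto simp: sgn_eq_iff[OF s(3)] sgn_0_0 split: if_splits)
    qed (use off[of x 0 0 c] in \<open>auto simp: Pole_def\<close>)
  qed
  have sub: "Double_arc b c \<subseteq> Sphere3" "Pinch b c \<subseteq> Sphere3" "Half_circle c \<subseteq> Sphere3" "Pole c \<subseteq> Sphere3"
    by (auto simp: Double_arc_def Pinch_def Half_circle_def Pole_def)
  show "Double_arc b c = {x \<in> Sphere3. signature x = (1, 0, b, c)}"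
    "Pinch b c = {x \<in> Sphere3. signature x = (0, 0, b, c)}"
    "Half_circle c = {x \<in> Sphere3. signature x = (1, 0, 0, c)}"
    "Pole c = {x \<in> Sphere3. signature x = (0, 0, 0, c)}"
    using h sub by blast+
qed

lemma sphere_cover:
  assumes x: "x \<in> Sphere3"
  obtains a b c where "\<bar>a\<bar> = 1" "\<bar>b\<bar> = 1" "\<bar>c\<bar> = (1::real)"
    "x \<in> Definite_cell a \<union> Mixed_cell b \<union> Surf a b \<union> Double_arc b c \<union> Pinch b c \<union> Half_circle c \<union> Pole c"
proof -
  have s: "\<exists>a. \<bar>a\<bar> = 1 \<and> a * t > 0" if "t \<noteq> 0" for t :: real
    using that by (intro exI[of _ "sgn t"]) (auto simp: sgn_if)
  consider "gap x > 0" | "gap x < 0" | "gap x = 0" "x$1 \<noteq> 0" | "gap x = 0" "x$1 = 0" by linarith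
  then show thesis
  proof cases
    case 1
    then obtain a where "\<bar>a\<bar> = 1" "a * x$1 > 0" using s gap_pos_imp by blast
    then show thesis using that[of a 1 1] x 1 by (simp add: Definite_cell_def)
  next
    case 2
    then obtain b where "\<bar>b\<bar> = 1" "b * x$2 > 0" using s gap_neg_imp by blast
    then show thesis using that[of 1 b 1] x 2 by (simp add: Mixed_cell_def)
  next
    case 3
    then obtain a b where "\<bar>a\<bar> = 1" "a * x$1 > 0" "\<bar>b\<bar> = 1" "b * x$2 > 0" using s gap_zero_imp by metis
    then show thesis using that[of a b 1] x 3 by (simp add: Surf_def)
  next
    case 4
    have n: "(x$2)\<^sup>2 + (x$3)\<^sup>2 + (x$4)\<^sup>2 = 1" using x 4 by (simp add: norm_4_eq_1)
    show thesis
    proof (cases "x$2 = 0")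
      case False
      then have z: "x$4 = 0" "(x$2)\<^sup>2 \<le> 1/2" using equator_facts(2)[OF x 4(2)] 4 by auto
      then have "x$3 \<noteq> 0" using n by auto
      then obtain b c where bc: "\<bar>b\<bar> = 1" "b * x$2 > 0" "\<bar>c\<bar> = 1" "c * x$3 > 0" using s False by metis
      have "x \<in> Double_arc b c \<union> Pinch b c"
        using x z 4 bc abs_le_half_sqrt2[OF bc(1,2)] by (auto simp: Double_arc_def Pinch_def)
      then show thesis using that[of 1 b c] bc by auto
    next
      case True
      show thesis
      proof (cases "x$4 = 0")
        case True
        then have "x$3 \<noteq> 0" using n \<open>x$2 = 0\<close> by auto
        then obtain c where "\<bar>c\<bar> = 1" "c * x$3 > 0" using s by metis
        then show thesis using that[of 1 1 c] x 4 True \<open>x$2 = 0\<close> by (simp add: Pole_def)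
      next
        case False
        then obtain c where "\<bar>c\<bar> = 1" "c * x$4 > 0" using s by metis
        then show thesis using that[of 1 1 c] x 4 True by (simp add: Half_circle_def)
      qed
    qed
  qed
qed

lemma sphere_eq_Union_strata: "\<Union>strata = Sphere3"
proof
  show "\<Union>strata \<subseteq> Sphere3"
    unfolding strata_def critical_strata_def V_eqs S_eqs L_eqs P_eqs
    by (auto simp: Definite_cell_def Mixed_cell_def Surf_def Double_arc_def Pinch_def Half_circle_def Pole_def)
  show "Sphere3 \<subseteq> \<Union>strata"
  proof
    fix x :: "real^4" assume "x \<in> Sphere3"
    then obtain a b c where s: "\<bar>a\<bar> = 1" "\<bar>b\<bar> = 1" "\<bar>c\<bar> = (1::real)"
      and x: "x \<in> Definite_cell a \<union> Mixed_cell b \<union> Surf a b \<union> Double_arc b c \<union> Pinch b c \<union> Half_circle c \<union> Pole c"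
      by (rule sphere_cover)
    have "a = 1 \<or> a = -1" "b = 1 \<or> b = -1" "c = 1 \<or> c = -1" using s by (auto simp: abs_if split: if_splits)
    then show "x \<in> \<Union>strata"
      using x unfolding strata_def critical_strata_def V_eqs S_eqs L_eqs P_eqs by auto
  qed
qed

lemma strata_induct:
  assumes "X \<in> strata"
    and "Q V1" "Q V2" "Q V3" "Q V4" "Q S1" "Q S2" "Q S3" "Q S4" "Q L1" "Q L2" "Q L3" "Q L4" "Q L5" "Q L6" "Q P1" "Q P2" "Q P3" "Q P4" "Q P5" "Q P6"
  shows "Q X"
  using assms unfolding strata_def critical_strata_def by blast

lemma strata_shape_induct:
  assumes "X \<in> strata"
    and "\<And>a. \<bar>a\<bar> = 1 \<Longrightarrow> Q (Definite_cell a)" "\<And>b. \<bar>b\<bar> = 1 \<Longrightarrow> Q (Mixed_cell b)"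
    and "\<And>a b. \<bar>a\<bar> = 1 \<Longrightarrow> \<bar>b\<bar> = 1 \<Longrightarrow> Q (Surf a b)" "\<And>b c. \<bar>b\<bar> = 1 \<Longrightarrow> \<bar>c\<bar> = 1 \<Longrightarrow> Q (Double_arc b c)"
    and "\<And>c. \<bar>c\<bar> = 1 \<Longrightarrow> Q (Half_circle c)" "\<And>b c. \<bar>b\<bar> = 1 \<Longrightarrow> \<bar>c\<bar> = 1 \<Longrightarrow> Q (Pinch b c)"
    and "\<And>c. \<bar>c\<bar> = 1 \<Longrightarrow> Q (Pole c)"
  shows "Q X"
  using assms(1) by (rule strata_induct) (unfold V_eqs S_eqs L_eqs P_eqs, auto intro!: assms(2-))

lemma strata_fibre:
  assumes "X \<in> strata"
  shows "\<exists>s. X = {x \<in> Sphere3. signature x = s}"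
  using assms
proof (rule strata_shape_induct)
  fix a b c :: real assume s: "\<bar>a\<bar> = 1" "\<bar>b\<bar> = 1"
  note f = signature_fibres[OF s(1,1) s(1)] signature_fibres[OF s s(2)] signature_fibres[OF s(1) s]
  show "\<exists>s. Surf a b = {x \<in> Sphere3. signature x = s}" "\<exists>s. Double_arc a b = {x \<in> Sphere3. signature x = s}"
    "\<exists>s. Pinch a b = {x \<in> Sphere3. signature x = s}"
    using f by blast+
next
  fix a :: real assume s: "\<bar>a\<bar> = 1"
  note f = signature_fibres[OF s s s]
  show "\<exists>s. Definite_cell a = {x \<in> Sphere3. signature x = s}" "\<exists>s. Mixed_cell a = {x \<in> Sphere3. signature x = s}"
    "\<exists>s. Half_circle a = {x \<in> Sphere3. signature x = s}" "\<exists>s. Pole a = {x \<in> Sphere3. signature x = s}"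
    using f by blast+
qed

text \<open>
  For \<open>x$1 \<noteq> 0\<close> the weak inequalities are strict. For \<open>x$1 = 0\<close> they leave the circle \<open>x$1 = x$2 = 0\<close> and, for
  \<open>x$4 = 0\<close>, the arcs \<open>0 < b * x$2 \<le> sqrt 2 / 2\<close>, on which \<open>x$3 \<noteq> 0\<close>.
\<close>

lemma closure_Surf_strata:
  assumes a: "\<bar>a\<bar> = 1" and b: "\<bar>b\<bar> = 1"
  shows "closure (Surf a b) = \<Union>{Surf a b, Double_arc b 1, Double_arc b (-1), Half_circle 1, Half_circle (-1),
    Pinch b 1, Pinch b (-1), Pole 1, Pole (-1)}"
proof -
  have "gap x = 0 \<and> a * x$1 \<ge> 0 \<and> b * x$2 \<ge> 0 \<longleftrightarrow>
    x \<in> \<Union>{Surf a b, Double_arc b 1, Double_arc b (-1), Half_circle 1, Half_circle (-1),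
      Pinch b 1, Pinch b (-1), Pole 1, Pole (-1)}" (is "?L \<longleftrightarrow> ?R") if x: "x \<in> Sphere3" for x
  proof (cases "x$1 = 0")
    case False
    have "a \<noteq> 0" "b \<noteq> 0" using a b by auto
    then have "?L \<longleftrightarrow> gap x = 0 \<and> a * x$1 > 0 \<and> b * x$2 > 0"
      using False gap_zero_imp[of x] by (auto simp: less_le)
    also have "\<dots> \<longleftrightarrow> ?R"
      using False x by (auto simp: Surf_def Double_arc_def Half_circle_def Pinch_def Pole_def)
    finally show ?thesis .
  next
    case True
    have n: "(x$2)\<^sup>2 + (x$3)\<^sup>2 + (x$4)\<^sup>2 = 1" using x True by (simp add: norm_4_eq_1)
    have L: "?L \<longleftrightarrow> x$2 = 0 \<or> x$4 = 0 \<and> b * x$2 > 0 \<and> (x$2)\<^sup>2 \<le> 1/2"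
    proof -
      have "b * x$2 \<ge> 0 \<longleftrightarrow> x$2 = 0 \<or> b * x$2 > 0" using b by (auto simp: less_le)
      then show ?thesis using True equator_facts(2)[OF x True] by auto
    qed
    have R: "?R \<longleftrightarrow> x$4 = 0 \<and> 0 < b * x$2 \<and> (x$2)\<^sup>2 \<le> 1/2 \<and> x$3 \<noteq> 0 \<or>
      x$2 = 0 \<and> (x$4 \<noteq> 0 \<or> x$3 \<noteq> 0)"
    proof -
      have "b * x$2 = sqrt 2 / 2 \<Longrightarrow> 0 < b * x$2" using half_sqrt2(2) by metis
      then have r: "0 < b * x$2 \<and> b * x$2 < sqrt 2 / 2 \<or> b * x$2 = sqrt 2 / 2 \<longleftrightarrow> 0 < b * x$2 \<and> (x$2)\<^sup>2 \<le> 1/2"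
        using abs_le_half_sqrt2[OF b, of "x$2"] by (metis le_less)
      have t: "t > 0 \<or> t < 0 \<longleftrightarrow> t \<noteq> 0" for t :: real by auto
      have "?R \<longleftrightarrow> x$4 = 0 \<and> (0 < b * x$2 \<and> b * x$2 < sqrt 2 / 2 \<or> b * x$2 = sqrt 2 / 2) \<and> (x$3 > 0 \<or> x$3 < 0) \<or>
        x$2 = 0 \<and> (x$4 > 0 \<or> x$4 < 0) \<or> x$2 = 0 \<and> x$4 = 0 \<and> (x$3 > 0 \<or> x$3 < 0)"
        unfolding Surf_def Double_arc_def Half_circle_def Pinch_def Pole_def using x True by auto
      also have "\<dots> \<longleftrightarrow> x$4 = 0 \<and> 0 < b * x$2 \<and> (x$2)\<^sup>2 \<le> 1/2 \<and> x$3 \<noteq> 0 \<or>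
        x$2 = 0 \<and> (x$4 \<noteq> 0 \<or> x$3 \<noteq> 0)"
        unfolding r t by blast
      finally show ?thesis .
    qed
    have "x$2 = 0 \<Longrightarrow> x$4 \<noteq> 0 \<or> x$3 \<noteq> 0" "x$4 = 0 \<Longrightarrow> (x$2)\<^sup>2 \<le> 1/2 \<Longrightarrow> x$3 \<noteq> 0" using n by auto
    then show ?thesis unfolding L R by blast
  qed
  moreover have "\<Union>{Surf a b, Double_arc b 1, Double_arc b (-1), Half_circle 1, Half_circle (-1),
      Pinch b 1, Pinch b (-1), Pole 1, Pole (-1)} \<subseteq> Sphere3"
    unfolding Surf_def Double_arc_def Half_circle_def Pinch_def Pole_def by auto
  ultimately show ?thesis unfolding closure_Surf_eq[OF a b] by blast
qed

lemma closure_Definite_cell_strata: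
  assumes a: "\<bar>a\<bar> = 1"
  shows "closure (Definite_cell a) = Definite_cell a \<union> closure (Surf a 1) \<union> closure (Surf a (-1))"
proof -
  have "gap x \<ge> 0 \<and> a * x$1 \<ge> 0 \<longleftrightarrow> gap x > 0 \<and> a * x$1 > 0 \<or> gap x = 0 \<and> a * x$1 \<ge> 0" for x
  proof -
    have "gap x > 0 \<Longrightarrow> a * x$1 \<noteq> 0" using gap_pos_imp[of x] a by auto
    then show ?thesis by linarith
  qed
  then have "{x \<in> Sphere3. gap x \<ge> 0 \<and> a * x$1 \<ge> 0} =
      {x \<in> Sphere3. gap x > 0 \<and> a * x$1 > 0} \<union> {x \<in> Sphere3. gap x = 0 \<and> a * x$1 \<ge> 0}" by blast
  moreover have "closure (Surf a 1) \<union> closure (Surf a (-1)) = {x \<in> Sphere3. gap x = 0 \<and> a * x$1 \<ge> 0}"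
  proof -
    have "x$2 \<ge> 0 \<or> - x$2 \<ge> 0" for x :: "real^4" by linarith
    then show ?thesis using a by (simp add: closure_Surf_eq) blast
  qed
  ultimately show ?thesis
    unfolding closure_Definite_cell_eq[OF a] unfolding Definite_cell_def Un_assoc by simp
qed

lemma closure_Mixed_cell_strata:
  assumes b: "\<bar>b\<bar> = 1"
  shows "closure (Mixed_cell b) = Mixed_cell b \<union> closure (Surf 1 b) \<union> closure (Surf (-1) b)"
proof -
  have "gap x \<le> 0 \<and> b * x$2 \<ge> 0 \<longleftrightarrow> gap x < 0 \<and> b * x$2 > 0 \<or> gap x = 0 \<and> b * x$2 \<ge> 0" for x
  proof -
    have "gap x < 0 \<Longrightarrow> b * x$2 \<noteq> 0" using gap_neg_imp[of x] b by auto
    then show ?thesis by linarith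
  qed
  then have "{x \<in> Sphere3. gap x \<le> 0 \<and> b * x$2 \<ge> 0} =
      {x \<in> Sphere3. gap x < 0 \<and> b * x$2 > 0} \<union> {x \<in> Sphere3. gap x = 0 \<and> b * x$2 \<ge> 0}" by blast
  moreover have "closure (Surf 1 b) \<union> closure (Surf (-1) b) = {x \<in> Sphere3. gap x = 0 \<and> b * x$2 \<ge> 0}"
  proof -
    have "x$1 \<ge> 0 \<or> - x$1 \<ge> 0" for x :: "real^4" by linarith
    then show ?thesis using b by (simp add: closure_Surf_eq) blast
  qed
  ultimately show ?thesis
    unfolding closure_Mixed_cell_eq[OF b] unfolding Mixed_cell_def Un_assoc by simp
qed

lemma closure_Double_arc_strata:
  assumes b: "\<bar>b\<bar> = 1" and c: "\<bar>c\<bar> = 1"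
  shows "closure (Double_arc b c) = \<Union>{Double_arc b c, Pinch b c, Pole c}"
proof -
  have eq: "0 \<le> b * x$2 \<and> b * x$2 \<le> sqrt 2 / 2 \<and> 0 \<le> c * x$3 \<longleftrightarrow>
    (0 < b * x$2 \<and> b * x$2 < sqrt 2 / 2 \<or> b * x$2 = sqrt 2 / 2 \<or> x$2 = 0) \<and> c * x$3 > 0"
    if x: "x \<in> Sphere3" "x$1 = 0" "x$4 = 0" for x
  proof -
    have n: "(x$2)\<^sup>2 + (x$3)\<^sup>2 = 1" using x by (simp add: norm_4_eq_1)
    have "0 \<le> b * x$2 \<Longrightarrow> b * x$2 \<le> sqrt 2 / 2 \<Longrightarrow> c * x$3 \<noteq> 0"
    proof
      assume h: "0 \<le> b * x$2" "b * x$2 \<le> sqrt 2 / 2" "c * x$3 = 0"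
      have "(x$2)\<^sup>2 = (b * x$2)\<^sup>2" unfolding power_mult_distrib power2_eq_square[of b] sign_square[OF b] by simp
      also have "\<dots> \<le> (sqrt 2 / 2)\<^sup>2" using h by (intro power_mono)
      finally have "(x$2)\<^sup>2 \<le> 1/2" unfolding half_sqrt2(1) .
      moreover have "x$3 = 0" using h c by auto
      ultimately show False using n by simp
    qed
    moreover have "b * x$2 = 0 \<longleftrightarrow> x$2 = 0" using b by auto
    moreover have "0 \<le> p \<and> p \<le> h \<and> 0 \<le> q \<longleftrightarrow> (0 < p \<and> p < h \<or> p = h \<or> z) \<and> q > 0"
      if "0 \<le> p \<Longrightarrow> p \<le> h \<Longrightarrow> q \<noteq> 0" "p = 0 \<longleftrightarrow> z" "h > 0" for p q h :: real and z
      using that by (smt (verit))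
    ultimately show ?thesis using half_sqrt2(2) by presburger
  qed
  show ?thesis
  proof (rule set_eqI)
    fix x
    show "x \<in> closure (Double_arc b c) \<longleftrightarrow> x \<in> \<Union>{Double_arc b c, Pinch b c, Pole c}"
    proof (cases "x \<in> Sphere3 \<and> x$1 = 0 \<and> x$4 = 0")
      case True
      then have x: "x \<in> Sphere3" "x$1 = 0" "x$4 = 0" by auto
      have "x \<in> closure (Double_arc b c) \<longleftrightarrow> 0 \<le> b * x$2 \<and> b * x$2 \<le> sqrt 2 / 2 \<and> 0 \<le> c * x$3" using x by (simp add: closure_Double_arc_eq[OF b c])
      also note eq[OF x]
      also have "(0 < b * x$2 \<and> b * x$2 < sqrt 2 / 2 \<or> b * x$2 = sqrt 2 / 2 \<or> x$2 = 0) \<and> c * x$3 > 0 \<longleftrightarrow> x \<in> \<Union>{Double_arc b c, Pinch b c, Pole c}"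
        using x unfolding Double_arc_def Pinch_def Pole_def by auto
      finally show ?thesis .
    next
      case False
      then show ?thesis
        unfolding closure_Double_arc_eq[OF b c] unfolding Double_arc_def Pinch_def Pole_def Union_insert Union_empty Un_iff mem_Collect_eq empty_iff by blast
    qed
  qed
qed

lemma closure_Half_circle_strata:
  assumes d: "\<bar>d\<bar> = 1"
  shows "closure (Half_circle d) = \<Union>{Half_circle d, Pole 1, Pole (-1)}"
proof -
  have eq: "0 \<le> d * x$4 \<longleftrightarrow> d * x$4 > 0 \<or> x$4 = 0 \<and> (1 * x$3 > 0 \<or> -1 * x$3 > 0)"
    if x: "x \<in> Sphere3" "x$1 = 0" "x$2 = 0" for x
  proof -
    have n: "(x$3)\<^sup>2 + (x$4)\<^sup>2 = 1" using x by (simp add: norm_4_eq_1)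
    have "d * x$4 = 0 \<longleftrightarrow> x$4 = 0" using d by auto
    moreover have "x$4 = 0 \<Longrightarrow> x$3 \<noteq> 0" using n by auto
    moreover have "0 \<le> p \<longleftrightarrow> p > 0 \<or> z \<and> (1 * q > 0 \<or> -1 * q > 0)"
      if "p = 0 \<longleftrightarrow> z" "z \<Longrightarrow> q \<noteq> 0" for p q :: real and z
      using that by (smt (verit))
    ultimately show ?thesis by presburger
  qed
  show ?thesis
  proof (rule set_eqI)
    fix x
    show "x \<in> closure (Half_circle d) \<longleftrightarrow> x \<in> \<Union>{Half_circle d, Pole 1, Pole (-1)}"
    proof (cases "x \<in> Sphere3 \<and> x$1 = 0 \<and> x$2 = 0")
      case True
      then have x: "x \<in> Sphere3" "x$1 = 0" "x$2 = 0" by auto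
      have "x \<in> closure (Half_circle d) \<longleftrightarrow> 0 \<le> d * x$4" using x by (simp add: closure_Half_circle_eq[OF d])
      also note eq[OF x]
      also have "d * x$4 > 0 \<or> x$4 = 0 \<and> (1 * x$3 > 0 \<or> -1 * x$3 > 0) \<longleftrightarrow> x \<in> \<Union>{Half_circle d, Pole 1, Pole (-1)}"
        using x unfolding Half_circle_def Pole_def by auto
      finally show ?thesis .
    next
      case False
      then show ?thesis
        unfolding closure_Half_circle_eq[OF d] unfolding Half_circle_def Pole_def Union_insert Union_empty Un_iff mem_Collect_eq empty_iff by blast
    qed
  qed
qed

lemma closure_points: "closure (Pinch 1 1) = Pinch 1 1" "closure (Pinch (-1) 1) = Pinch (-1) 1"
  "closure (Pinch 1 (-1)) = Pinch 1 (-1)" "closure (Pinch (-1) (-1)) = Pinch (-1) (-1)"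
  "closure (Pole 1) = Pole 1" "closure (Pole (-1)) = Pole (-1)"
  by (simp_all add: Pinch_eq Pole_eq)

lemma strata_closures:
  "closure V1 = \<Union>{V1, S1, S4, L1, L2, L3, L4, L5, L6, P1, P2, P3, P4, P5, P6}"
  "closure V2 = \<Union>{V2, S1, S3, L1, L3, L5, L6, P1, P3, P5, P6}"
  "closure V3 = \<Union>{V3, S3, S2, L1, L2, L3, L4, L5, L6, P1, P2, P3, P4, P5, P6}"
  "closure V4 = \<Union>{V4, S2, S4, L2, L4, L5, L6, P2, P4, P5, P6}"
  "closure S1 = \<Union>{S1, L1, L3, L5, L6, P1, P3, P5, P6}"
  "closure S2 = \<Union>{S2, L2, L4, L5, L6, P2, P4, P5, P6}"
  "closure S3 = \<Union>{S3, L1, L3, L5, L6, P1, P3, P5, P6}"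
  "closure S4 = \<Union>{S4, L2, L4, L5, L6, P2, P4, P5, P6}"
  "closure L1 = \<Union>{L1, P1, P5}" "closure L2 = \<Union>{L2, P2, P5}"
  "closure L3 = \<Union>{L3, P3, P6}" "closure L4 = \<Union>{L4, P4, P6}"
  "closure L5 = \<Union>{L5, P5, P6}" "closure L6 = \<Union>{L6, P5, P6}"
  "closure P1 = \<Union>{P1}" "closure P2 = \<Union>{P2}" "closure P3 = \<Union>{P3}"
  "closure P4 = \<Union>{P4}" "closure P5 = \<Union>{P5}" "closure P6 = \<Union>{P6}"
  unfolding V_eqs S_eqs L_eqs P_eqs closure_points
  by (simp_all add: closure_Definite_cell_strata closure_Mixed_cell_strata closure_Surf_strata
      closure_Double_arc_strata closure_Half_circle_strata Un_ac)

lemma empty_notin_strata: "{} \<notin> strata"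
proof -
  have P: "P1 \<noteq> {}" "P2 \<noteq> {}" "P3 \<noteq> {}" "P4 \<noteq> {}" "P5 \<noteq> {}" "P6 \<noteq> {}"
    by (simp_all add: P1_def P2_def P3_def P4_def P5_def P6_def)
  have ne: "X \<noteq> {}" if "closure X = \<Union>\<D>" "P5 \<in> \<D> \<or> P6 \<in> \<D>" for X \<D>
    using that P(5,6) by auto
  have "V1 \<noteq> {}" "V2 \<noteq> {}" "V3 \<noteq> {}" "V4 \<noteq> {}" "S1 \<noteq> {}" "S2 \<noteq> {}" "S3 \<noteq> {}" "S4 \<noteq> {}"
    "L1 \<noteq> {}" "L2 \<noteq> {}" "L3 \<noteq> {}" "L4 \<noteq> {}" "L5 \<noteq> {}" "L6 \<noteq> {}"
    by (rule ne, rule strata_closures, simp)+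
  with P show ?thesis unfolding strata_def critical_strata_def by auto
qed

lemma disjoint_strata: "X \<in> strata \<Longrightarrow> Y \<in> strata \<Longrightarrow> X \<inter> Y \<noteq> {} \<Longrightarrow> X = Y"
proof -
  assume X: "X \<in> strata" and Y: "Y \<in> strata" and ne: "X \<inter> Y \<noteq> {}"
  obtain s t where "X = {x \<in> Sphere3. signature x = s}" "Y = {x \<in> Sphere3. signature x = t}"
    using strata_fibre X Y by meson
  then show "X = Y" using ne by auto
qed

text \<open>
  Strata are nonempty and disjoint, so a stratum inside a union of strata is one of them.
\<close>

lemma mem_of_subset_Union_strata:
  assumes "X \<in> strata" "\<D> \<subseteq> strata" "X \<subseteq> \<Union>\<D>"
  shows "X \<in> \<D>"
proof -
  obtain x where "x \<in> X" using assms(1) empty_notin_strata by (metis equals0I)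
  then obtain Z where "Z \<in> \<D>" "x \<in> Z" using assms(3) by blast
  then have "X = Z" using assms(1,2) \<open>x \<in> X\<close> by (intro disjoint_strata) auto
  then show ?thesis using \<open>Z \<in> \<D>\<close> by simp
qed

lemma strata_members:
  "V1 \<in> strata" "V2 \<in> strata" "V3 \<in> strata" "V4 \<in> strata"
  "S1 \<in> strata" "S2 \<in> strata" "S3 \<in> strata" "S4 \<in> strata"
  "L1 \<in> strata" "L2 \<in> strata" "L3 \<in> strata" "L4 \<in> strata" "L5 \<in> strata" "L6 \<in> strata"
  "P1 \<in> strata" "P2 \<in> strata" "P3 \<in> strata" "P4 \<in> strata" "P5 \<in> strata" "P6 \<in> strata"
  by (simp_all add: strata_def critical_strata_def)

lemma faces:
  assumes "X \<in> strata"
  shows "X \<subseteq> closure V1 \<longleftrightarrow> X \<in> {V1, S1, S4, L1, L2, L3, L4, L5, L6, P1, P2, P3, P4, P5, P6}"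
    "X \<subseteq> closure V2 \<longleftrightarrow> X \<in> {V2, S1, S3, L1, L3, L5, L6, P1, P3, P5, P6}"
    "X \<subseteq> closure V3 \<longleftrightarrow> X \<in> {V3, S3, S2, L1, L2, L3, L4, L5, L6, P1, P2, P3, P4, P5, P6}"
    "X \<subseteq> closure V4 \<longleftrightarrow> X \<in> {V4, S2, S4, L2, L4, L5, L6, P2, P4, P5, P6}"
    "X \<subseteq> closure S1 \<longleftrightarrow> X \<in> {S1, L1, L3, L5, L6, P1, P3, P5, P6}"
    "X \<subseteq> closure S2 \<longleftrightarrow> X \<in> {S2, L2, L4, L5, L6, P2, P4, P5, P6}"
    "X \<subseteq> closure S3 \<longleftrightarrow> X \<in> {S3, L1, L3, L5, L6, P1, P3, P5, P6}"
    "X \<subseteq> closure S4 \<longleftrightarrow> X \<in> {S4, L2, L4, L5, L6, P2, P4, P5, P6}"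
    "X \<subseteq> closure L1 \<longleftrightarrow> X \<in> {L1, P1, P5}" "X \<subseteq> closure L2 \<longleftrightarrow> X \<in> {L2, P2, P5}"
    "X \<subseteq> closure L3 \<longleftrightarrow> X \<in> {L3, P3, P6}" "X \<subseteq> closure L4 \<longleftrightarrow> X \<in> {L4, P4, P6}"
    "X \<subseteq> closure L5 \<longleftrightarrow> X \<in> {L5, P5, P6}" "X \<subseteq> closure L6 \<longleftrightarrow> X \<in> {L6, P5, P6}"
    "X \<subseteq> closure P1 \<longleftrightarrow> X \<in> {P1}" "X \<subseteq> closure P2 \<longleftrightarrow> X \<in> {P2}" "X \<subseteq> closure P3 \<longleftrightarrow> X \<in> {P3}"
    "X \<subseteq> closure P4 \<longleftrightarrow> X \<in> {P4}" "X \<subseteq> closure P5 \<longleftrightarrow> X \<in> {P5}" "X \<subseteq> closure P6 \<longleftrightarrow> X \<in> {P6}"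
  unfolding strata_closures
  by (rule iffI, rule mem_of_subset_Union_strata[OF assms], simp add: strata_members, assumption,
      rule Union_upper, assumption)+

lemma stratum_dimension:
  "X \<in> strata \<Longrightarrow> smooth_submanifold d X \<Longrightarrow> smooth_submanifold n X \<longleftrightarrow> n = d"
  using smooth_submanifold_dim_unique empty_notin_strata by metis

lemma strata_dimensions:
  "smooth_submanifold n V1 \<longleftrightarrow> n = 3" "smooth_submanifold n V2 \<longleftrightarrow> n = 3"
  "smooth_submanifold n V3 \<longleftrightarrow> n = 3" "smooth_submanifold n V4 \<longleftrightarrow> n = 3"
  "smooth_submanifold n S1 \<longleftrightarrow> n = 2" "smooth_submanifold n S2 \<longleftrightarrow> n = 2"
  "smooth_submanifold n S3 \<longleftrightarrow> n = 2" "smooth_submanifold n S4 \<longleftrightarrow> n = 2"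
  "smooth_submanifold n L1 \<longleftrightarrow> n = 1" "smooth_submanifold n L2 \<longleftrightarrow> n = 1"
  "smooth_submanifold n L3 \<longleftrightarrow> n = 1" "smooth_submanifold n L4 \<longleftrightarrow> n = 1"
  "smooth_submanifold n L5 \<longleftrightarrow> n = 1" "smooth_submanifold n L6 \<longleftrightarrow> n = 1"
  "smooth_submanifold n P1 \<longleftrightarrow> n = 0" "smooth_submanifold n P2 \<longleftrightarrow> n = 0"
  "smooth_submanifold n P3 \<longleftrightarrow> n = 0" "smooth_submanifold n P4 \<longleftrightarrow> n = 0"
  "smooth_submanifold n P5 \<longleftrightarrow> n = 0" "smooth_submanifold n P6 \<longleftrightarrow> n = 0"
  by (rule stratum_dimension, rule strata_members,
      simp add: V_eqs S_eqs L_eqs P1_def P2_def P3_def P4_def P5_def P6_def smooth_submanifold_singleton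
        smooth_submanifold_cells smooth_submanifold_Surf
        smooth_submanifold_Double_arc[simplified] smooth_submanifold_Half_circle[simplified])+

section \<open>The stratification and its incidences\<close>

lemma locally_closed_strata:
  assumes "X \<in> strata"
  shows "\<exists>U K. open U \<and> closed K \<and> X = U \<inter> K"
proof -
  have lc: "\<exists>U K. open U \<and> closed K \<and> A = U \<inter> K"
    if "open {x. P x}" "closed {x. Q x}" "A = {x. P x} \<inter> {x. Q x}" for A :: "(real^4) set" and P Q
    using that by blast
  have V: "\<exists>U K. open U \<and> closed K \<and> Definite_cell a = U \<inter> K" "\<exists>U K. open U \<and> closed K \<and> Mixed_cell a = U \<inter> K" for a
    by (intro exI conjI, rule open_cells(1), rule closed_sphere, rule Definite_cell_open_in_sphere,
        intro exI conjI, rule open_cells(2), rule closed_sphere, rule Mixed_cell_open_in_sphere)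
  have S: "\<exists>U K. open U \<and> closed K \<and> Surf a b = U \<inter> K" for a b
  proof (rule lc)
    show "open {x::real^4. a * x$1 > 0 \<and> b * x$2 > 0}"
      by (intro open_Collect_conj open_Collect_less continuous_intros)
    show "closed {x \<in> Sphere3. gap x = 0}" by (intro closed_Collect_sphere closed_gap)
  qed (auto simp: Surf_def)
  have H: "\<exists>U K. open U \<and> closed K \<and> Double_arc b c = U \<inter> K" for b c
  proof (rule lc)
    show "open {x::real^4. 0 < b * x$2 \<and> b * x$2 < sqrt 2 / 2 \<and> c * x$3 > 0}"
      by (intro open_Collect_conj open_Collect_less continuous_intros)
    show "closed {x \<in> Sphere3. x$1 = 0 \<and> x$4 = 0}"
      by (intro closed_Collect_sphere closed_Collect_conj closed_Collect_eq continuous_intros)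
  qed (auto simp: Double_arc_def)
  have C: "\<exists>U K. open U \<and> closed K \<and> Half_circle d = U \<inter> K" for d
  proof (rule lc)
    show "open {x::real^4. d * x$4 > 0}" by (intro open_Collect_less continuous_intros)
    show "closed {x \<in> Sphere3. x$1 = 0 \<and> x$2 = 0}"
      by (intro closed_Collect_sphere closed_Collect_conj closed_Collect_eq continuous_intros)
  qed (auto simp: Half_circle_def)
  have P: "\<exists>U K. open U \<and> closed K \<and> {p} = U \<inter> K" for p :: "real^4"
    by (intro exI[of _ UNIV] exI[of _ "{p}"]) simp
  show ?thesis
    using assms by (rule strata_shape_induct) (simp_all only: Pinch_eq Pole_eq V S H C P)
qed

lemma tangents_approximable_strata:
  assumes X: "X \<in> strata" and Y: "Y \<in> strata" and XY: "X \<subseteq> closure Y"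
  shows "tangents_approximable X Y"
proof -
  have dimX: "\<exists>d. smooth_submanifold d X" if "X \<in> strata" for X
    using that by (rule strata_induct) (auto simp: strata_dimensions)
  have eq: "tangents_approximable X X" using dimX[OF X] tangents_approximable_refl by blast
  have sph: "X \<subseteq> Sphere3" using X sphere_eq_Union_strata by blast
  have V: "tangents_approximable X (Definite_cell a)" "tangents_approximable X (Mixed_cell a)" for a
    unfolding Definite_cell_open_in_sphere Mixed_cell_open_in_sphere
    by (intro tangents_approximable_open_in_sphere sph open_cells)+
  have P: "tangents_approximable X Y" if "X \<in> {P1, P2, P3, P4, P5, P6}"
    using that unfolding P1_def P2_def P3_def P4_def P5_def P6_def
    by (auto simp: tangents_approximable_singleton)
  have S: "tangents_approximable X (Surf a b)"
    if "X \<in> {Double_arc b 1, Double_arc b (-1), Half_circle 1, Half_circle (-1)}" "\<bar>b\<bar> = 1" for a b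
    using that tangents_approximable_Double_arc[OF that(2)] tangents_approximable_Half_circle by auto
  have "X \<subseteq> closure Y \<longrightarrow> Y \<in> {V1, V2, V3, V4} \<or> X = Y \<or> X \<in> {P1, P2, P3, P4, P5, P6} \<or>
      Y = S1 \<and> X \<in> {L1, L3, L5, L6} \<or> Y = S2 \<and> X \<in> {L2, L4, L5, L6} \<or>
      Y = S3 \<and> X \<in> {L1, L3, L5, L6} \<or> Y = S4 \<and> X \<in> {L2, L4, L5, L6}"
    using Y by (rule strata_induct) (auto simp: faces[OF X])
  from mp[OF this XY] show ?thesis
  proof (elim disjE conjE)
    assume "Y \<in> {V1, V2, V3, V4}"
    then show ?thesis using V unfolding V_eqs by auto
  next
    assume "X = Y"
    then show ?thesis using eq by simp
  next
    assume "X \<in> {P1, P2, P3, P4, P5, P6}"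
    then show ?thesis by (rule P)
  qed (use S[of 1] S[of "-1"] in \<open>simp_all add: S_eqs L_eqs\<close>)
qed

text \<open>
  The family is finite, and the remaining conditions concern single strata or pairs of strata, so every
  subfamily stratifies its union.
\<close>

lemma whitney_stratification_subfamily:
  assumes "\<C> \<subseteq> strata"
  shows "whitney_stratification (\<Union>\<C>) \<C>"
proof -
  have fin: "finite \<C>"
    using assms by (rule finite_subset) (simp add: strata_def critical_strata_def)
  have part: "partition_on (\<Union>\<C>) \<C>"
    using assms empty_notin_strata disjoint_strata unfolding partition_on_def disjoint_def by blast
  have sub: "\<exists>d. smooth_submanifold d X" if "X \<in> strata" for X
    using that by (rule strata_induct) (auto simp: strata_dimensions)
  have frontier: "X \<subseteq> closure Y" if X: "X \<in> strata" and Y: "Y \<in> strata" and XY: "X \<inter> closure Y \<noteq> {}" for X Y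
  proof -
    have "\<exists>\<D>. \<D> \<subseteq> strata \<and> closure Y = \<Union>\<D>"
      using Y by (rule strata_induct) (rule exI, rule conjI[rotated], rule strata_closures, simp add: strata_members)+
    then obtain \<D> where D: "\<D> \<subseteq> strata" "closure Y = \<Union>\<D>" by blast
    then obtain Z where "Z \<in> \<D>" "X \<inter> Z \<noteq> {}" using XY D(2) by auto
    then have "X = Z" using disjoint_strata D(1) X by blast
    then show ?thesis using D(2) \<open>Z \<in> \<D>\<close> by blast
  qed
  have "stratification (\<Union>\<C>) \<C>"
    unfolding stratification_def
  proof (intro conjI ballI impI)
    show "partition_on (\<Union>\<C>) \<C>" by (rule part)
    show "locally_finite_in (top_of_set (\<Union>\<C>)) \<C>" using fin by (intro finite_imp_locally_finite_in) auto
    fix X assume "X \<in> \<C>"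
    then have X: "X \<in> strata" using assms by blast
    show "\<exists>U K. open U \<and> closed K \<and> X = U \<inter> K" by (rule locally_closed_strata[OF X])
    show "\<exists>d. smooth_submanifold d X" by (rule sub[OF X])
    show "X \<subseteq> closure Y" if "Y \<in> \<C>" "X \<inter> closure Y \<noteq> {}" for Y
      using frontier[OF X _ that(2)] that(1) assms by blast
  qed
  then show ?thesis
    unfolding whitney_stratification_def
    using tangents_approximable_imp_tangency[OF tangents_approximable_strata] assms by blast
qed

lemma whitney_stratification_strata: "whitney_stratification Sphere3 strata"
  using whitney_stratification_subfamily[of strata] sphere_eq_Union_strata by simp

lemma whitney_stratification_critical_strata:
  "whitney_stratification (critical_surface - handles) critical_strata"
proof -
  have "\<Union>critical_strata = closure S1 \<union> closure S2 \<union> closure S3 \<union> closure S4"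
    unfolding strata_closures critical_strata_def by auto
  also have "\<dots> = {x \<in> Sphere3. gap x = 0}"
  proof -
    have "(x$1 \<ge> 0 \<or> x$1 \<le> 0) \<and> (x$2 \<ge> 0 \<or> x$2 \<le> 0)" for x :: "real^4" by linarith
    then show ?thesis unfolding S_eqs by (auto simp: closure_Surf_eq)
  qed
  finally have "critical_surface - handles = \<Union>critical_strata"
    by (simp only: critical_surface_minus_handles)
  moreover have "critical_strata \<subseteq> strata" by (auto simp: strata_def)
  ultimately show ?thesis using whitney_stratification_subfamily by simp
qed

lemma incidences_strata:
  "incidences 0 strata =
     {(P1, L1), (P5, L1), (P2, L2), (P5, L2), (P3, L3), (P6, L3), (P4, L4), (P6, L4),
      (P5, L5), (P6, L5), (P5, L6), (P6, L6)}"
  "incidences 1 strata =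
     {L1, L3} \<times> {S1, S3} \<union> {L2, L4} \<times> {S2, S4} \<union> {L5, L6} \<times> {S1, S2, S3, S4}"
  "incidences 2 strata =
     {S1, S4} \<times> {V1} \<union> {S1, S3} \<times> {V2} \<union> {S2, S3} \<times> {V3} \<union> {S2, S4} \<times> {V4}"
proof -
  have inc: "(X, Y) \<in> incidences n strata \<longleftrightarrow> X \<in> strata \<and> Y \<in> strata \<and>
      smooth_submanifold n X \<and> smooth_submanifold m Y \<and> X \<subseteq> closure Y" if "m = Suc n" for X Y n m
    using that by (simp add: incidences_def incident_def)
  have times: "A \<times> B \<subseteq> I" if "\<forall>X\<in>A. \<forall>Y\<in>B. (X, Y) \<in> I" for A B :: "'z set" and I
    using that by blast
  have suc: "1 = Suc 0" "2 = Suc 1" "3 = Suc 2" by simp_all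
  show "incidences 0 strata = 
     {(P1, L1), (P5, L1), (P2, L2), (P5, L2), (P3, L3), (P6, L3), (P4, L4), (P6, L4),
      (P5, L5), (P6, L5), (P5, L6), (P6, L6)}" (is "_ = ?R")
  proof -
    have 1: "(X, Y) \<in> ?R" if X: "X \<in> strata" and Y: "Y \<in> strata"
      and dX: "smooth_submanifold 0 X" and dY: "smooth_submanifold 1 Y" and XY: "X \<subseteq> closure Y" for X Y
    proof -
      have "smooth_submanifold 1 Y \<longrightarrow> X \<subseteq> closure Y \<longrightarrow> (X, Y) \<in> ?R"
        using Y by (rule strata_induct; intro impI; simp only: faces[OF X]; (simp add: strata_dimensions; fail)?;
          elim insertE emptyE; insert dX; simp add: strata_dimensions)
      from mp[OF mp[OF this dY] XY] show ?thesis .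
    qed
    show ?thesis
    proof
      show "incidences 0 strata \<subseteq> ?R"
      proof (rule subrelI)
        fix X Y assume "(X, Y) \<in> incidences 0 strata"
        from inc[OF suc(1), THEN iffD1, OF this] show "(X, Y) \<in> ?R"
          by (elim conjE) (rule 1)
      qed
      show "?R \<subseteq> incidences 0 strata"
        by (simp add: inc[OF suc(1)] strata_members faces strata_dimensions)
    qed
  qed
  show "incidences 1 strata = 
     {L1, L3} \<times> {S1, S3} \<union> {L2, L4} \<times> {S2, S4} \<union> {L5, L6} \<times> {S1, S2, S3, S4}" (is "_ = ?R")
  proof -
    have 1: "(X, Y) \<in> ?R" if X: "X \<in> strata" and Y: "Y \<in> strata"
      and dX: "smooth_submanifold 1 X" and dY: "smooth_submanifold 2 Y" and XY: "X \<subseteq> closure Y" for X Y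
    proof -
      have "smooth_submanifold 2 Y \<longrightarrow> X \<subseteq> closure Y \<longrightarrow> (X, Y) \<in> ?R"
        using Y by (rule strata_induct; intro impI; simp only: faces[OF X]; (simp add: strata_dimensions; fail)?;
          elim insertE emptyE; insert dX; simp add: strata_dimensions)
      from mp[OF mp[OF this dY] XY] show ?thesis .
    qed
    show ?thesis
    proof
      show "incidences 1 strata \<subseteq> ?R"
      proof (rule subrelI)
        fix X Y assume "(X, Y) \<in> incidences 1 strata"
        from inc[OF suc(2), THEN iffD1, OF this] show "(X, Y) \<in> ?R"
          by (elim conjE) (rule 1)
      qed
      show "?R \<subseteq> incidences 1 strata"
        by (intro Un_least times; simp add: inc[OF suc(2)] strata_members faces strata_dimensions del: One_nat_def)
    qed
  qed
  show "incidences 2 strata = 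
     {S1, S4} \<times> {V1} \<union> {S1, S3} \<times> {V2} \<union> {S2, S3} \<times> {V3} \<union> {S2, S4} \<times> {V4}" (is "_ = ?R")
  proof -
    have 1: "(X, Y) \<in> ?R" if X: "X \<in> strata" and Y: "Y \<in> strata"
      and dX: "smooth_submanifold 2 X" and dY: "smooth_submanifold 3 Y" and XY: "X \<subseteq> closure Y" for X Y
    proof -
      have "smooth_submanifold 3 Y \<longrightarrow> X \<subseteq> closure Y \<longrightarrow> (X, Y) \<in> ?R"
        using Y by (rule strata_induct; intro impI; simp only: faces[OF X]; (simp add: strata_dimensions; fail)?;
          elim insertE emptyE; insert dX; simp add: strata_dimensions)
      from mp[OF mp[OF this dY] XY] show ?thesis .
    qed
    show ?thesis
    proof
      show "incidences 2 strata \<subseteq> ?R"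
      proof (rule subrelI)
        fix X Y assume "(X, Y) \<in> incidences 2 strata"
        from inc[OF suc(3), THEN iffD1, OF this] show "(X, Y) \<in> ?R"
          by (elim conjE) (rule 1)
      qed
      show "?R \<subseteq> incidences 2 strata"
        by (intro Un_least times; simp add: inc[OF suc(3)] strata_members faces strata_dimensions)
    qed
  qed
qed

section \<open>Characteristic polynomials and eigenvectors\<close>

lemma det_4:
  fixes A :: "'a::comm_ring_1^4^4"
  shows "det A =
    A$1$1 * (A$2$2 * (A$3$3 * A$4$4 - A$3$4 * A$4$3) - A$2$3 * (A$3$2 * A$4$4 - A$3$4 * A$4$2) + A$2$4 * (A$3$2 * A$4$3 - A$3$3 * A$4$2))
  - A$1$2 * (A$2$1 * (A$3$3 * A$4$4 - A$3$4 * A$4$3) - A$2$3 * (A$3$1 * A$4$4 - A$3$4 * A$4$1) + A$2$4 * (A$3$1 * A$4$3 - A$3$3 * A$4$1))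
  + A$1$3 * (A$2$1 * (A$3$2 * A$4$4 - A$3$4 * A$4$2) - A$2$2 * (A$3$1 * A$4$4 - A$3$4 * A$4$1) + A$2$4 * (A$3$1 * A$4$2 - A$3$2 * A$4$1))
  - A$1$4 * (A$2$1 * (A$3$2 * A$4$3 - A$3$3 * A$4$2) - A$2$2 * (A$3$1 * A$4$3 - A$3$3 * A$4$1) + A$2$3 * (A$3$1 * A$4$2 - A$3$2 * A$4$1))"
proof -
  have f1234: "finite {2::4, 3, 4}" "1 \<notin> {2::4, 3, 4}" by auto
  have f234: "finite {3::4, 4}" "2 \<notin> {3::4, 4}" by auto
  have f34: "finite {4::4}" "3 \<notin> {4::4}" by auto
  show ?thesis
    unfolding det_def UNIV_4
    unfolding sum_over_permutations_insert[OF f1234]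
    unfolding sum_over_permutations_insert[OF f234]
    unfolding sum_over_permutations_insert[OF f34]
    unfolding permutes_sing
    by (simp add: sign_swap_id permutation_swap_id permutation_compose sign_compose sign_id swap_id_eq algebra_simps)
qed

lemma poly_charpoly: "poly (charpoly A) x = det (mat x - A)"
proof -
  let ?M = "\<chi> i j. (if i = j then [:0, 1:] else 0) - [:A$i$j:]"
  have "poly (det ?M) x = (\<Sum>p | p permutes UNIV. of_int (sign p) * (\<Prod>i\<in>UNIV. poly (?M$i$p i) x))"
    unfolding det_def by (simp add: poly_sum poly_prod)
  also have "\<dots> = det (mat x - A)"
    unfolding det_def by (intro sum.cong refl arg_cong2[where f = "(*)"] prod.cong) (auto simp: mat_def)
  finally show ?thesis by (simp add: charpoly_def)
qed

lemma eigenvalue_iff_root: "eigenvalue A x \<longleftrightarrow> poly (charpoly A) x = 0" for A :: "complex^'n^'n"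
proof -
  have v: "(mat x - A) *v v = x *s v - A *v v" for v :: "complex^'n"
  proof -
    have "mat x *v v = x *s v"
      by (simp add: matrix_vector_mult_def mat_def vec_eq_iff if_distrib if_distribR cong: if_cong)
    then show ?thesis by (simp add: matrix_vector_mult_diff_rdistrib)
  qed
  have "eigenvalue A x \<longleftrightarrow> \<not> (\<forall>v. (mat x - A) *v v = 0 \<longrightarrow> v = 0)"
    unfolding eigenvalue_def v by (auto simp: eq_commute[of "A *v _"])
  also have "\<dots> \<longleftrightarrow> \<not> invertible (mat x - A)"
    by (simp add: invertible_left_inverse matrix_left_invertible_ker)
  also have "\<dots> \<longleftrightarrow> poly (charpoly A) x = 0"
    by (simp add: invertible_det_nz poly_charpoly)
  finally show ?thesis .
qed

text \<open>
  Applying \<open>A - l k\<close> removes the term of index \<open>k\<close> and scales the others by the nonzero factors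
  \<open>l i - l k\<close>; induction on the index set then applies.
\<close>

lemma eigenvectors_sum_zero:
  fixes A :: "complex^'n^'n"
  assumes "finite I" "inj_on l I" "\<And>i. i \<in> I \<Longrightarrow> A *v v i = l i *s v i" "(\<Sum>i\<in>I. v i) = 0" "i \<in> I"
  shows "v i = 0"
  using assms
proof (induction I arbitrary: v i rule: finite_induct)
  case empty
  then show ?case by simp
next
  case (insert k I)
  have eq: "v k = - (\<Sum>i\<in>I. v i)" using insert by (simp add: eq_neg_iff_add_eq_0)
  let ?w = "\<lambda>i. (l i - l k) *s v i"
  have zero: "?w i = 0" if "i \<in> I" for i
  proof (rule insert.IH[of ?w])
    show "inj_on l I" using insert.prems by auto
    show "A *v ?w j = l j *s ?w j" if "j \<in> I" for j
    proof -
      have "A *v ?w j = (l j - l k) *s (A *v v j)" by (rule vec.scale)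
      also have "A *v v j = l j *s v j" using insert.prems(2) that by simp
      also have "(l j - l k) *s (l j *s v j) = l j *s ?w j" by (rule vec.scale_left_commute)
      finally show ?thesis .
    qed
    show "(\<Sum>i\<in>I. ?w i) = 0"
    proof -
      have "(\<Sum>i\<in>I. ?w i) = (\<Sum>i\<in>I. l i *s v i) - l k *s (\<Sum>i\<in>I. v i)"
        by (simp add: vec.scale_left_diff_distrib sum_subtractf vec.scale_sum_right)
      also have "(\<Sum>i\<in>I. l i *s v i) = (\<Sum>i\<in>I. A *v v i)" using insert.prems(2) by (intro sum.cong) auto
      also have "\<dots> = A *v (\<Sum>i\<in>I. v i)" by (simp add: vec.sum)
      also have "(\<Sum>i\<in>I. v i) = - v k" using eq by simp
      also have "A *v (- v k) = - (l k *s v k)" using insert.prems(2)[of k]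
        by (simp add: vec.neg)
      finally show ?thesis by (simp add: vec.scale_minus_right)
    qed
  qed fact
  have vI: "v i = 0" if "i \<in> I" for i
    using zero[OF that] insert.prems(1) insert.hyps(2) that by (auto simp: vec.scale_eq_0_iff inj_on_def)
  then have "v k = 0" using eq by simp
  then show ?case using vI insert.prems(4) by auto
qed

text \<open>
  Eigenvectors for \<open>CARD('n)\<close> different eigenvalues form a basis. Expanding an arbitrary eigenvector in it
  and comparing terms leaves only the multiples of one basis vector.
\<close>

lemma geom_mult_simple_spectrum:
  fixes A :: "complex^'n^'n"
  assumes inj: "inj l" and ev: "\<And>i::'n. eigenvalue A (l i)"
  shows "geom_mult A (l k) = 1"
proof -
  have "\<forall>i. \<exists>v. v \<noteq> 0 \<and> A *v v = l i *s v" using ev by (simp add: eigenvalue_def)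
  then obtain v where v: "\<And>i. v i \<noteq> 0" "\<And>i. A *v v i = l i *s v i" by metis
  have scale: "A *v (c *s v i) = l i *s (c *s v i)" for c i
    unfolding vec.scale v(2) by (rule vec.scale_left_commute)
  have injv: "inj v"
  proof (rule injI)
    fix i j assume ij: "v i = v j"
    have "l i *s v i = A *v v i" using v(2) by simp
    also have "\<dots> = l j *s v i" unfolding ij using v(2) by simp
    finally have "l i = l j" using v(1) by simp
    then show "i = j" using inj by (simp add: inj_eq)
  qed
  have indep: "vec.independent (range v)"
  proof
    assume "vec.dependent (range v)"
    then obtain c where c: "\<exists>x\<in>range v. c x \<noteq> 0" "(\<Sum>x\<in>range v. c x *s x) = 0"
      using vec.dependent_finite[of "range v"] by auto
    have "(\<Sum>i\<in>UNIV. c (v i) *s v i) = 0" using c(2) injv by (simp add: sum.reindex)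
    then have "c (v i) *s v i = 0" for i
      using eigenvectors_sum_zero[of UNIV l A "\<lambda>i. c (v i) *s v i" i] inj scale by auto
    then show False using c(1) v(1) by auto
  qed
  have "card (range v) = CARD('n)" using injv by (simp add: card_image)
  then have span: "vec.span (range v) = UNIV"
    using vec.card_ge_dim_independent[of "range v" UNIV] indep
    unfolding vec_dim_card by auto
  have "{u. A *v u = l k *s u} = vec.span {v k}"
  proof
    show "vec.span {v k} \<subseteq> {u. A *v u = l k *s u}"
      using scale by (auto simp: vec.span_singleton)
    show "{u. A *v u = l k *s u} \<subseteq> vec.span {v k}"
    proof
      fix u assume u: "u \<in> {u. A *v u = l k *s u}"
      have "u \<in> vec.span (range v)" using span by simp
      then obtain c where "u = (\<Sum>x\<in>range v. c x *s x)" by (auto simp: vec.span_finite)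
      then have c: "u = (\<Sum>i\<in>UNIV. c (v i) *s v i)" using injv by (simp add: sum.reindex)
      define w where "w i = (if i = k then c (v k) *s v k - u else c (v i) *s v i)" for i
      have "w k = 0"
      proof (rule eigenvectors_sum_zero[of UNIV l A w])
        show "A *v w i = l i *s w i" for i
          using scale u by (auto simp: w_def vec.diff vec.scale_right_diff_distrib)
        have "(\<Sum>i\<in>UNIV. w i) = (\<Sum>i\<in>UNIV. c (v i) *s v i - (if i = k then u else 0))"
          by (intro sum.cong) (auto simp: w_def)
        then show "(\<Sum>i\<in>UNIV. w i) = 0" using c by (simp add: sum_subtractf)
      qed (use inj in auto)
      then have "u = c (v k) *s v k" by (simp add: w_def)
      then show "u \<in> vec.span {v k}" by (auto simp: vec.span_singleton)
    qed
  qed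
  moreover have "vec.independent {v k}" using v(1) by (simp add: vec.dependent_single)
  ultimately show ?thesis unfolding geom_mult_def by (simp add: vec.dim_span_eq_card_independent)
qed

lemma eigenvalue_iff_mem: "charpoly A \<noteq> 0 \<Longrightarrow> eigenvalue A x \<longleftrightarrow> x \<in># eigenvalues A"
  by (simp add: eigenvalue_iff_root eigenvalues_def)

lemma image_mset_4: "image_mset l (mset_set (UNIV :: 4 set)) = {#l 1, l 2, l 3, l 4#}"
  unfolding UNIV_4 by simp

text \<open>
  An enumeration of \<open>{#a, cnj a, b, cnj b#}\<close> by the index type, as \<open>same_configuration\<close> asks for.
\<close>

definition conjugate_pairs :: "complex \<Rightarrow> complex \<Rightarrow> 4 \<Rightarrow> complex" where
  "conjugate_pairs a b = (\<lambda>i. if i = 1 then a else if i = 2 then cnj a else if i = 3 then b else cnj b)"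

lemma image_conjugate_pairs: "image_mset (conjugate_pairs a b) (mset_set UNIV) = {#a, cnj a, b, cnj b#}"
  by (simp add: image_mset_4 conjugate_pairs_def)

lemma different_pairs_simple:
  assumes "different_pairs A p q"
  obtains a b where "image_mset (conjugate_pairs a b) (mset_set UNIV) = eigenvalues A" "Im a \<noteq> 0" "Im b \<noteq> 0"
    "sgn (Re a) = p" "sgn (Re b) = q"
    "\<And>i. alg_mult A (conjugate_pairs a b i) = 1" "\<And>i. geom_mult A (conjugate_pairs a b i) = 1"
proof -
  obtain a b where ab: "eigenvalues A = {#a, cnj a, b, cnj b#}" "Im a \<noteq> 0" "Im b \<noteq> 0"
    "{a, cnj a} \<noteq> {b, cnj b}" "sgn (Re a) = p" "sgn (Re b) = q"
    using assms unfolding different_pairs_def by blast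
  have ne: "a \<noteq> cnj a" "b \<noteq> cnj b" "a \<noteq> b" "a \<noteq> cnj b" "cnj a \<noteq> b" "cnj a \<noteq> cnj b"
    using ab by (auto simp: complex_eq_iff)
  have inj: "inj (conjugate_pairs a b)"
    unfolding inj_def forall_4 using ne by (auto simp: conjugate_pairs_def)
  have cp: "charpoly A \<noteq> 0" using ab(1) by (auto simp: eigenvalues_def)
  have mem: "conjugate_pairs a b i \<in># eigenvalues A" for i
    unfolding ab(1) conjugate_pairs_def by simp
  have alg: "alg_mult A (conjugate_pairs a b i) = 1" for i
  proof -
    have "alg_mult A (conjugate_pairs a b i) = count (eigenvalues A) (conjugate_pairs a b i)"
      using cp by (simp add: alg_mult_def eigenvalues_def)
    also have "\<dots> = 1" unfolding ab(1) using ne exhaust_4[of i] by (auto simp: conjugate_pairs_def)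
    finally show ?thesis .
  qed
  have "geom_mult A (conjugate_pairs a b i) = 1" for i
    by (rule geom_mult_simple_spectrum[OF inj]) (simp add: eigenvalue_iff_mem[OF cp] mem)
  then show thesis using that[of a b] ab alg image_conjugate_pairs by simp
qed

lemma different_pairs_same_configuration:
  assumes "different_pairs A p q" "different_pairs B p q"
  shows "same_configuration A B"
proof -
  obtain a b where A: "image_mset (conjugate_pairs a b) (mset_set UNIV) = eigenvalues A" "Im a \<noteq> 0" "Im b \<noteq> 0"
    "sgn (Re a) = p" "sgn (Re b) = q" "\<And>i. alg_mult A (conjugate_pairs a b i) = 1" "\<And>i. geom_mult A (conjugate_pairs a b i) = 1"
    using different_pairs_simple[OF assms(1)] by blast
  obtain c d where B: "image_mset (conjugate_pairs c d) (mset_set UNIV) = eigenvalues B" "Im c \<noteq> 0" "Im d \<noteq> 0"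
    "sgn (Re c) = p" "sgn (Re d) = q" "\<And>i. alg_mult B (conjugate_pairs c d i) = 1" "\<And>i. geom_mult B (conjugate_pairs c d i) = 1"
    using different_pairs_simple[OF assms(2)] by blast
  have st: "same_type x y" if "sgn (Re x) = sgn (Re y)" "Im x \<noteq> 0" "Im y \<noteq> 0" for x y
    using that unfolding same_type_def by (metis sgn_0_0)
  have "same_type (conjugate_pairs a b i) (conjugate_pairs c d i)" for i
    using A(2-5) B(2-5) by (auto simp: conjugate_pairs_def intro!: st)
  then show ?thesis
    unfolding same_configuration_def using A B
    by (intro exI[of _ "conjugate_pairs a b"] exI[of _ "conjugate_pairs c d"] exI[of _ id]) simp
qed

lemma same_configuration_refl:
  fixes A :: "complex^4^4"
  assumes "double_pair A p"
  shows "same_configuration A A"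
proof -
  obtain a where a: "eigenvalues A = {#a, cnj a, a, cnj a#}" "Im a \<noteq> 0"
    using assms unfolding double_pair_def by blast
  have "same_type x x" for x by (auto simp: same_type_def complex_eq_iff)
  then show ?thesis
    unfolding same_configuration_def using a
    by (intro exI[of _ "conjugate_pairs a a"] exI[of _ id]) (simp add: image_conjugate_pairs)
qed

section \<open>The spectrum of the unfolding\<close>

lemma H_r_nth:
  "H_r e x $ 1 = vector [x$1, x$4, x$3 + e, x$2]"
  "H_r e x $ 2 = vector [- x$4, x$1, - x$2, e - x$3]"
  "H_r e x $ 3 = vector [- x$3 - e, - x$2, x$1, x$4]"
  "H_r e x $ 4 = vector [x$2, x$3 - e, - x$4, x$1]"
  by (simp_all add: vec4_eq_iff H_r_def M1_def M4_def M5_def M6_def M8_def block_matrix_def I2_def R2_def J2_def)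

lemma complexify_nth: "complexify A $ i $ j = of_real (A $ i $ j)"
  by (simp add: complexify_def map_matrix_def)

definition disc_root :: "real^4 \<Rightarrow> complex" where
  "disc_root x = csqrt (disc x)"

lemma disc_root: "(disc_root x)\<^sup>2 = disc x" "Re (disc_root x) \<ge> 0"
  unfolding disc_root_def by (rule power2_csqrt, rule Re_csqrt)

lemma disc_root_eq_0_iff: "disc_root x = 0 \<longleftrightarrow> disc x = 0"
  by (metis disc_root(1) power_eq_0_iff zero_less_numeral)

lemma rho2_eq: "rho2 x = (Re (disc_root x))\<^sup>2"
proof -
  let ?w = "disc_root x"
  have "cmod (disc x) = (cmod ?w)\<^sup>2" by (metis disc_root(1) norm_power)
  moreover have "Re (disc x) = (Re ?w)\<^sup>2 - (Im ?w)\<^sup>2" by (metis disc_root(1) Re_power2)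
  ultimately show ?thesis by (simp add: rho2_def cmod_power2)
qed

definition root_plus :: "real \<Rightarrow> real^4 \<Rightarrow> complex" where
  "root_plus e x = of_real (x$1) + \<i> * of_real e + disc_root x"

definition root_minus :: "real \<Rightarrow> real^4 \<Rightarrow> complex" where
  "root_minus e x = of_real (x$1) + \<i> * of_real e - disc_root x"

text \<open>
  With \<open>z = t - x$1\<close> and real parameters the determinant is a sum of two squares \<open>p\<^sup>2 + q\<^sup>2\<close>. It factors as
  \<open>(p - \<i> q) (p + \<i> q)\<close>, and \<open>p - \<i> q = (z - \<i> e)\<^sup>2 - disc x\<close>: the two factors belong to the two eigenspaces
  of \<open>M5\<close>.
\<close>

lemma poly_charpoly_H_r:
  "poly (charpoly (complexify (H_r e x))) t =
    (t - root_plus e x) * (t - cnj (root_plus e x)) * ((t - root_minus e x) * (t - cnj (root_minus e x)))"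
proof -
  let ?w = "disc_root x"
  define z a b c d where "z = t - of_real (x$1)" and "a = complex_of_real (x$3)" and "b = complex_of_real (x$2)"
    and "c = complex_of_real (x$4)" and "d = complex_of_real e"
  have w: "?w\<^sup>2 = b\<^sup>2 - a\<^sup>2 - c\<^sup>2 - 2 * \<i> * b * c"
    unfolding disc_root(1) by (simp add: disc_def complex_eq_iff a_def b_def c_def power2_eq_square)
  have cw: "(cnj ?w)\<^sup>2 = b\<^sup>2 - a\<^sup>2 - c\<^sup>2 + 2 * \<i> * b * c"
    by (simp only: complex_cnj_power[symmetric] disc_root(1))
       (simp add: disc_def complex_eq_iff a_def b_def c_def power2_eq_square)
  have m: "mat t - complexify (H_r e x) = vector [
      vector [z, - c, - a - d, - b], vector [c, z, b, a - d],
      vector [a + d, b, z, - c], vector [- b, d - a, c, z]]"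
    by (simp add: vec4_eq_iff complexify_nth H_r_nth mat_def z_def a_def b_def c_def d_def)
  have "det (mat t - complexify (H_r e x)) =
      (z\<^sup>2 - d\<^sup>2 - (b\<^sup>2 - a\<^sup>2 - c\<^sup>2))\<^sup>2 + (2 * z * d - 2 * b * c)\<^sup>2"
    unfolding m det_4 by (simp add: algebra_simps power2_eq_square)
  also have "\<dots> = ((z - \<i> * d)\<^sup>2 - (b\<^sup>2 - a\<^sup>2 - c\<^sup>2 - 2 * \<i> * b * c)) *
      ((z + \<i> * d)\<^sup>2 - (b\<^sup>2 - a\<^sup>2 - c\<^sup>2 + 2 * \<i> * b * c))"
  proof -
    have "(z - \<i> * d)\<^sup>2 - (b\<^sup>2 - a\<^sup>2 - c\<^sup>2 - 2 * \<i> * b * c) =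
        (z\<^sup>2 - d\<^sup>2 - (b\<^sup>2 - a\<^sup>2 - c\<^sup>2)) - \<i> * (2 * z * d - 2 * b * c)"
      "(z + \<i> * d)\<^sup>2 - (b\<^sup>2 - a\<^sup>2 - c\<^sup>2 + 2 * \<i> * b * c) =
        (z\<^sup>2 - d\<^sup>2 - (b\<^sup>2 - a\<^sup>2 - c\<^sup>2)) + \<i> * (2 * z * d - 2 * b * c)"
      by (simp_all add: power2_eq_square algebra_simps)
    moreover have "(p - \<i> * q) * (p + \<i> * q) = p\<^sup>2 + q\<^sup>2" for p q
      by (simp add: power2_eq_square algebra_simps)
    ultimately show ?thesis by (simp only:)
  qed
  also have "\<dots> = ((z - \<i> * d)\<^sup>2 - ?w\<^sup>2) * ((z + \<i> * d)\<^sup>2 - (cnj ?w)\<^sup>2)" by (simp only: w cw)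
  also have "\<dots> = ((z - \<i> * d) - ?w) * ((z + \<i> * d) - cnj ?w) * (((z - \<i> * d) + ?w) * ((z + \<i> * d) + cnj ?w))"
    by (simp add: power2_eq_square algebra_simps)
  also have "\<dots> = (t - root_plus e x) * (t - cnj (root_plus e x)) * ((t - root_minus e x) * (t - cnj (root_minus e x)))"
    by (simp add: root_plus_def root_minus_def z_def d_def algebra_simps)
  finally show ?thesis by (simp only: poly_charpoly)
qed

lemma charpoly_H_r:
  "charpoly (complexify (H_r e x)) =
    [:- root_plus e x, 1:] * [:- cnj (root_plus e x), 1:] * ([:- root_minus e x, 1:] * [:- cnj (root_minus e x), 1:])"
  unfolding poly_eq_poly_eq_iff[symmetric] fun_eq_iff
  by (simp add: poly_charpoly_H_r del: mult_pCons_left mult_pCons_right)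

lemma eigenvalues_H_r:
  "eigenvalues (complexify (H_r e x)) = {#root_plus e x, cnj (root_plus e x), root_minus e x, cnj (root_minus e x)#}"
  unfolding eigenvalues_def charpoly_H_r by (simp add: proots_mult del: mult_pCons_left mult_pCons_right)

lemma eigenvalue_H_r_iff:
  "eigenvalue (complexify (H_r e x)) t \<longleftrightarrow>
    t \<in> {root_plus e x, cnj (root_plus e x), root_minus e x, cnj (root_minus e x)}"
  unfolding eigenvalue_iff_root poly_charpoly_H_r by auto

text \<open>
  If \<open>\<bar>e\<bar> \<le> 1\<close>, then at \<open>\<nu> = (sqrt (1 - e\<^sup>2), 0, e, 0)\<close> the diagonal blocks of \<open>H_r\<close> are scalar and the
  off-diagonal ones are \<open>\<plusminus> e (R + I)\<close>, which annihilates the second basis vector of the plane. So the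
  second basis vector of the space is an eigenvector for the scalar.
\<close>

lemma no_real_eigenvalue_bound:
  assumes "\<forall>\<nu>. norm \<nu> = 1 \<longrightarrow> (\<forall>r. \<not> eigenvalue (H_r e \<nu>) r)"
  shows "\<bar>e\<bar> > 1"
proof (rule ccontr)
  assume "\<not> \<bar>e\<bar> > 1"
  then have "e\<^sup>2 \<le> 1" by (simp add: abs_square_le_1)
  define \<nu> :: "real^4" where "\<nu> = vector [sqrt (1 - e\<^sup>2), 0, e, 0]"
  define v :: "real^4" where "v = vector [0, 1, 0, 0]"
  have "norm \<nu> = 1" using \<open>e\<^sup>2 \<le> 1\<close> by (simp add: norm_4_eq_1 \<nu>_def)
  moreover have "H_r e \<nu> *v v = sqrt (1 - e\<^sup>2) *s v"
    by (simp add: vec4_eq_iff matrix_vector_mult_def sum_4 H_r_nth \<nu>_def v_def)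
  moreover have "v \<noteq> 0" by (simp add: vec4_eq_iff v_def)
  ultimately show False using assms unfolding eigenvalue_def by blast
qed

lemma cmod_disc_le: "cmod (disc x) \<le> (x$2)\<^sup>2 + (x$3)\<^sup>2 + (x$4)\<^sup>2"
proof -
  let ?a = "(x$3)\<^sup>2" and ?b = "(x$2)\<^sup>2" and ?c = "(x$4)\<^sup>2"
  have "(cmod (disc x))\<^sup>2 = (?b - ?a - ?c)\<^sup>2 + 4 * ?b * ?c"
    by (simp add: cmod_power2 disc_def power_mult_distrib)
  also have "\<dots> \<le> (?b + ?a + ?c)\<^sup>2"
  proof -
    have "(?b + ?a + ?c)\<^sup>2 - ((?b - ?a - ?c)\<^sup>2 + 4 * ?b * ?c) = 4 * ?b * ?a"
      by (simp add: power2_eq_square[of "_ + _"] power2_eq_square[of "_ - _"] algebra_simps)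
    moreover have "4 * ?b * ?a \<ge> 0" by simp
    ultimately show ?thesis by linarith
  qed
  finally show ?thesis by (rule power2_le_imp_le) simp
qed

text \<open>
  \<open>\<bar>Im w\<bar> \<le> 1 < \<bar>e\<bar>\<close>, so \<open>e \<plusminus> Im w\<close> has the sign of \<open>e\<close>.
\<close>

lemma Im_roots:
  assumes e: "\<bar>e\<bar> > 1" and x: "x \<in> Sphere3"
  shows "Im (root_plus e x) * e > 0" "Im (root_minus e x) * e > 0"
proof -
  let ?w = "disc_root x"
  have "(cmod ?w)\<^sup>2 = cmod (disc x)" by (metis disc_root(1) norm_power)
  also have "\<dots> \<le> 1" using cmod_disc_le[of x] x zero_le_power2[of "x$1"] unfolding mem_sphere_4 by linarith
  finally have "cmod ?w \<le> 1" by (simp add: abs_square_le_1)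
  then have w: "\<bar>Im ?w\<bar> < \<bar>e\<bar>" using abs_Im_le_cmod[of ?w] e by linarith
  have r: "Im (root_plus e x) = e + Im ?w" "Im (root_minus e x) = e - Im ?w"
    by (simp_all add: root_plus_def root_minus_def)
  consider "e > 0" | "e < 0" using e by linarith
  then show "Im (root_plus e x) * e > 0" "Im (root_minus e x) * e > 0"
    unfolding r using w by (cases; auto intro!: mult_pos_pos mult_neg_neg)+
qed

lemma disc_eq_0_iff: "disc x = 0 \<longleftrightarrow> x$4 = 0 \<and> (x$2)\<^sup>2 = (x$3)\<^sup>2"
proof
  assume "disc x = 0"
  then have h: "(x$2)\<^sup>2 - (x$3)\<^sup>2 - (x$4)\<^sup>2 = 0" "x$2 * x$4 = 0" by (auto simp: disc_def complex_eq_iff)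
  show "x$4 = 0 \<and> (x$2)\<^sup>2 = (x$3)\<^sup>2"
  proof (cases "x$4 = 0")
    case False
    then have "x$2 = 0" using h by simp
    then have "(x$3)\<^sup>2 + (x$4)\<^sup>2 = 0" using h(1) by (simp only: power_zero_numeral)
    then show ?thesis using False by (simp add: sum_power2_eq_zero_iff)
  qed (use h in simp)
qed (auto simp: disc_def complex_eq_iff)

text \<open>
  The imaginary parts of the two roots have the same sign, so neither root is the conjugate of the other,
  and the roots differ by \<open>2 w\<close>. Both orders of the pairs are provided because the code of a stratum
  lists its signs in a fixed order.
\<close>

lemma different_pairs_H_r:
  assumes e: "\<bar>e\<bar> > 1" and x: "x \<in> Sphere3" and d: "disc x \<noteq> 0"
  shows "different_pairs (complexify (H_r e x)) (sgn (x$1 + Re (disc_root x))) (sgn (x$1 - Re (disc_root x)))"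
    "different_pairs (complexify (H_r e x)) (sgn (x$1 - Re (disc_root x))) (sgn (x$1 + Re (disc_root x)))"
proof -
  let ?a = "root_plus e x" and ?b = "root_minus e x"
  have im: "Im ?a * e > 0" "Im ?b * e > 0" using Im_roots[OF e x] .
  have nz: "Im ?a \<noteq> 0" "Im ?b \<noteq> 0" using im by auto
  have "?a \<noteq> ?b"
  proof
    assume "?a = ?b"
    then have "disc_root x = 0" by (simp add: root_plus_def root_minus_def)
    then show False using d by (simp add: disc_root_eq_0_iff)
  qed
  moreover have "?a \<noteq> cnj ?b"
  proof
    assume "?a = cnj ?b"
    then have "Im ?a = - Im ?b" by simp
    then show False using im by simp
  qed
  ultimately have ne: "{?a, cnj ?a} \<noteq> {?b, cnj ?b}" by (metis insertCI insertE singletonD)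
  have re: "Re ?a = x$1 + Re (disc_root x)" "Re ?b = x$1 - Re (disc_root x)"
    by (simp_all add: root_plus_def root_minus_def)
  show "different_pairs (complexify (H_r e x)) (sgn (x$1 + Re (disc_root x))) (sgn (x$1 - Re (disc_root x)))"
    unfolding different_pairs_def
    by (intro exI[of _ ?a] exI[of _ ?b] conjI eigenvalues_H_r nz ne) (simp_all add: re)
  show "different_pairs (complexify (H_r e x)) (sgn (x$1 - Re (disc_root x))) (sgn (x$1 + Re (disc_root x)))"
    unfolding different_pairs_def
    by (intro exI[of _ ?b] exI[of _ ?a] conjI nz ne[symmetric]) (simp_all add: re eigenvalues_H_r add_mset_commute)
qed

lemma double_pair_H_r:
  assumes e: "\<bar>e\<bar> > 1" and x: "x \<in> Sphere3" and d: "disc x = 0"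
  shows "double_pair (complexify (H_r e x)) (sgn (x$1))"
proof -
  let ?a = "of_real (x$1) + \<i> * of_real e"
  have "root_plus e x = ?a" "root_minus e x = ?a" using d by (simp_all add: root_plus_def root_minus_def disc_root_eq_0_iff)
  then show ?thesis
    unfolding double_pair_def using eigenvalues_H_r[of e x] e by (intro exI[of _ ?a]) auto
qed

lemma rho_signs:
  defines "r x \<equiv> Re (disc_root x)"
  shows "r x \<ge> 0" "gap x = (x$1 + r x) * (x$1 - r x)"
proof -
  show "r x \<ge> 0" unfolding r_def by (rule disc_root)
  show "gap x = (x$1 + r x) * (x$1 - r x)"
    by (simp add: gap_def rho2_eq r_def power2_eq_square algebra_simps)
qed

section \<open>Nilpotent and semisimple parts\<close>

lemma matrix_inv_eqI:
  fixes Q P :: "'a::comm_ring_1^'n^'n"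
  assumes "Q ** P = mat 1" "P ** Q = mat 1"
  shows "matrix_inv Q = P"
proof -
  have "Q ** matrix_inv Q = mat 1"
    unfolding matrix_inv_def using someI[of "\<lambda>P. Q ** P = mat 1 \<and> P ** Q = mat 1" P] assms by auto
  then have "P ** (Q ** matrix_inv Q) = P" by simp
  then show ?thesis using assms(2) by (simp add: matrix_mul_assoc)
qed

text \<open>
  Here \<open>H_r\<close> is \<open>s + e M5\<close>, and \<open>Q\<close> has the eigenvectors of \<open>M5\<close> as columns.
\<close>

lemma semisimple_circulation: "semisimple (complexify (H_r e (vector [s, 0, 0, 0])))"
proof -
  define Q :: "complex^4^4" where
    "Q = vector [vector [1, 0, 1, 0], vector [0, 1, 0, 1], vector [\<i>, 0, - \<i>, 0], vector [0, \<i>, 0, - \<i>]]"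
  define P :: "complex^4^4" where
    "P = vector [vector [1/2, 0, - \<i>/2, 0], vector [0, 1/2, 0, - \<i>/2], vector [1/2, 0, \<i>/2, 0], vector [0, 1/2, 0, \<i>/2]]"
  define l m where "l = of_real s + \<i> * of_real e" and "m = of_real s - \<i> * of_real e"
  define D :: "complex^4^4" where
    "D = vector [vector [l, 0, 0, 0], vector [0, l, 0, 0], vector [0, 0, m, 0], vector [0, 0, 0, m]]"
  have QP: "Q ** P = mat 1" "P ** Q = mat 1"
    by (simp_all add: vec4_eq_iff matrix_matrix_mult_def sum_4 mat_def Q_def P_def)
  have "\<forall>i j. i \<noteq> j \<longrightarrow> D$i$j = 0" by (simp add: forall_4 D_def)
  moreover have "complexify (H_r e (vector [s, 0, 0, 0])) = Q ** D ** P"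
    by (simp add: vec4_eq_iff matrix_matrix_mult_def sum_4 Q_def P_def D_def complexify_nth H_r_nth l_def m_def field_simps)
  moreover have "invertible Q" using QP by (auto simp: invertible_def)
  ultimately show ?thesis unfolding semisimple_def using matrix_inv_eqI[OF QP] by metis
qed

text \<open>
  The summands \<open>x$2 M4 + x$3 M6\<close> have square \<open>disc x = 0\<close>, and they commute with \<open>M1\<close> and \<open>M5\<close>.
\<close>

lemma nilpotent_part_H_r:
  assumes "disc x = 0" "x$2 \<noteq> 0"
  shows "nilpotent_part_height2 (complexify (H_r e x))"
proof -
  have x: "x$4 = 0" "x$2 * x$2 = x$3 * x$3" using assms(1) by (auto simp: disc_eq_0_iff power2_eq_square)
  let ?D = "complexify (H_r e (vector [x$1, 0, 0, 0]))"
  define N where "N = complexify (H_r 0 (vector [0, x$2, x$3, 0]))"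
  have sq: "complex_of_real (x$2) * of_real (x$2) = of_real (x$3) * of_real (x$3)"
    using x(2) by (simp flip: of_real_mult)
  have "complexify (H_r e x) = ?D + N"
    using x by (simp add: vec4_eq_iff complexify_nth H_r_nth N_def)
  moreover have "?D ** N = N ** ?D"
    by (simp add: vec4_eq_iff matrix_matrix_mult_def sum_4 complexify_nth H_r_nth N_def algebra_simps)
  moreover have "N ** N = 0"
    using sq by (simp add: vec4_eq_iff matrix_matrix_mult_def sum_4 complexify_nth H_r_nth N_def algebra_simps)
  moreover have "N \<noteq> 0"
  proof
    assume "N = 0"
    then have "N$1$4 = 0" by simp
    then show False using assms(2) by (simp add: N_def complexify_nth H_r_nth)
  qed
  ultimately show ?thesis unfolding nilpotent_part_height2_def using semisimple_circulation by blast
qed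

section \<open>Eigenvalue configurations on the strata\<close>

lemma collision_locus_iff: "x \<in> collision_locus \<longleftrightarrow> x$1 \<noteq> 0 \<and> disc x = 0"
  by (auto simp: collision_locus_def disc_eq_0_iff)

lemma configuration_Definite_cell:
  assumes e: "\<bar>e\<bar> > 1" and a: "\<bar>a\<bar> = 1" and x: "x \<in> Definite_cell a"
  shows "sgn (x$1 + Re (disc_root x)) = a \<and> sgn (x$1 - Re (disc_root x)) = a"
    "x \<notin> collision_locus \<Longrightarrow> different_pairs (complexify (H_r e x)) a a"
    "x \<in> collision_locus \<Longrightarrow> collided (complexify (H_r e x)) x a"
proof -
  let ?r = "Re (disc_root x)"
  have S: "x \<in> Sphere3" "gap x > 0" "a * x$1 > 0" using x by (auto simp: Definite_cell_def)
  have r: "?r \<ge> 0" "(x$1 + ?r) * (x$1 - ?r) > 0" using rho_signs[of x] S(2) by auto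
  have "a = 1 \<or> a = -1" using a by (auto simp: abs_if split: if_splits)
  then have pos: "a * (x$1 + ?r) > 0 \<and> a * (x$1 - ?r) > 0"
    using r S(3) by (auto simp: zero_less_mult_iff)
  then show s: "sgn (x$1 + ?r) = a \<and> sgn (x$1 - ?r) = a" by (simp only: sgn_eq_iff[OF a])
  have sx: "sgn (x$1) = a" using S(3) sgn_eq_iff[OF a] by simp
  have x1: "x$1 \<noteq> 0" using S(3) by auto
  show "different_pairs (complexify (H_r e x)) a a" if "x \<notin> collision_locus"
  proof -
    have "disc x \<noteq> 0" using that x1 by (simp add: collision_locus_iff)
    from different_pairs_H_r(1)[OF e S(1) this] show ?thesis using s by simp
  qed
  show "collided (complexify (H_r e x)) x a" if "x \<in> collision_locus"
  proof -
    have d: "disc x = 0" using that by (simp add: collision_locus_iff)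
    have "semisimple (complexify (H_r e x))" if "x$2 = 0"
    proof -
      have "x = vector [x$1, 0, 0, 0]" using that d by (simp add: vec4_eq_iff disc_eq_0_iff)
      then show ?thesis using semisimple_circulation by metis
    qed
    then show ?thesis
      unfolding collided_def using double_pair_H_r[OF e S(1) d] nilpotent_part_H_r[OF d] sx by simp
  qed
qed

lemma configuration_Mixed_cell:
  assumes e: "\<bar>e\<bar> > 1" and x: "x \<in> Mixed_cell b"
  shows "different_pairs (complexify (H_r e x)) 1 (-1)"
proof -
  let ?r = "Re (disc_root x)"
  have S: "x \<in> Sphere3" "gap x < 0" using x by (auto simp: Mixed_cell_def)
  have r: "?r \<ge> 0" "(x$1 + ?r) * (x$1 - ?r) < 0" using rho_signs[of x] S(2) by auto
  then have s: "x$1 + ?r > 0" "x$1 - ?r < 0" by (auto simp: mult_less_0_iff)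
  then have "disc x \<noteq> 0" using disc_root_eq_0_iff[of x] by auto
  from different_pairs_H_r(1)[OF e S(1) this] show ?thesis using s by simp
qed

text \<open>
  One of \<open>x$1 \<plusminus> \<rho>\<close> vanishes, and the other one is \<open>2 x$1\<close>.
\<close>

lemma configuration_Surf:
  assumes e: "\<bar>e\<bar> > 1" and a: "\<bar>a\<bar> = 1" and x: "x \<in> Surf a b"
  shows "different_pairs (complexify (H_r e x)) 0 a"
proof -
  let ?r = "Re (disc_root x)"
  have S: "x \<in> Sphere3" "gap x = 0" "a * x$1 > 0" using x by (auto simp: Surf_def)
  have r: "?r \<ge> 0" "x$1 + ?r = 0 \<or> x$1 - ?r = 0" using rho_signs[of x] S(2) by auto
  have "x$1 \<noteq> 0" using S(3) by auto
  then have "disc x \<noteq> 0" using r disc_root_eq_0_iff[of x] by auto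
  note dp = different_pairs_H_r[OF e S(1) this]
  have "a = 1 \<or> a = -1" using a by (auto simp: abs_if split: if_splits)
  then consider "a = 1" "x$1 > 0" | "a = -1" "x$1 < 0" using S(3) by auto
  then show ?thesis
  proof cases
    case 1
    then have "x$1 - ?r = 0" "x$1 + ?r > 0" using r by auto
    then show ?thesis using dp(2) 1 by simp
  next
    case 2
    then have "x$1 + ?r = 0" "x$1 - ?r < 0" using r by auto
    then show ?thesis using dp(1) 2 by simp
  qed
qed

text \<open>
  Both real parts vanish, since \<open>x$1 = gap x = 0\<close>. On the sphere \<open>disc x = 0\<close> would require
  \<open>x$4 = 0\<close> and \<open>(x$2)\<^sup>2 = (x$3)\<^sup>2 = 1/2\<close>, which happens only at the pinch points.
\<close>

lemma configuration_equatorial_curves: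
  assumes e: "\<bar>e\<bar> > 1" and x: "x \<in> Double_arc b c \<union> Half_circle c \<union> Pole c" and b: "\<bar>b\<bar> = 1"
  shows "different_pairs (complexify (H_r e x)) 0 0"
proof -
  have S: "x \<in> Sphere3" "x$1 = 0" using x by (auto simp: Double_arc_def Half_circle_def Pole_def)
  have n: "(x$2)\<^sup>2 + (x$3)\<^sup>2 + (x$4)\<^sup>2 = 1" using S by (simp add: norm_4_eq_1)
  have small: "(x$2)\<^sup>2 < 1/2" if "x \<in> Double_arc b c"
    using that abs_le_half_sqrt2(1)[OF b, of "x$2"] by (simp add: Double_arc_def)
  have "x$2 = 0 \<or> x$4 = 0 \<and> (x$2)\<^sup>2 < 1/2"
    using x small by (auto simp: Half_circle_def Pole_def Double_arc_def)
  then have "gap x = 0" and d: "disc x \<noteq> 0"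
    using equator_facts(2)[OF S] n by (auto simp: disc_eq_0_iff)
  then have "Re (disc_root x) = 0" using rho_signs[of x] S by simp
  then show ?thesis using different_pairs_H_r(1)[OF e S(1) d] S by simp
qed

lemma configuration_Pinch:
  assumes e: "\<bar>e\<bar> > 1" and x: "x \<in> Pinch b c" and b: "\<bar>b\<bar> = 1"
  shows "double_pair (complexify (H_r e x)) 0" "nilpotent_part_height2 (complexify (H_r e x))"
proof -
  have S: "x \<in> Sphere3" "x$1 = 0" "x$4 = 0" and bx: "b * x$2 = sqrt 2 / 2"
    using x by (auto simp: Pinch_def)
  have pos: "b * x$2 > 0" using bx half_sqrt2(2) by metis
  have "(x$2)\<^sup>2 = 1/2" using abs_le_half_sqrt2(2)[OF b pos] bx by (rule iffD1)
  moreover have "x$2 \<noteq> 0" using pos by auto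
  moreover from calculation have "(x$3)\<^sup>2 = 1/2" using S by (simp add: norm_4_eq_1)
  ultimately have d: "disc x = 0" "x$2 \<noteq> 0" using S by (auto simp: disc_eq_0_iff)
  show "double_pair (complexify (H_r e x)) 0" using double_pair_H_r[OF e S(1) d(1)] S by simp
  show "nilpotent_part_height2 (complexify (H_r e x))" by (rule nilpotent_part_H_r[OF d])
qed

lemma same_configuration_on_strata:
  assumes e: "\<bar>e\<bar> > 1" and X: "X \<in> strata" and x: "x \<in> X - collision_locus" "y \<in> X - collision_locus"
  shows "same_configuration (complexify (H_r e x)) (complexify (H_r e y))"
proof -
  let ?C = "\<lambda>x. complexify (H_r e x)"
  have "\<forall>x\<in>X - collision_locus. \<forall>y\<in>X - collision_locus. same_configuration (?C x) (?C y)"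
    using X
  proof (rule strata_shape_induct)
    fix a b :: real assume a: "\<bar>a\<bar> = 1" and b: "\<bar>b\<bar> = 1"
    show "\<forall>x\<in>Surf a b - collision_locus. \<forall>y\<in>Surf a b - collision_locus. same_configuration (?C x) (?C y)"
      using configuration_Surf[OF e a] by (blast intro: different_pairs_same_configuration)
    show "\<forall>x\<in>Double_arc a b - collision_locus. \<forall>y\<in>Double_arc a b - collision_locus. same_configuration (?C x) (?C y)"
      using configuration_equatorial_curves[OF e _ a, of _ b] by (blast intro: different_pairs_same_configuration)
    show "\<forall>x\<in>Pinch a b - collision_locus. \<forall>y\<in>Pinch a b - collision_locus. same_configuration (?C x) (?C y)"
    proof (intro ballI)
      fix x y assume "x \<in> Pinch a b - collision_locus" "y \<in> Pinch a b - collision_locus"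
      then have "x \<in> Pinch a b" "y = x" unfolding Pinch_eq[OF a b] by auto
      then show "same_configuration (?C x) (?C y)"
        using same_configuration_refl[OF configuration_Pinch(1)[OF e _ a]] by simp
    qed
  next
    fix a :: real assume a: "\<bar>a\<bar> = 1"
    show "\<forall>x\<in>Definite_cell a - collision_locus. \<forall>y\<in>Definite_cell a - collision_locus. same_configuration (?C x) (?C y)"
      using configuration_Definite_cell(2)[OF e a] by (blast intro: different_pairs_same_configuration)
    show "\<forall>x\<in>Mixed_cell a - collision_locus. \<forall>y\<in>Mixed_cell a - collision_locus. same_configuration (?C x) (?C y)"
      using configuration_Mixed_cell[OF e] by (blast intro: different_pairs_same_configuration)
    show "\<forall>x\<in>Half_circle a - collision_locus. \<forall>y\<in>Half_circle a - collision_locus. same_configuration (?C x) (?C y)"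
      using configuration_equatorial_curves[OF e _ a, of _ a] by (blast intro: different_pairs_same_configuration)
    show "\<forall>x\<in>Pole a - collision_locus. \<forall>y\<in>Pole a - collision_locus. same_configuration (?C x) (?C y)"
      using configuration_equatorial_curves[OF e _ a, of _ a] by (blast intro: different_pairs_same_configuration)
  qed
  then show ?thesis using x by blast
qed

lemma stability_domain:
  assumes e: "\<bar>e\<bar> > 1"
  shows "Definite_cell (-1) = {\<nu> \<in> Sphere3. \<forall>t. eigenvalue (complexify (H_r e \<nu>)) t \<longrightarrow> Re t < 0}"
proof -
  have re: "Re (root_plus e x) = x$1 + Re (disc_root x)" "Re (root_minus e x) = x$1 - Re (disc_root x)" for x
    by (simp_all add: root_plus_def root_minus_def)
  have "(\<forall>t. eigenvalue (complexify (H_r e x)) t \<longrightarrow> Re t < 0) \<longleftrightarrow>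
      x$1 + Re (disc_root x) < 0 \<and> x$1 - Re (disc_root x) < 0" for x
    unfolding eigenvalue_H_r_iff by (auto simp: re)
  moreover have "x$1 + Re (disc_root x) < 0 \<and> x$1 - Re (disc_root x) < 0 \<longleftrightarrow> gap x > 0 \<and> -1 * x$1 > 0" for x
    using rho_signs[of x] by (auto simp: zero_less_mult_iff)
  ultimately show ?thesis unfolding Definite_cell_def by simp
qed

theorem theorem2p5:
  fixes nu5 :: real
  assumes "nu5 \<noteq> 0"
    and "\<forall>\<nu>. norm \<nu> = 1 \<longrightarrow> (\<forall>r. \<not> eigenvalue (H_r nu5 \<nu>) r)"
  shows
    \<comment> \<open>(i)\<close>
    "whitney_stratification Sphere3 strata \<and>
    \<comment> \<open>(ii)\<close>
     incidences 0 strata =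
       {(P1, L1), (P5, L1), (P2, L2), (P5, L2), (P3, L3), (P6, L3), (P4, L4), (P6, L4),
        (P5, L5), (P6, L5), (P5, L6), (P6, L6)} \<and>
     incidences 1 strata =
       {L1, L3} \<times> {S1, S3} \<union> {L2, L4} \<times> {S2, S4} \<union> {L5, L6} \<times> {S1, S2, S3, S4} \<and>
     incidences 2 strata =
       {S1, S4} \<times> {V1} \<union> {S1, S3} \<times> {V2} \<union> {S2, S3} \<times> {V3} \<union> {S2, S4} \<times> {V4} \<and>
    \<comment> \<open>(iii)\<close>
     critical_surface - handles = S_plus \<union> S_minus \<and>
     whitney_stratification (critical_surface - handles) critical_strata \<and>
    \<comment> \<open>(iv)\<close>
     (\<forall>X\<in>strata. \<forall>\<nu>\<in>X - collision_locus. \<forall>\<mu>\<in>X - collision_locus.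
        same_configuration (complexify (H_r nu5 \<nu>)) (complexify (H_r nu5 \<mu>))) \<and>
     (\<forall>\<nu>\<in>V1 - collision_locus. different_pairs (complexify (H_r nu5 \<nu>)) 1 1) \<and>
     (\<forall>\<nu>\<in>V1 \<inter> collision_locus. collided (complexify (H_r nu5 \<nu>)) \<nu> 1) \<and>
     (\<forall>\<nu>\<in>V3 - collision_locus. different_pairs (complexify (H_r nu5 \<nu>)) (-1) (-1)) \<and>
     (\<forall>\<nu>\<in>V3 \<inter> collision_locus. collided (complexify (H_r nu5 \<nu>)) \<nu> (-1)) \<and>
     (\<forall>\<nu>\<in>V2 \<union> V4. different_pairs (complexify (H_r nu5 \<nu>)) 1 (-1)) \<and>
     (\<forall>\<nu>\<in>S1 \<union> S4. different_pairs (complexify (H_r nu5 \<nu>)) 0 1) \<and>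
     (\<forall>\<nu>\<in>S2 \<union> S3. different_pairs (complexify (H_r nu5 \<nu>)) 0 (-1)) \<and>
     (\<forall>\<nu>\<in>L1 \<union> L2 \<union> L3 \<union> L4 \<union> L5 \<union> L6.
        different_pairs (complexify (H_r nu5 \<nu>)) 0 0) \<and>
     (\<forall>\<nu>\<in>P1 \<union> P2 \<union> P3 \<union> P4.
        double_pair (complexify (H_r nu5 \<nu>)) 0 \<and>
        nilpotent_part_height2 (complexify (H_r nu5 \<nu>))) \<and>
     (\<forall>\<nu>\<in>P5 \<union> P6. different_pairs (complexify (H_r nu5 \<nu>)) 0 0) \<and>
    \<comment> \<open>(v)\<close>
     V3 = {\<nu> \<in> Sphere3. \<forall>x. eigenvalue (complexify (H_r nu5 \<nu>)) x \<longrightarrow> Re x < 0}"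
proof -
  have e: "\<bar>nu5\<bar> > 1" using no_real_eigenvalue_bound[OF assms(2)] .
  show ?thesis
  proof (intro conjI)
    show "whitney_stratification Sphere3 strata" by (rule whitney_stratification_strata)
    show "incidences 0 strata =
       {(P1, L1), (P5, L1), (P2, L2), (P5, L2), (P3, L3), (P6, L3), (P4, L4), (P6, L4),
        (P5, L5), (P6, L5), (P5, L6), (P6, L6)}"
      "incidences 1 strata =
       {L1, L3} \<times> {S1, S3} \<union> {L2, L4} \<times> {S2, S4} \<union> {L5, L6} \<times> {S1, S2, S3, S4}"
      "incidences 2 strata =
       {S1, S4} \<times> {V1} \<union> {S1, S3} \<times> {V2} \<union> {S2, S3} \<times> {V3} \<union> {S2, S4} \<times> {V4}"
      by (rule incidences_strata)+
    show "critical_surface - handles = S_plus \<union> S_minus"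
      unfolding critical_surface_minus_handles S_plus_minus ..
    show "whitney_stratification (critical_surface - handles) critical_strata"
      by (rule whitney_stratification_critical_strata)
    show "\<forall>X\<in>strata. \<forall>\<nu>\<in>X - collision_locus. \<forall>\<mu>\<in>X - collision_locus.
        same_configuration (complexify (H_r nu5 \<nu>)) (complexify (H_r nu5 \<mu>))"
      using same_configuration_on_strata[OF e] by blast
    show "\<forall>\<nu>\<in>V1 - collision_locus. different_pairs (complexify (H_r nu5 \<nu>)) 1 1"
      "\<forall>\<nu>\<in>V1 \<inter> collision_locus. collided (complexify (H_r nu5 \<nu>)) \<nu> 1"
      "\<forall>\<nu>\<in>V3 - collision_locus. different_pairs (complexify (H_r nu5 \<nu>)) (-1) (-1)"
      "\<forall>\<nu>\<in>V3 \<inter> collision_locus. collided (complexify (H_r nu5 \<nu>)) \<nu> (-1)"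
      unfolding V_eqs using configuration_Definite_cell[OF e] by simp_all
    show "\<forall>\<nu>\<in>V2 \<union> V4. different_pairs (complexify (H_r nu5 \<nu>)) 1 (-1)"
      unfolding V_eqs using configuration_Mixed_cell[OF e] by blast
    show "\<forall>\<nu>\<in>S1 \<union> S4. different_pairs (complexify (H_r nu5 \<nu>)) 0 1"
      "\<forall>\<nu>\<in>S2 \<union> S3. different_pairs (complexify (H_r nu5 \<nu>)) 0 (-1)"
      unfolding S_eqs using configuration_Surf[OF e, of 1] configuration_Surf[OF e, of "-1"] by auto
    show "\<forall>\<nu>\<in>L1 \<union> L2 \<union> L3 \<union> L4 \<union> L5 \<union> L6. different_pairs (complexify (H_r nu5 \<nu>)) 0 0"
      "\<forall>\<nu>\<in>P5 \<union> P6. different_pairs (complexify (H_r nu5 \<nu>)) 0 0"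
      unfolding L_eqs P_eqs using configuration_equatorial_curves[OF e, of _ 1] configuration_equatorial_curves[OF e, of _ "-1"] by auto
    show "\<forall>\<nu>\<in>P1 \<union> P2 \<union> P3 \<union> P4.
        double_pair (complexify (H_r nu5 \<nu>)) 0 \<and> nilpotent_part_height2 (complexify (H_r nu5 \<nu>))"
      unfolding P_eqs using configuration_Pinch[OF e, of _ 1] configuration_Pinch[OF e, of _ "-1"] by auto
    show "V3 = {\<nu> \<in> Sphere3. \<forall>x. eigenvalue (complexify (H_r nu5 \<nu>)) x \<longrightarrow> Re x < 0}"
      unfolding V_eqs by (rule stability_domain[OF e])
  qed
qed

end
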